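(* Suppose $q$ is not a root of unity. Let $A$ be the subalgebra of $U_{g,h}^{\circ}$ generated by all the coordinate functions of all finite-dimensional simple $U_{g,h}$-modules. Then $A$ is a sub-Hopf algebra of $U_{g,h}^{\circ}$.
   Context: $\mathbb{K}$ is an algebraically closed field of characteristic zero, and $q\in\mathbb{K}$ is nonzero with $q^2\neq 1$. $U_{g,h}$ is the unital associative $\mathbb{K}$-algebra generated by $E,F,K^{\pm1},g^{\pm1},h^{\pm1}$ with relations: $KK^{-1}=K^{-1}K=gg^{-1}=g^{-1}g=hh^{-1}=h^{-1}h=1$; $g$ and $h$ commute with each other and with $E,F,K$; $KEK^{-1}=q^2E$; $KFK^{-1}=q^{-2}F$; $EF-FE=\frac{K-K^{-1}g^2}{q-q^{-1}}$. It is a Hopf algebra with coproduct $\Delta(E)=h^{-1}\otimes E+E\otimes hK$, $\Delta(F)=K^{-1}hg^2\otimes F+F\otimes h^{-1}$, and $K^{\pm1},g^{\pm1},h^{\pm1}$ group-like; counit $\varepsilon(E)=\varepsilon(F)=0$, $\varepsilon(K)=\varepsilon(g)=\varepsilon(h)=1$; antipode $S(E)=-EK^{-1}$, $S(F)=-KFg^{-2}$, $S(K)=K^{-1}$, $S(g)=g^{-1}$, $S(h)=h^{-1}$. For a Hopf algebra $H$, the finite dual Hopf algebra is $H^\circ=\{f\in H^*\mid \ker f \text{ contains an ideal } I \text{ with } \dim H/I<\infty\}$, with its usual Hopf algebra structure. For a left $U_{g,h}$-module $M$, $f\in M^*$ and $v\in M$, the coordinate function $c^M_{f,v}\in U_{g,h}^*$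 is $c^M_{f,v}(x)=f(xv)$ for $x\in U_{g,h}$; if $M$ is finite-dimensional then $c^M_{f,v}\in U_{g,h}^\circ$. *)

theory Defs
  imports
    "HOL-Library.FuncSet"
    "HOL-Library.Poly_Mapping"
    "HOL-Algebra.Algebraic_Closure_Type"
    "HOL-Algebra.QuotRing"
    "HOL-Algebra.Module"
    "HOL-Algebra.Subrings"
begin

section \<open>Algebras and modules over a type of scalars\<close>

text \<open>
  The ground field is a type \<open>'k\<close>.  Vector spaces and algebras over it are records of type
  \<open>('k, 'a) module\<close>; for a vector space that is not an algebra the fields \<open>mult\<close> and \<open>one\<close>
  are irrelevant.  A left module over an algebra \<open>H\<close> is a record whose first type argument is the
  element type of \<open>H\<close>.
\<close>

definition quotient_algebra :: "('k, 'a, 'm) module_scheme \<Rightarrow> 'a set \<Rightarrow> ('k, 'a set) module"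
  where "quotient_algebra H I =
    ring.extend (H Quot I) (module.fields (\<lambda>c C. \<Union>x\<in>C. I +>\<^bsub>H\<^esub> (c \<odot>\<^bsub>H\<^esub> x)))"

definition opposite_algebra :: "('k, 'a, 'm) module_scheme \<Rightarrow> ('k, 'a, 'm) module_scheme"
  where "opposite_algebra H = H\<lparr>monoid.mult := \<lambda>x y. y \<otimes>\<^bsub>H\<^esub> x\<rparr>"

definition scalar_algebra :: "('k::field, 'k) module"
  where "scalar_algebra = ring.extend ring_of_type_algebra (module.fields (*))"

definition fin_dim :: "('k, 'a, 'm) module_scheme \<Rightarrow> bool"
  where "fin_dim V \<longleftrightarrow> (\<exists>B \<subseteq> carrier V. finite B \<and>
    (\<forall>x \<in> carrier V. \<exists>c. x = (\<Oplus>\<^bsub>V\<^esub>b\<in>B. c b \<odot>\<^bsub>V\<^esub> b)))"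

definition dual_space :: "('k::field, 'a, 'm) module_scheme \<Rightarrow> ('a \<Rightarrow> 'k) set"
  where "dual_space V = {f \<in> carrier V \<rightarrow>\<^sub>E UNIV.
    (\<forall>x\<in>carrier V. \<forall>y\<in>carrier V. f (x \<oplus>\<^bsub>V\<^esub> y) = f x + f y) \<and>
    (\<forall>c. \<forall>x\<in>carrier V. f (c \<odot>\<^bsub>V\<^esub> x) = c * f x)}"

definition k_subalgebra :: "'a set \<Rightarrow> ('k, 'a, 'm) module_scheme \<Rightarrow> bool"
  where "k_subalgebra A H \<longleftrightarrow> subring A H \<and> (\<forall>c. \<forall>a\<in>A. c \<odot>\<^bsub>H\<^esub> a \<in> A)"

definition generated_subalgebra :: "('k, 'a, 'm) module_scheme \<Rightarrow> 'a set \<Rightarrow> 'a set"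
  where "generated_subalgebra H S = \<Inter>{A. k_subalgebra A H \<and> S \<subseteq> A}"


section \<open>Free and presented algebras\<close>

datatype 'g word = Word (letters: "'g list")

instantiation word :: (type) monoid_add
begin

definition zero_word :: "'g word"
  where "zero_word = Word []"

definition plus_word :: "'g word \<Rightarrow> 'g word \<Rightarrow> 'g word"
  where "plus_word u v = Word (letters u @ letters v)"

instance
  by standard (simp_all add: zero_word_def plus_word_def)

end

text \<open>
  As words form a monoid under concatenation (written additively), the type \<open>'g word \<Rightarrow>\<^sub>0 'k\<close>
  with its convolution product is the free unital algebra on \<open>'g\<close>.
\<close>

definition free_algebra :: "('k::field, 'g word \<Rightarrow>\<^sub>0 'k) module"
  where "free_algebra = ring.extend ring_of_type_algebra
    (module.fields (\<lambda>c x. Poly_Mapping.single 0 c * x))"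

definition letter :: "'g \<Rightarrow> 'g word \<Rightarrow>\<^sub>0 'k::field"
  where "letter s = Poly_Mapping.single (Word [s]) 1"

definition const :: "'k::field \<Rightarrow> 'g word \<Rightarrow>\<^sub>0 'k"
  where "const c = Poly_Mapping.single 0 c"

definition presented_algebra :: "('g word \<Rightarrow>\<^sub>0 'k::field) set \<Rightarrow> ('k, ('g word \<Rightarrow>\<^sub>0 'k) set) module"
  where "presented_algebra R = quotient_algebra free_algebra (Idl\<^bsub>free_algebra\<^esub> R)"

definition eval_free :: "('k::field, 'b, 'm) module_scheme \<Rightarrow> ('g \<Rightarrow> 'b) \<Rightarrow> ('g word \<Rightarrow>\<^sub>0 'k) \<Rightarrow> 'b"
  where "eval_free B \<phi> x = (\<Oplus>\<^bsub>B\<^esub>w\<in>Poly_Mapping.keys x.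
    Poly_Mapping.lookup x w \<odot>\<^bsub>B\<^esub> foldr (\<lambda>s b. \<phi> s \<otimes>\<^bsub>B\<^esub> b) (letters w) \<one>\<^bsub>B\<^esub>)"

text \<open>
  The homomorphism from a presented algebra to \<open>B\<close> determined by the images \<open>\<phi>\<close> of the
  generators: on a coset it takes the common value of \<open>eval_free B \<phi>\<close> on its representatives.
\<close>

definition induced_hom ::
  "('k::field, 'b, 'm) module_scheme \<Rightarrow> ('g \<Rightarrow> 'b) \<Rightarrow> ('g word \<Rightarrow>\<^sub>0 'k) set \<Rightarrow> 'b"
  where "induced_hom B \<phi> C = the_elem (eval_free B \<phi> ` C)"


section \<open>Tensor products\<close>

text \<open>
  The tensor product of \<open>V\<close> and \<open>W\<close> is the free vector space on \<open>carrier V \<times> carrier W\<close>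
  modulo the span of the bilinearity relations; its elements are cosets.
\<close>

definition tensor_free :: "'a set \<Rightarrow> 'b set \<Rightarrow> (('a \<times> 'b) \<Rightarrow>\<^sub>0 'k::field) set"
  where "tensor_free A B = {x. Poly_Mapping.keys x \<subseteq> A \<times> B}"

definition bilinear_rels ::
  "('k::field, 'a, 'm) module_scheme \<Rightarrow> ('k, 'b, 'n) module_scheme \<Rightarrow> (('a \<times> 'b) \<Rightarrow>\<^sub>0 'k) set"
  where "bilinear_rels V W =
    {Poly_Mapping.single (v \<oplus>\<^bsub>V\<^esub> v', w) 1 - Poly_Mapping.single (v, w) 1
       - Poly_Mapping.single (v', w) 1
     | v v' w. v \<in> carrier V \<and> v' \<in> carrier V \<and> w \<in> carrier W} \<union>
    {Poly_Mapping.single (v, w \<oplus>\<^bsub>W\<^esub> w') 1 - Poly_Mapping.single (v, w) 1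
       - Poly_Mapping.single (v, w') 1
     | v w w'. v \<in> carrier V \<and> w \<in> carrier W \<and> w' \<in> carrier W} \<union>
    {Poly_Mapping.single (c \<odot>\<^bsub>V\<^esub> v, w) 1 - Poly_Mapping.single (v, w) c
     | c v w. v \<in> carrier V \<and> w \<in> carrier W} \<union>
    {Poly_Mapping.single (v, c \<odot>\<^bsub>W\<^esub> w) 1 - Poly_Mapping.single (v, w) c
     | c v w. v \<in> carrier V \<and> w \<in> carrier W}"

definition tensor_null ::
  "('k::field, 'a, 'm) module_scheme \<Rightarrow> ('k, 'b, 'n) module_scheme \<Rightarrow> (('a \<times> 'b) \<Rightarrow>\<^sub>0 'k) set"
  where "tensor_null V W =
    Modules.module.span (\<lambda>c. Poly_Mapping.map ((*) c)) (bilinear_rels V W)"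

definition tensor_class ::
  "('k::field, 'a, 'm) module_scheme \<Rightarrow> ('k, 'b, 'n) module_scheme \<Rightarrow>
    (('a \<times> 'b) \<Rightarrow>\<^sub>0 'k) \<Rightarrow> (('a \<times> 'b) \<Rightarrow>\<^sub>0 'k) set"
  where "tensor_class V W x =
    {y \<in> tensor_free (carrier V) (carrier W). y - x \<in> tensor_null V W}"

definition pure_tensor ::
  "('k::field, 'a, 'm) module_scheme \<Rightarrow> ('k, 'b, 'n) module_scheme \<Rightarrow>
    'a \<Rightarrow> 'b \<Rightarrow> (('a \<times> 'b) \<Rightarrow>\<^sub>0 'k) set"
  where "pure_tensor V W v w = tensor_class V W (Poly_Mapping.single (v, w) 1)"

definition tensor_free_mult ::
  "('k::field, 'a, 'm) module_scheme \<Rightarrow> ('k, 'b, 'n) module_scheme \<Rightarrow>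
    (('a \<times> 'b) \<Rightarrow>\<^sub>0 'k) \<Rightarrow> (('a \<times> 'b) \<Rightarrow>\<^sub>0 'k) \<Rightarrow> (('a \<times> 'b) \<Rightarrow>\<^sub>0 'k)"
  where "tensor_free_mult V W x y =
    (\<Sum>p\<in>Poly_Mapping.keys x. \<Sum>r\<in>Poly_Mapping.keys y.
      Poly_Mapping.single (fst p \<otimes>\<^bsub>V\<^esub> fst r, snd p \<otimes>\<^bsub>W\<^esub> snd r)
        (Poly_Mapping.lookup x p * Poly_Mapping.lookup y r))"

text \<open>
  The product \<open>mult\<close> below, given by \<open>(a \<otimes> b) (c \<otimes> d) = a c \<otimes> b d\<close>, is meaningful when
  \<open>V\<close> and \<open>W\<close> are algebras; otherwise only the vector space structure is.
\<close>

definition tensor ::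
  "('k::field, 'a, 'm) module_scheme \<Rightarrow> ('k, 'b, 'n) module_scheme \<Rightarrow>
    ('k, (('a \<times> 'b) \<Rightarrow>\<^sub>0 'k) set) module"
  where "tensor V W =
    \<lparr>carrier = tensor_class V W ` tensor_free (carrier V) (carrier W),
     monoid.mult = (\<lambda>C D. \<Union>x\<in>C. \<Union>y\<in>D. tensor_class V W (tensor_free_mult V W x y)),
     one = pure_tensor V W \<one>\<^bsub>V\<^esub> \<one>\<^bsub>W\<^esub>,
     ring.zero = tensor_class V W 0,
     add = (\<lambda>C D. \<Union>x\<in>C. \<Union>y\<in>D. tensor_class V W (x + y)),
     module.smult = (\<lambda>c C. \<Union>x\<in>C. tensor_class V W (Poly_Mapping.map ((*) c) x))\<rparr>"

text \<open>The image of \<open>A \<otimes> B\<close> in \<open>V \<otimes> W\<close>, for subspaces \<open>A\<close> of \<open>V\<close> and \<open>B\<close> of \<open>W\<close>.\<close>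

definition tensor_subspace ::
  "('k::field, 'a, 'm) module_scheme \<Rightarrow> ('k, 'b, 'n) module_scheme \<Rightarrow>
    'a set \<Rightarrow> 'b set \<Rightarrow> (('a \<times> 'b) \<Rightarrow>\<^sub>0 'k) set set"
  where "tensor_subspace V W A B = tensor_class V W ` tensor_free A B"

text \<open>The linear form on \<open>V \<otimes> W\<close> induced by a bilinear form \<open>\<beta>\<close>.\<close>

definition tensor_form :: "('a \<Rightarrow> 'b \<Rightarrow> 'k::field) \<Rightarrow> (('a \<times> 'b) \<Rightarrow>\<^sub>0 'k) set \<Rightarrow> 'k"
  where "tensor_form \<beta> C = the_elem
    ((\<lambda>x. \<Sum>p\<in>Poly_Mapping.keys x. Poly_Mapping.lookup x p * \<beta> (fst p) (snd p)) ` C)"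


section \<open>Hopf algebras and the finite dual\<close>

record (overloaded) ('k, 'a) hopf = "('k::field, 'a) module" +
  comult :: "'a \<Rightarrow> (('a \<times> 'a) \<Rightarrow>\<^sub>0 'k) set"
  counit :: "'a \<Rightarrow> 'k"
  antipode :: "'a \<Rightarrow> 'a"

text \<open>
  The ambient \<open>H\<close> is meant to be a Hopf algebra; a subset is then a sub-Hopf algebra iff it is
  a unital subalgebra \<open>A\<close> with \<open>\<Delta>(A) \<subseteq> A \<otimes> A\<close> and \<open>S(A) \<subseteq> A\<close>.
\<close>

definition sub_hopf_algebra :: "'a set \<Rightarrow> ('k::field, 'a, 'm) hopf_scheme \<Rightarrow> bool"
  where "sub_hopf_algebra A H \<longleftrightarrow>
    k_subalgebra A H \<and>
    (\<forall>a\<in>A. comult H a \<in> tensor_subspace H H A A) \<and>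
    (\<forall>a\<in>A. antipode H a \<in> A)"

definition finite_dual_carrier :: "('k::field, 'a, 'm) module_scheme \<Rightarrow> ('a \<Rightarrow> 'k) set"
  where "finite_dual_carrier H = {f \<in> dual_space H.
    \<exists>I. ideal I H \<and> (\<forall>x\<in>I. f x = 0) \<and> fin_dim (quotient_algebra H I)}"

definition finite_dual_algebra :: "('k::field, 'a, 'm) hopf_scheme \<Rightarrow> ('k, 'a \<Rightarrow> 'k) module"
  where "finite_dual_algebra H =
    \<lparr>carrier = finite_dual_carrier H,
     monoid.mult = (\<lambda>f g. \<lambda>x\<in>carrier H. tensor_form (\<lambda>a b. f a * g b) (comult H x)),
     one = (\<lambda>x\<in>carrier H. counit H x),
     ring.zero = (\<lambda>x\<in>carrier H. 0),
     add = (\<lambda>f g. \<lambda>x\<in>carrier H. f x + g x),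
     module.smult = (\<lambda>c f. \<lambda>x\<in>carrier H. c * f x)\<rparr>"

text \<open>
  The coproduct of \<open>f\<close> is the transpose of the multiplication: the unique
  \<open>\<Sum> f\<^sub>1 \<otimes> f\<^sub>2\<close> in the tensor square of the finite dual with
  \<open>f (x y) = \<Sum> f\<^sub>1 x * f\<^sub>2 y\<close>.
\<close>

definition finite_dual :: "('k::field, 'a, 'm) hopf_scheme \<Rightarrow> ('k, 'a \<Rightarrow> 'k) hopf"
  where "finite_dual H = module.extend (finite_dual_algebra H) (hopf.fields
    (\<lambda>f. THE t. t \<in> carrier (tensor (finite_dual_algebra H) (finite_dual_algebra H)) \<and>
       (\<forall>x\<in>carrier H. \<forall>y\<in>carrier H. tensor_form (\<lambda>a b. a x * b y) t = f (x \<otimes>\<^bsub>H\<^esub> y)))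
    (\<lambda>f. f \<one>\<^bsub>H\<^esub>)
    (\<lambda>f. \<lambda>x\<in>carrier H. f (antipode H x)))"


section \<open>Coordinate functions of simple modules\<close>

locale left_module = R?: ring H + M?: abelian_group M
  for H :: "('a, 'r) ring_scheme" (structure) and M :: "('a, 'b, 'm) module_scheme" (structure) +
  assumes smult_closed: "\<lbrakk>a \<in> carrier H; x \<in> carrier M\<rbrakk> \<Longrightarrow> a \<odot>\<^bsub>M\<^esub> x \<in> carrier M"
    and smult_l_distr: "\<lbrakk>a \<in> carrier H; b \<in> carrier H; x \<in> carrier M\<rbrakk> \<Longrightarrow>
      (a \<oplus> b) \<odot>\<^bsub>M\<^esub> x = a \<odot>\<^bsub>M\<^esub> x \<oplus>\<^bsub>M\<^esub> b \<odot>\<^bsub>M\<^esub> x"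
    and smult_r_distr: "\<lbrakk>a \<in> carrier H; x \<in> carrier M; y \<in> carrier M\<rbrakk> \<Longrightarrow>
      a \<odot>\<^bsub>M\<^esub> (x \<oplus>\<^bsub>M\<^esub> y) = a \<odot>\<^bsub>M\<^esub> x \<oplus>\<^bsub>M\<^esub> a \<odot>\<^bsub>M\<^esub> y"
    and smult_assoc: "\<lbrakk>a \<in> carrier H; b \<in> carrier H; x \<in> carrier M\<rbrakk> \<Longrightarrow>
      (a \<otimes> b) \<odot>\<^bsub>M\<^esub> x = a \<odot>\<^bsub>M\<^esub> (b \<odot>\<^bsub>M\<^esub> x)"
    and smult_one: "x \<in> carrier M \<Longrightarrow> \<one> \<odot>\<^bsub>M\<^esub> x = x"

definition simple_module :: "('a, 'r) ring_scheme \<Rightarrow> ('a, 'b, 'm) module_scheme \<Rightarrow> bool"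
  where "simple_module H M \<longleftrightarrow> left_module H M \<and> carrier M \<noteq> {\<zero>\<^bsub>M\<^esub>} \<and>
    (\<forall>N. submodule N H M \<longrightarrow> N = {\<zero>\<^bsub>M\<^esub>} \<or> N = carrier M)"

text \<open>The vector space underlying a module \<open>M\<close> over an algebra \<open>H\<close>.\<close>

definition underlying_space ::
  "('k, 'a, 'r) module_scheme \<Rightarrow> ('a, 'b, 'm) module_scheme \<Rightarrow> ('k, 'b) module"
  where "underlying_space H M =
    ring.extend (ring.truncate M) (module.fields (\<lambda>c v. (c \<odot>\<^bsub>H\<^esub> \<one>\<^bsub>H\<^esub>) \<odot>\<^bsub>M\<^esub> v))"

definition coordinate_function ::
  "('k, 'a, 'r) module_scheme \<Rightarrow> ('a, 'b, 'm) module_scheme \<Rightarrow> ('b \<Rightarrow> 'k) \<Rightarrow> 'b \<Rightarrow> 'a \<Rightarrow> 'k"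
  where "coordinate_function H M f v = (\<lambda>x\<in>carrier H. f (x \<odot>\<^bsub>M\<^esub> v))"

text \<open>
  Modules in the following set are carried by subsets of the type \<open>nat \<Rightarrow> 'k\<close>, which contains a
  copy of every finite-dimensional space; the lemma \<open>coordinate_function_simple\<close> below
  shows that this restriction does not lose any coordinate function.
\<close>

definition simple_coordinate_functions :: "('k::field, 'a, 'r) module_scheme \<Rightarrow> ('a \<Rightarrow> 'k) set"
  where "simple_coordinate_functions H =
    {coordinate_function H M f v | (M :: ('a, nat \<Rightarrow> 'k) module) f v.
      simple_module H M \<and> fin_dim (underlying_space H M) \<and>
      f \<in> dual_space (underlying_space H M) \<and> v \<in> carrier M}"

definition transported_module ::
  "('b \<Rightarrow> 'c) \<Rightarrow> ('a, 'b, 'm) module_scheme \<Rightarrow> ('a, 'c) module"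
  where "transported_module j M = (let k = inv_into (carrier M) j in
    \<lparr>carrier = j ` carrier M,
     monoid.mult = undefined,
     one = undefined,
     ring.zero = j \<zero>\<^bsub>M\<^esub>,
     add = (\<lambda>x y. j (k x \<oplus>\<^bsub>M\<^esub> k y)),
     module.smult = (\<lambda>a x. j (a \<odot>\<^bsub>M\<^esub> k x))\<rparr>)"

lemma transported_module_simps:
  assumes "inj_on j (carrier M)"
  shows "carrier (transported_module j M) = j ` carrier M"
    and "\<zero>\<^bsub>transported_module j M\<^esub> = j \<zero>\<^bsub>M\<^esub>"
    and "\<lbrakk>x \<in> carrier M; y \<in> carrier M\<rbrakk> \<Longrightarrow>
      j x \<oplus>\<^bsub>transported_module j M\<^esub> j y = j (x \<oplus>\<^bsub>M\<^esub> y)"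
    and "x \<in> carrier M \<Longrightarrow> a \<odot>\<^bsub>transported_module j M\<^esub> j x = j (a \<odot>\<^bsub>M\<^esub> x)"
  using assms by (simp_all add: transported_module_def Let_def)

lemma left_module_transported:
  assumes "left_module H M" and inj: "inj_on j (carrier M)"
  shows "left_module H (transported_module j M)"
proof -
  interpret left_module H M by fact
  note simps = transported_module_simps[OF inj]
  have ag: "abelian_group (transported_module j M)"
  proof (rule abelian_groupI)
    fix x assume "x \<in> carrier (transported_module j M)"
    then obtain a where a: "a \<in> carrier M" "x = j a" by (auto simp: simps)
    show "\<exists>y\<in>carrier (transported_module j M).
        y \<oplus>\<^bsub>transported_module j M\<^esub> x = \<zero>\<^bsub>transported_module j M\<^esub>"
      by (rule bexI[of _ "j (\<ominus>\<^bsub>M\<^esub> a)"]) (use a in \<open>simp_all add: simps M.l_neg\<close>)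
  qed (auto simp: simps M.a_ac)
  show ?thesis
    by (intro left_module.intro left_module_axioms.intro ag R.ring_axioms)
      (auto simp: simps smult_closed smult_l_distr smult_r_distr smult_assoc smult_one)
qed

lemma simple_module_transported:
  assumes "simple_module H M" and inj: "inj_on j (carrier M)"
  shows "simple_module H (transported_module j M)"
  unfolding simple_module_def
proof (intro conjI allI impI)
  let ?M' = "transported_module j M"
  note simps = transported_module_simps[OF inj]
  have M: "left_module H M" and nz: "carrier M \<noteq> {\<zero>\<^bsub>M\<^esub>}"
    and simple: "\<And>N. submodule N H M \<Longrightarrow> N = {\<zero>\<^bsub>M\<^esub>} \<or> N = carrier M"
    using assms unfolding simple_module_def by auto
  interpret left_module H M by (fact M)
  show "left_module H ?M'" by (rule left_module_transported[OF M inj])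
  interpret M': left_module H ?M' by fact
  show "carrier ?M' \<noteq> {\<zero>\<^bsub>?M'\<^esub>}"
    using nz inj M.zero_closed by (auto simp: simps inj_on_def)
  fix N' assume N': "submodule N' H ?M'"
  interpret N': submodule N' H ?M' by fact
  define N where "N = {x \<in> carrier M. j x \<in> N'}"
  have N'_eq: "N' = j ` N"
    using N'.subset by (auto simp: N_def simps)
  have "submodule N H M"
  proof (intro submodule.intro subgroup.intro submodule_axioms.intro)
    fix x assume x: "x \<in> N"
    have "j (\<ominus>\<^bsub>M\<^esub> x) \<oplus>\<^bsub>?M'\<^esub> j x = \<zero>\<^bsub>?M'\<^esub>"
      using x by (simp add: N_def simps M.l_neg)
    then have "\<ominus>\<^bsub>?M'\<^esub> j x = j (\<ominus>\<^bsub>M\<^esub> x)"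
      using x by (intro M'.minus_equality) (auto simp: N_def simps)
    moreover have "\<ominus>\<^bsub>?M'\<^esub> j x \<in> N'"
      using N'.m_inv_closed[of "j x"] x by (simp add: N_def a_inv_def)
    ultimately show "inv\<^bsub>add_monoid M\<^esub> x \<in> N"
      using x by (simp add: N_def a_inv_def[symmetric])
  next
    fix x y assume "x \<in> N" "y \<in> N"
    then show "x \<otimes>\<^bsub>add_monoid M\<^esub> y \<in> N"
      using N'.m_closed[of "j x" "j y"] by (simp add: N_def simps)
  next
    show "\<one>\<^bsub>add_monoid M\<^esub> \<in> N"
      using N'.one_closed by (simp add: N_def simps)
  next
    fix a x assume "a \<in> carrier H" "x \<in> N"
    then show "a \<odot>\<^bsub>M\<^esub> x \<in> N"
      using N'.smult_closed[of a "j x"] by (simp add: N_def simps smult_closed)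
  qed (auto simp: N_def)
  then show "N' = {\<zero>\<^bsub>?M'\<^esub>} \<or> N' = carrier ?M'"
    using simple[of N] by (auto simp: N'_eq simps)
qed

lemma underlying_space_simps:
  "carrier (underlying_space H M) = carrier M"
  "\<zero>\<^bsub>underlying_space H M\<^esub> = \<zero>\<^bsub>M\<^esub>"
  "x \<oplus>\<^bsub>underlying_space H M\<^esub> y = x \<oplus>\<^bsub>M\<^esub> y"
  "c \<odot>\<^bsub>underlying_space H M\<^esub> x = (c \<odot>\<^bsub>H\<^esub> \<one>\<^bsub>H\<^esub>) \<odot>\<^bsub>M\<^esub> x"
  by (simp_all add: underlying_space_def ring.defs module.defs)

lemma finsum_underlying_space: "finsum (underlying_space H M) = finsum M"
  by (intro ext) (simp add: finsum_def finprod_def underlying_space_def ring.defs module.defs)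

lemma coordinate_function_simple:
  fixes H :: "('k::field, 'a, 'r) module_scheme" and M :: "('a, 'b, 'm) module_scheme"
  assumes scalar: "\<And>c. c \<odot>\<^bsub>H\<^esub> \<one>\<^bsub>H\<^esub> \<in> carrier H"
    and simple: "simple_module H M" and fd: "fin_dim (underlying_space H M)"
    and f: "f \<in> dual_space (underlying_space H M)" and v: "v \<in> carrier M"
  shows "coordinate_function H M f v \<in> simple_coordinate_functions H"
proof -
  let ?s = "\<lambda>c b. (c \<odot>\<^bsub>H\<^esub> \<one>\<^bsub>H\<^esub>) \<odot>\<^bsub>M\<^esub> b"
  have M: "left_module H M" using simple by (simp add: simple_module_def)
  interpret left_module H M by (fact M)
  obtain B where B: "B \<subseteq> carrier M" "finite B"
    and span: "\<forall>x\<in>carrier M. \<exists>c. x = (\<Oplus>\<^bsub>M\<^esub>b\<in>B. ?s (c b) b)"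
    using fd unfolding fin_dim_def
    by (auto simp: underlying_space_simps finsum_underlying_space)
  from span obtain c where c: "\<And>x. x \<in> carrier M \<Longrightarrow> x = (\<Oplus>\<^bsub>M\<^esub>b\<in>B. ?s (c x b) b)"
    by metis
  obtain e :: "'b \<Rightarrow> nat" where e: "inj_on e B"
    using B(2) finite_imp_inj_to_nat_seg by metis
  define j where "j x = (\<lambda>n. c x (inv_into B e n))" for x
  have inj: "inj_on j (carrier M)"
  proof (rule inj_onI)
    fix x y assume xy: "x \<in> carrier M" "y \<in> carrier M" "j x = j y"
    have eq: "c x b = c y b" if "b \<in> B" for b
      using fun_cong[OF xy(3), of "e b"] that e by (simp add: j_def)
    have closed: "?s (c y b) b \<in> carrier M" if "b \<in> B" for b
      using that B(1) by (intro smult_closed scalar) auto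
    have "(\<Oplus>\<^bsub>M\<^esub>b\<in>B. ?s (c x b) b) = (\<Oplus>\<^bsub>M\<^esub>b\<in>B. ?s (c y b) b)"
      by (rule M.finsum_cong') (use eq closed in auto)
    then show "x = y" using c[OF xy(1)] c[OF xy(2)] by simp
  qed
  let ?M' = "transported_module j M"
  note simps = transported_module_simps[OF inj]
  have simple': "simple_module H ?M'" by (rule simple_module_transported[OF simple inj])
  interpret M': left_module H ?M' using simple' by (simp add: simple_module_def)
  let ?k = "inv_into (carrier M) j"
  let ?s' = "\<lambda>c b. (c \<odot>\<^bsub>H\<^esub> \<one>\<^bsub>H\<^esub>) \<odot>\<^bsub>?M'\<^esub> b"
  have sum: "j (\<Oplus>\<^bsub>M\<^esub>b\<in>F. ?s (d b) b) = (\<Oplus>\<^bsub>?M'\<^esub>b\<in>j ` F. ?s' (d (?k b)) b)"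
    if "finite F" "F \<subseteq> carrier M" for F d
    using that
  proof (induction F rule: finite_induct)
    case empty
    show ?case by (simp add: simps)
  next
    case (insert b F)
    then have b: "b \<in> carrier M" and F: "F \<subseteq> carrier M" by auto
    have clM: "(\<lambda>b. ?s (d b) b) \<in> F \<rightarrow> carrier M" "?s (d b) b \<in> carrier M"
      using b F by (auto intro!: smult_closed scalar)
    have jc: "j x \<in> carrier ?M'" if "x \<in> carrier M" for x
      using that by (simp add: simps(1))
    have clM': "(\<lambda>b. ?s' (d (?k b)) b) \<in> j ` F \<rightarrow> carrier ?M'"
      "?s' (d (?k (j b))) (j b) \<in> carrier ?M'"
      using b F by (auto intro!: M'.smult_closed[OF scalar] simp del: inv_into_f_f simp: jc)
    have notin: "j b \<notin> j ` F"
      using insert.hyps b F inj by (auto simp: inj_on_def subset_eq)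
    have "j (\<Oplus>\<^bsub>M\<^esub>b\<in>insert b F. ?s (d b) b) = j (?s (d b) b \<oplus>\<^bsub>M\<^esub> (\<Oplus>\<^bsub>M\<^esub>b\<in>F. ?s (d b) b))"
      using insert.hyps clM by (simp add: M.finsum_insert)
    also have "\<dots> = j (?s (d b) b) \<oplus>\<^bsub>?M'\<^esub> j (\<Oplus>\<^bsub>M\<^esub>b\<in>F. ?s (d b) b)"
      using clM by (simp add: simps M.finsum_closed)
    also have "\<dots> = ?s' (d (?k (j b))) (j b) \<oplus>\<^bsub>?M'\<^esub> (\<Oplus>\<^bsub>?M'\<^esub>b\<in>j ` F. ?s' (d (?k b)) b)"
      using insert.IH[OF F] b inj by (simp add: simps(4))
    also have "\<dots> = (\<Oplus>\<^bsub>?M'\<^esub>b\<in>j ` insert b F. ?s' (d (?k b)) b)"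
      using insert.hyps clM' notin by (simp add: M'.finsum_insert)
    finally show ?case .
  qed
  have fd': "fin_dim (underlying_space H ?M')"
    unfolding fin_dim_def underlying_space_simps finsum_underlying_space
  proof (intro exI[of _ "j ` B"] conjI ballI)
    show "j ` B \<subseteq> carrier ?M'" "finite (j ` B)" using B by (auto simp: simps)
    fix x' assume "x' \<in> carrier ?M'"
    then obtain x where x: "x \<in> carrier M" "x' = j x" by (auto simp: simps)
    have "x' = (\<Oplus>\<^bsub>?M'\<^esub>b\<in>j ` B. ?s' (c x (?k b)) b)"
      using sum[OF B(2,1), of "c x"] c[OF x(1)] x(2) by metis
    then show "\<exists>d. x' = (\<Oplus>\<^bsub>?M'\<^esub>b\<in>j ` B. ?s' (d b) b)" by fast
  qed
  define f' where "f' = (\<lambda>x\<in>carrier ?M'. f (?k x))"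
  have f': "f' (j x) = f x" if "x \<in> carrier M" for x
    using that inj by (simp add: f'_def simps(1))
  have "f' \<in> dual_space (underlying_space H ?M')"
    unfolding dual_space_def
  proof (intro CollectI conjI ballI allI)
    show "f' \<in> carrier (underlying_space H ?M') \<rightarrow>\<^sub>E UNIV"
      by (simp add: f'_def underlying_space_simps)
  qed (use f scalar in \<open>auto simp: dual_space_def underlying_space_simps simps f' smult_closed\<close>)
  moreover have "coordinate_function H M f v = coordinate_function H ?M' f' (j v)"
    using v by (auto simp: coordinate_function_def restrict_def fun_eq_iff simps f' smult_closed)
  moreover have "j v \<in> carrier ?M'" using v by (simp add: simps)
  ultimately show ?thesis
    unfolding simple_coordinate_functions_def using simple' fd' by blast
qed

section \<open>The algebra $U_{g,h}$\<close>

datatype gen = GE | GF | GK | GKi | Gg | Ggi | Gh | Ghi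

definition U_rels :: "'k::field \<Rightarrow> (gen word \<Rightarrow>\<^sub>0 'k) set"
  where "U_rels q = (let
      E = letter GE; F = letter GF; K = letter GK; Ki = letter GKi;
      g = letter Gg; gi = letter Ggi; h = letter Gh; hi = letter Ghi
    in {K * Ki - 1, Ki * K - 1, g * gi - 1, gi * g - 1, h * hi - 1, hi * h - 1,
        g * h - h * g,
        g * E - E * g, g * F - F * g, g * K - K * g,
        h * E - E * h, h * F - F * h, h * K - K * h,
        K * E * Ki - const (q\<^sup>2) * E,
        K * F * Ki - const (inverse (q\<^sup>2)) * F,
        E * F - F * E - const (inverse (q - inverse q)) * (K - Ki * g\<^sup>2)})"

definition U_alg :: "'k::field \<Rightarrow> ('k, (gen word \<Rightarrow>\<^sub>0 'k) set) module"
  where "U_alg q = presented_algebra (U_rels q)"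

definition U_gen :: "'k::field \<Rightarrow> gen \<Rightarrow> (gen word \<Rightarrow>\<^sub>0 'k) set"
  where "U_gen q s = (Idl\<^bsub>free_algebra\<^esub> (U_rels q)) +>\<^bsub>free_algebra\<^esub> (letter s)"

definition U_comult_gen ::
  "'k::field \<Rightarrow> gen \<Rightarrow> (((gen word \<Rightarrow>\<^sub>0 'k) set \<times> (gen word \<Rightarrow>\<^sub>0 'k) set) \<Rightarrow>\<^sub>0 'k) set"
  where "U_comult_gen q s = (let
      U = U_alg q; T = tensor U U; t = pure_tensor U U;
      E = U_gen q GE; F = U_gen q GF; K = U_gen q GK; Ki = U_gen q GKi;
      g = U_gen q Gg; h = U_gen q Gh; hi = U_gen q Ghi
    in (case s of
        GE \<Rightarrow> t hi E \<oplus>\<^bsub>T\<^esub> t E (h \<otimes>\<^bsub>U\<^esub> K)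
      | GF \<Rightarrow> t (Ki \<otimes>\<^bsub>U\<^esub> h \<otimes>\<^bsub>U\<^esub> g [^]\<^bsub>U\<^esub> (2::nat)) F \<oplus>\<^bsub>T\<^esub> t F hi
      | _ \<Rightarrow> t (U_gen q s) (U_gen q s)))"

fun U_counit_gen :: "gen \<Rightarrow> 'k::field"
  where
    "U_counit_gen GE = 0"
  | "U_counit_gen GF = 0"
  | "U_counit_gen s = 1"

definition U_antipode_gen :: "'k::field \<Rightarrow> gen \<Rightarrow> (gen word \<Rightarrow>\<^sub>0 'k) set"
  where "U_antipode_gen q s = (let
      U = U_alg q;
      E = U_gen q GE; F = U_gen q GF; K = U_gen q GK; Ki = U_gen q GKi; gi = U_gen q Ggi
    in (case s of
        GE \<Rightarrow> \<ominus>\<^bsub>U\<^esub> (E \<otimes>\<^bsub>U\<^esub> Ki)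
      | GF \<Rightarrow> \<ominus>\<^bsub>U\<^esub> (K \<otimes>\<^bsub>U\<^esub> F \<otimes>\<^bsub>U\<^esub> gi [^]\<^bsub>U\<^esub> (2::nat))
      | GK \<Rightarrow> U_gen q GKi
      | GKi \<Rightarrow> U_gen q GK
      | Gg \<Rightarrow> U_gen q Ggi
      | Ggi \<Rightarrow> U_gen q Gg
      | Gh \<Rightarrow> U_gen q Ghi
      | Ghi \<Rightarrow> U_gen q Gh))"

definition U_gh :: "'k::field \<Rightarrow> ('k, (gen word \<Rightarrow>\<^sub>0 'k) set) hopf"
  where "U_gh q = module.extend (U_alg q) (hopf.fields
    (induced_hom (tensor (U_alg q) (U_alg q)) (U_comult_gen q))
    (induced_hom scalar_algebra U_counit_gen)
    (induced_hom (opposite_algebra (U_alg q)) (U_antipode_gen q)))"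

end

theory Submission
  imports Defs
begin

text \<open>
  Let \<open>H\<close> be an algebra with comultiplication, counit and surjective antipode \<open>S\<close>, such as
  \<open>U\<^sub>g\<^sub>,\<^sub>h\<close>, and let \<open>A\<close> be generated by the coordinate functions of the finite-dimensional simple modules.
  Two observations about a single module \<open>M\<close> make \<open>A\<close> a sub-Hopf algebra of the finite dual.

  Comultiplication: for a basis \<open>v\<^sub>i\<close> of \<open>M\<close> with dual basis \<open>f\<^sub>i\<close>, the value of \<open>c\<^sub>f\<^sub>,\<^sub>v\<close> at \<open>x y\<close> is the
  sum over \<open>i\<close> of the values of \<open>c\<close> for \<open>(f, v\<^sub>i)\<close> at \<open>x\<close> times those for \<open>(f\<^sub>i, v)\<close> at \<open>y\<close>, which are
  coordinate functions of the same module (\<open>coordinate_function_splits\<close>).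
  Antipode: composing \<open>c\<^sub>f\<^sub>,\<^sub>v\<close> with \<open>S\<close> gives a coordinate function of the dual module
  (\<open>simple_coordinate_functions_antipode\<close>), and the dual of a simple module is simple
  (\<open>dual_module_simple\<close>), because the annihilator in \<open>M\<close> of a submodule of the dual is stable under the
  image of \<open>S\<close>, which is all of \<open>H\<close>.

  Both properties pass from the generators to all of \<open>A\<close>: the comultiplication of \<open>H\<close> is
  multiplicative, so products of functions that split into factors from \<open>A\<close> split into factors from
  \<open>A\<close> (\<open>splits_conv\<close>), and composition with \<open>S\<close> reverses products.

  To connect this with the finite dual as defined by ideals of finite codimension, its elements
  are characterised as the linear forms \<open>f\<close> for which \<open>f (x y)\<close> is a finite sum of products
  \<open>a x * b y\<close> (\<open>finite_dual_carrierI\<close>, \<open>finite_dual_carrierD\<close>).  Such a splitting determines the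
  coproduct of \<open>f\<close>, since tensors over the finite dual are determined by their values on pairs
  (\<open>tensor_finite_dual_inj\<close>).  The linear algebra behind all of this is the reduced echelon form
  (\<open>subspace_pivots\<close>).

  It remains to see that the structure maps of \<open>U\<^sub>g\<^sub>,\<^sub>h\<close> are well defined, that is, that the images of the
  generators in the tensor square and in the opposite algebra satisfy the defining relations, which
  is a comparison of normal forms (\<open>normal_form\<close>).
\<close>

section \<open>Linear algebra over a type of scalars\<close>

text \<open>
  This is the reduced echelon form of a space of row vectors: it is spanned by vectors \<open>w p\<close>,
  one for each pivot \<open>p\<close>, and the coefficients of a vector are its entries at the pivots.
  Pivots are found one position at a time.  If the vectors vanishing at all earlier positions also
  vanish at the new position, it is no pivot; otherwise one of them, normalised, is the new \<open>w\<close>,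
  and its multiples are subtracted from the old ones.
\<close>

lemma subspace_pivots:
  fixes S :: "('i \<Rightarrow> 'k::field) set"
  assumes "finite I"
    and add: "\<And>x y. x \<in> S \<Longrightarrow> y \<in> S \<Longrightarrow> (\<lambda>i. x i + y i) \<in> S"
    and scale: "\<And>c x. x \<in> S \<Longrightarrow> (\<lambda>i. c * x i) \<in> S"
  shows "\<exists>P w. P \<subseteq> I \<and> (\<forall>p\<in>P. w p \<in> S) \<and> (\<forall>x\<in>S. \<forall>i\<in>I. x i = (\<Sum>p\<in>P. x p * w p i))"
proof -
  have comb: "(\<lambda>i. x i - (\<Sum>p\<in>P. c p * w p i)) \<in> S"
    if "finite P" "\<forall>p\<in>P. w p \<in> S" "x \<in> S" for P w x and c :: "'i \<Rightarrow> 'k"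
    using that
  proof (induction P)
    case (insert p P)
    have "(\<lambda>i. (x i - (\<Sum>p\<in>P. c p * w p i)) + (- c p) * w p i) \<in> S"
      using insert by (intro add scale) auto
    then show ?case using insert.hyps by (simp add: algebra_simps)
  qed simp
  show ?thesis
    using \<open>finite I\<close>
  proof (induction I)
    case empty
    then show ?case by (intro exI[of _ "{}"]) simp
  next
    case (insert j I)
    then obtain P w where P: "P \<subseteq> I" and w: "\<forall>p\<in>P. w p \<in> S"
      and eq: "\<And>x i. x \<in> S \<Longrightarrow> i \<in> I \<Longrightarrow> x i = (\<Sum>p\<in>P. x p * w p i)" by blast
    have fin: "finite P" using P insert.hyps by (auto intro: finite_subset)
    have j: "j \<notin> P" using P insert.hyps by auto
    show ?case
    proof (cases "\<exists>v\<in>S. (\<forall>i\<in>I. v i = 0) \<and> v j \<noteq> 0")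
      case False
      have "x j = (\<Sum>p\<in>P. x p * w p j)" if x: "x \<in> S" for x
        using False comb[OF fin w x, of x] eq[OF x] by fastforce
      then show ?thesis using P w eq by (intro exI[of _ P] exI[of _ w]) auto
    next
      case True
      then obtain v' where v': "v' \<in> S" "\<forall>i\<in>I. v' i = 0" "v' j \<noteq> 0" by blast
      define v where "v = (\<lambda>i. inverse (v' j) * v' i)"
      have v: "v \<in> S" "\<And>i. i \<in> I \<Longrightarrow> v i = 0" "v j = 1"
        using v' scale by (auto simp: v_def)
      define u where "u p = (if p = j then v else (\<lambda>i. w p i + (- w p j) * v i))" for p
      have u: "u p \<in> S" if "p \<in> insert j P" for p
      proof (cases "p = j")
        case True
        then show ?thesis using v by (simp add: u_def)
      next
        case False
        then have "(\<lambda>i. w p i + (- w p j) * v i) \<in> S"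
          using that w by (intro add scale v) auto
        then show ?thesis using False by (simp add: u_def)
      qed
      have "x i = (\<Sum>p\<in>insert j P. x p * u p i)" if x: "x \<in> S" and i: "i \<in> insert j I" for x i
      proof -
        have "(\<Sum>p\<in>insert j P. x p * u p i) = x j * v i + (\<Sum>p\<in>P. x p * u p i)"
          using fin j by (simp add: u_def)
        also have "(\<Sum>p\<in>P. x p * u p i) = (\<Sum>p\<in>P. x p * (w p i - w p j * v i))"
          using j by (intro sum.cong) (auto simp: u_def)
        also have "x j * v i + \<dots> = x i"
          using i v eq[OF x] by (cases "i = j") (auto simp: algebra_simps)
        finally show ?thesis by simp
      qed
      then show ?thesis using P u by (intro exI[of _ "insert j P"] exI[of _ u]) blast
    qed
  qed
qed

text \<open>
  Vector spaces in the sense of records with scalars from a type, so that no membership conditions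
  on scalars arise.
\<close>

locale k_space = abelian_group V
  for V :: "('k::field, 'a, 'm) module_scheme" (structure) +
  assumes scale_closed [simp]: "x \<in> carrier V \<Longrightarrow> c \<odot> x \<in> carrier V"
    and scale_add_left: "x \<in> carrier V \<Longrightarrow> (c + d) \<odot> x = c \<odot> x \<oplus> d \<odot> x"
    and scale_add_right: "\<lbrakk>x \<in> carrier V; y \<in> carrier V\<rbrakk> \<Longrightarrow> c \<odot> (x \<oplus> y) = c \<odot> x \<oplus> c \<odot> y"
    and scale_scale: "x \<in> carrier V \<Longrightarrow> c \<odot> (d \<odot> x) = (c * d) \<odot> x"
    and scale_one [simp]: "x \<in> carrier V \<Longrightarrow> 1 \<odot> x = x"
begin

lemma scale_zero_left [simp]: "x \<in> carrier V \<Longrightarrow> 0 \<odot> x = \<zero>"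
  using scale_add_left[of x 0 0] add.l_cancel_one'[of "0 \<odot> x" "0 \<odot> x"] by simp

lemma scale_zero_right [simp]: "c \<odot> \<zero> = \<zero>"
  using scale_add_right[of \<zero> \<zero> c] add.l_cancel_one'[of "c \<odot> \<zero>" "c \<odot> \<zero>"] by simp

lemma scale_minus_one: "x \<in> carrier V \<Longrightarrow> (- 1) \<odot> x = \<ominus> x"
  using scale_add_left[of x "- 1" 1] by (intro minus_equality[symmetric]) auto

lemma scale_cancel:
  assumes "x \<in> carrier V"
  shows "c \<odot> x \<oplus> (- c) \<odot> x = \<zero>" "z \<in> carrier V \<Longrightarrow> c \<odot> x \<oplus> ((- c) \<odot> x \<oplus> z) = z"
proof -
  show 0: "c \<odot> x \<oplus> (- c) \<odot> x = \<zero>" using assms scale_add_left[of x c "- c"] by simp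
  show "z \<in> carrier V \<Longrightarrow> c \<odot> x \<oplus> ((- c) \<odot> x \<oplus> z) = z"
    using assms 0 by (simp add: a_assoc[symmetric])
qed

lemma lincomb_closed [simp]: "v \<in> I \<rightarrow> carrier V \<Longrightarrow> (\<Oplus>i\<in>I. c i \<odot> v i) \<in> carrier V"
  by (intro finsum_closed) (auto simp: Pi_iff)

lemma lincomb_zero: "v \<in> I \<rightarrow> carrier V \<Longrightarrow> (\<Oplus>i\<in>I. 0 \<odot> v i) = \<zero>"
  using add.finprod_cong'[of I I "\<lambda>_. \<zero>" "\<lambda>i. 0 \<odot> v i"] by (simp add: Pi_iff)

lemma lincomb_add:
  assumes "v \<in> I \<rightarrow> carrier V"
  shows "(\<Oplus>i\<in>I. (c i + d i) \<odot> v i) = (\<Oplus>i\<in>I. c i \<odot> v i) \<oplus> (\<Oplus>i\<in>I. d i \<odot> v i)"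
proof -
  have "(\<Oplus>i\<in>I. (c i + d i) \<odot> v i) = (\<Oplus>i\<in>I. c i \<odot> v i \<oplus> d i \<odot> v i)"
    using assms by (intro finsum_cong') (auto simp: scale_add_left Pi_iff)
  also have "\<dots> = (\<Oplus>i\<in>I. c i \<odot> v i) \<oplus> (\<Oplus>i\<in>I. d i \<odot> v i)"
    using assms by (intro finsum_addf) (auto simp: Pi_iff)
  finally show ?thesis .
qed

lemma lincomb_scale:
  assumes "finite I" "v \<in> I \<rightarrow> carrier V"
  shows "(\<Oplus>i\<in>I. (c * d i) \<odot> v i) = c \<odot> (\<Oplus>i\<in>I. d i \<odot> v i)"
  using assms
proof (induction I)
  case (insert i I)
  then have "(\<lambda>i. (c * d i) \<odot> v i) \<in> I \<rightarrow> carrier V" "(\<lambda>i. d i \<odot> v i) \<in> I \<rightarrow> carrier V"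
    by (auto simp: Pi_iff)
  with insert show ?case by (auto simp: finsum_insert scale_add_right scale_scale)
qed simp

lemma lincomb_single:
  assumes "finite B" "B \<subseteq> carrier V" "b \<in> B"
  shows "(\<Oplus>i\<in>B. (if i = b then c else 0) \<odot> i) = c \<odot> b"
proof -
  have "(\<Oplus>i\<in>B. (if i = b then c else 0) \<odot> i) = (\<Oplus>i\<in>B. if i = b then c \<odot> i else \<zero>)"
    using assms by (intro finsum_cong') auto
  also have "\<dots> = c \<odot> b"
    using assms add.finprod_singleton_swap[of b B "\<lambda>i. c \<odot> i"] by (auto simp: Pi_iff subset_eq)
  finally show ?thesis .
qed

text \<open>
  The definition of finite dimension asks for a spanning set; spanning families with
  repetitions are what arises in practice.
\<close>

lemma fin_dimI:
  assumes "finite I" "v \<in> I \<rightarrow> carrier V"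
    and span: "\<And>x. x \<in> carrier V \<Longrightarrow> \<exists>c. x = (\<Oplus>i\<in>I. c i \<odot> v i)"
  shows "fin_dim V"
proof -
  have sub: "v ` I \<subseteq> carrier V" "id \<in> v ` I \<rightarrow> carrier V" using assms by auto
  have "\<exists>d. (\<Oplus>i\<in>J. c i \<odot> v i) = (\<Oplus>b\<in>v ` I. d b \<odot> b)" if "finite J" "J \<subseteq> I" for c J
    using that
  proof (induction J)
    case empty
    have "(\<Oplus>b\<in>v ` I. 0 \<odot> b) = \<zero>"
      using lincomb_zero[of id "v ` I"] sub by simp
    then show ?case by (intro exI[of _ "\<lambda>_. 0"]) simp
  next
    case (insert j J)
    then obtain d where d: "(\<Oplus>i\<in>J. c i \<odot> v i) = (\<Oplus>b\<in>v ` I. d b \<odot> b)" by auto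
    have "(\<lambda>i. c i \<odot> v i) \<in> J \<rightarrow> carrier V" "v j \<in> carrier V"
      using insert assms by (auto simp: Pi_iff)
    then have "(\<Oplus>i\<in>insert j J. c i \<odot> v i) = c j \<odot> v j \<oplus> (\<Oplus>b\<in>v ` I. d b \<odot> b)"
      using insert.hyps d by (simp add: finsum_insert)
    also have "\<dots> = (\<Oplus>b\<in>v ` I. ((if b = v j then c j else 0) + d b) \<odot> b)"
      using lincomb_add[of id "v ` I" "\<lambda>b. if b = v j then c j else 0" d]
        lincomb_single[of "v ` I" "v j" "c j"] sub insert.prems assms(1) by simp
    finally show ?case
      by (intro exI[of _ "\<lambda>b. (if b = v j then c j else 0) + d b"])
  qed
  with assms(1) have "\<exists>d. (\<Oplus>i\<in>I. c i \<odot> v i) = (\<Oplus>b\<in>v ` I. d b \<odot> b)" for c by blast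
  then have "\<forall>x\<in>carrier V. \<exists>d. x = (\<Oplus>b\<in>v ` I. d b \<odot> b)"
    using span by metis
  then show ?thesis
    unfolding fin_dim_def using sub(1) finite_imageI[OF assms(1)] by blast
qed

lemma dual_space_add: "\<lbrakk>f \<in> dual_space V; x \<in> carrier V; y \<in> carrier V\<rbrakk> \<Longrightarrow> f (x \<oplus> y) = f x + f y"
  and dual_space_scale: "\<lbrakk>f \<in> dual_space V; x \<in> carrier V\<rbrakk> \<Longrightarrow> f (c \<odot> x) = c * f x"
  by (simp_all add: dual_space_def)

lemma dual_space_zero: "f \<in> dual_space V \<Longrightarrow> f \<zero> = 0"
  using dual_space_scale[of f \<zero> 0] by simp

lemma dual_space_lincomb:
  assumes f: "f \<in> dual_space V" and "finite I" "v \<in> I \<rightarrow> carrier V"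
  shows "f (\<Oplus>i\<in>I. c i \<odot> v i) = (\<Sum>i\<in>I. c i * f (v i))"
  using assms(2,3)
proof (induction I)
  case empty
  then show ?case using f by (simp add: dual_space_zero)
next
  case (insert i I)
  then have "(\<lambda>i. c i \<odot> v i) \<in> I \<rightarrow> carrier V" by (auto simp: Pi_iff)
  with insert show ?case
    using f by (auto simp: dual_space_add dual_space_scale finsum_insert)
qed

text \<open>
  The coefficients with respect to a spanning set need not be unique.  Subtracting
  the spanning relations \<open>w p\<close>, multiplied with the coefficients at the pivots \<open>p\<close>, does not change the
  vector that they represent and turns the coefficients of every relation into zero.  The new
  coefficients therefore depend on the vector only, hence linearly.
\<close>

lemma fin_dim_frame:
  assumes "fin_dim V"
  obtains B F where "finite B" "B \<subseteq> carrier V" "\<And>b. b \<in> B \<Longrightarrow> F b \<in> dual_space V"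
    "\<And>x. x \<in> carrier V \<Longrightarrow> x = (\<Oplus>b\<in>B. F b x \<odot> b)"
proof -
  obtain B c where B: "B \<subseteq> carrier V" "finite B"
    and c: "\<And>x. x \<in> carrier V \<Longrightarrow> x = (\<Oplus>b\<in>B. c x b \<odot> b)"
    using assms unfolding fin_dim_def by metis
  have B': "id \<in> B \<rightarrow> carrier V" using B by auto
  have L_add: "(\<Oplus>b\<in>B. (d b + e b) \<odot> b) = (\<Oplus>b\<in>B. d b \<odot> b) \<oplus> (\<Oplus>b\<in>B. e b \<odot> b)" for d e
    using lincomb_add[OF B'] by simp
  have L_scale: "(\<Oplus>b\<in>B. (a * d b) \<odot> b) = a \<odot> (\<Oplus>b\<in>B. d b \<odot> b)" for a d
    using lincomb_scale[OF B(2) B'] by simp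
  define S where "S = {d. (\<Oplus>b\<in>B. d b \<odot> b) = \<zero>}"
  have Sadd: "(\<lambda>i. x i + y i) \<in> S" if "x \<in> S" "y \<in> S" for x y
    using L_add[of x y] that by (simp add: S_def)
  have Sscale: "(\<lambda>i. a * x i) \<in> S" if "x \<in> S" for a x
    using L_scale[of a x] that by (simp add: S_def)
  obtain P w where P: "P \<subseteq> B" and w: "\<forall>p\<in>P. w p \<in> S"
    and piv: "\<And>x b. x \<in> S \<Longrightarrow> b \<in> B \<Longrightarrow> x b = (\<Sum>p\<in>P. x p * w p b)"
    using subspace_pivots[OF B(2) Sadd Sscale] by blast
  have finP: "finite P" using P B by (auto intro: finite_subset)
  define F where "F b = (\<lambda>x\<in>carrier V. c x b - (\<Sum>p\<in>P. c x p * w p b))" for b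
  have rel: "(\<lambda>b. c (x \<oplus> y) b + ((- 1) * c x b + (- 1) * c y b)) \<in> S"
    if "x \<in> carrier V" "y \<in> carrier V" for x y
  proof -
    have "(\<Oplus>b\<in>B. (c (x \<oplus> y) b + ((- 1) * c x b + (- 1) * c y b)) \<odot> b)
        = (x \<oplus> y) \<oplus> ((- 1) \<odot> x \<oplus> (- 1) \<odot> y)"
      using that by (simp only: L_add L_scale c[symmetric] a_closed)
    also have "\<dots> = \<zero>" using that by (simp add: scale_minus_one minus_add[symmetric] r_neg)
    finally show ?thesis by (simp add: S_def)
  qed
  have rel': "(\<lambda>b. c (a \<odot> x) b + (- a) * c x b) \<in> S" if "x \<in> carrier V" for a x
  proof -
    have "(\<Oplus>b\<in>B. (c (a \<odot> x) b + (- a) * c x b) \<odot> b) = a \<odot> x \<oplus> (- a) \<odot> x"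
      using that by (simp only: L_add L_scale c[symmetric] scale_closed)
    also have "\<dots> = \<zero>" using that scale_add_left[of x a "- a"] by simp
    finally show ?thesis by (simp add: S_def)
  qed
  have "F b \<in> dual_space V" if b: "b \<in> B" for b
    unfolding dual_space_def
  proof (intro CollectI conjI ballI allI)
    fix x y assume xy: "x \<in> carrier V" "y \<in> carrier V"
    show "F b (x \<oplus> y) = F b x + F b y"
      using piv[OF rel[OF xy] b] xy
      by (simp add: F_def sum.distrib algebra_simps sum_subtractf)
  next
    fix a x assume x: "x \<in> carrier V"
    show "F b (a \<odot> x) = a * F b x"
      using piv[OF rel'[OF x] b] x
      by (simp add: F_def sum.distrib algebra_simps sum_subtractf sum_distrib_left)
  qed (simp add: F_def)
  moreover have "x = (\<Oplus>b\<in>B. F b x \<odot> b)" if x: "x \<in> carrier V" for x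
  proof -
    have "(\<lambda>b. \<Sum>p\<in>Q. c x p * w p b) \<in> S" if "finite Q" "Q \<subseteq> P" for Q
      using that
    proof (induction Q)
      case empty
      show ?case using lincomb_zero[OF B'] by (simp add: S_def)
    qed (use w Sadd Sscale in auto)
    from this[OF finP] have SS: "(\<lambda>b. (- 1) * (\<Sum>p\<in>P. c x p * w p b)) \<in> S"
      by (intro Sscale) simp
    have "(\<Oplus>b\<in>B. F b x \<odot> b) = (\<Oplus>b\<in>B. (c x b + (- 1) * (\<Sum>p\<in>P. c x p * w p b)) \<odot> b)"
      using x by (simp add: F_def)
    also have "\<dots> = x \<oplus> \<zero>"
      using SS by (simp only: L_add c[OF x, symmetric] S_def mem_Collect_eq)
    finally show ?thesis using x by simp
  qed
  ultimately show ?thesis using that[of B F] B by blast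
qed

end

locale k_algebra = ring H + k_space H
  for H :: "('k::field, 'a, 'm) module_scheme" (structure) +
  assumes scale_mult_left: "\<lbrakk>x \<in> carrier H; y \<in> carrier H\<rbrakk> \<Longrightarrow> (c \<odot> x) \<otimes> y = c \<odot> (x \<otimes> y)"
    and scale_mult_right: "\<lbrakk>x \<in> carrier H; y \<in> carrier H\<rbrakk> \<Longrightarrow> x \<otimes> (c \<odot> y) = c \<odot> (x \<otimes> y)"
begin

lemma ideal_scale:
  assumes "ideal I H" "x \<in> I"
  shows "c \<odot> x \<in> I"
proof -
  have x: "x \<in> carrier H" using assms by (auto dest: ideal.Icarr)
  then have "c \<odot> x = (c \<odot> \<one>) \<otimes> x" by (simp add: scale_mult_left)
  then show ?thesis using assms x by (metis ideal.I_l_closed scale_closed one_closed)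
qed

text \<open>
  The operations of the quotient are unions over representatives; they are evaluated here on cosets
  of elements.  Scalar multiplication is well defined because an ideal absorbs \<open>c \<odot> \<one>\<close>.
\<close>

lemma quotient_algebra_simps:
  assumes "ideal I H"
  shows "carrier (quotient_algebra H I) = (+>) I ` carrier H"
    and "\<one>\<^bsub>quotient_algebra H I\<^esub> = I +> \<one>"
    and "\<zero>\<^bsub>quotient_algebra H I\<^esub> = I +> \<zero>"
    and "\<lbrakk>x \<in> carrier H; y \<in> carrier H\<rbrakk> \<Longrightarrow>
      (I +> x) \<oplus>\<^bsub>quotient_algebra H I\<^esub> (I +> y) = I +> (x \<oplus> y)"
    and "\<lbrakk>x \<in> carrier H; y \<in> carrier H\<rbrakk> \<Longrightarrow>
      (I +> x) \<otimes>\<^bsub>quotient_algebra H I\<^esub> (I +> y) = I +> (x \<otimes> y)"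
    and "x \<in> carrier H \<Longrightarrow> c \<odot>\<^bsub>quotient_algebra H I\<^esub> (I +> x) = I +> (c \<odot> x)"
proof -
  interpret ideal I H by fact
  have q: "quotient_algebra H I = \<lparr>carrier = carrier (H Quot I), monoid.mult = monoid.mult (H Quot I),
      one = one (H Quot I), ring.zero = ring.zero (H Quot I), add = add (H Quot I),
      module.smult = (\<lambda>c C. \<Union>x\<in>C. I +> (c \<odot> x))\<rparr>"
    by (simp add: quotient_algebra_def ring.defs module.defs)
  show "carrier (quotient_algebra H I) = (+>) I ` carrier H"
    by (auto simp: q FactRing_simps)
  show "\<one>\<^bsub>quotient_algebra H I\<^esub> = I +> \<one>" by (simp add: q FactRing_simps)
  show "\<zero>\<^bsub>quotient_algebra H I\<^esub> = I +> \<zero>"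
    using a_rcos_const[of \<zero>] by (simp add: q FactRing_simps)
  show "\<lbrakk>x \<in> carrier H; y \<in> carrier H\<rbrakk> \<Longrightarrow>
      (I +> x) \<oplus>\<^bsub>quotient_algebra H I\<^esub> (I +> y) = I +> (x \<oplus> y)"
    by (simp add: q FactRing_simps a_rcos_sum)
  show "\<lbrakk>x \<in> carrier H; y \<in> carrier H\<rbrakk> \<Longrightarrow>
      (I +> x) \<otimes>\<^bsub>quotient_algebra H I\<^esub> (I +> y) = I +> (x \<otimes> y)"
    by (simp add: q FactRing_simps rcoset_mult_add)
  show "c \<odot>\<^bsub>quotient_algebra H I\<^esub> (I +> x) = I +> (c \<odot> x)" if x: "x \<in> carrier H"
  proof -
    have eq: "I +> (c \<odot> y) = I +> (c \<odot> x)" if y: "y \<in> I +> x" for y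
    proof -
      obtain i where i: "i \<in> I" "y = i \<oplus> x" using y by (auto simp: a_r_coset_def r_coset_def)
      have "c \<odot> y = c \<odot> i \<oplus> c \<odot> x" using i x by (auto simp: scale_add_right)
      then have "c \<odot> y \<in> I +> (c \<odot> x)"
        using ideal_scale[OF \<open>ideal I H\<close> i(1)] by (auto simp: a_r_coset_def r_coset_def)
      then show ?thesis
        using a_repr_independence[OF _ _ a_subgroup] x by simp
    qed
    have "I +> x \<noteq> {}" using a_rcos_self[OF x] by blast
    then have "(\<Union>y\<in>I +> x. I +> (c \<odot> y)) = I +> (c \<odot> x)"
      by (rule SUP_eq_const) (rule eq)
    then show ?thesis by (simp add: q)
  qed
qed

lemma quotient_algebra_k_algebra:
  assumes I: "ideal I H"
  shows "k_algebra (quotient_algebra H I)"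
proof -
  let ?Q = "quotient_algebra H I"
  note simps = quotient_algebra_simps[OF I]
  have add: "abelian_group ?Q"
  proof (rule abelian_groupI)
    fix x assume "x \<in> carrier ?Q"
    then obtain a where a: "a \<in> carrier H" "x = I +> a" by (auto simp: simps)
    show "\<exists>y\<in>carrier ?Q. y \<oplus>\<^bsub>?Q\<^esub> x = \<zero>\<^bsub>?Q\<^esub>"
      by (rule bexI[of _ "I +> (\<ominus> a)"]) (use a in \<open>simp_all add: simps l_neg\<close>)
  qed (auto simp: simps a_ac)
  have ring: "ring ?Q"
    by (intro ringI add monoidI) (auto simp: simps m_assoc l_distr r_distr)
  show ?thesis
    by (intro k_algebra.intro k_space.intro ring add k_algebra_axioms.intro k_space_axioms.intro)
      (auto simp: simps scale_add_left scale_add_right scale_scale scale_mult_left scale_mult_right)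
qed

lemma quotient_algebra_lincomb:
  assumes "ideal I H" "finite J" "v \<in> J \<rightarrow> carrier H"
  shows "(\<Oplus>\<^bsub>quotient_algebra H I\<^esub>j\<in>J. c j \<odot>\<^bsub>quotient_algebra H I\<^esub> (I +> v j))
    = I +> (\<Oplus>j\<in>J. c j \<odot> v j)"
proof -
  interpret Q: k_algebra "quotient_algebra H I" by (rule quotient_algebra_k_algebra) fact
  note simps = quotient_algebra_simps[OF assms(1)]
  show ?thesis
    using assms(2,3)
  proof (induction J)
    case (insert j J)
    then have "(\<lambda>j. c j \<odot> v j) \<in> J \<rightarrow> carrier H"
      "(\<lambda>j. c j \<odot>\<^bsub>quotient_algebra H I\<^esub> (I +> v j)) \<in> J \<rightarrow> carrier (quotient_algebra H I)"
      by (auto simp: simps Pi_iff)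
    moreover have "v j \<in> carrier H" "(\<Oplus>j\<in>J. c j \<odot> v j) \<in> carrier H"
      using insert.prems by (auto intro: lincomb_closed)
    ultimately show ?case
      using insert by (simp add: Q.finsum_insert finsum_insert simps)
  qed (simp add: simps)
qed

end

section \<open>Tensor products\<close>

abbreviation pm_scale :: "'k::field \<Rightarrow> ('p \<Rightarrow>\<^sub>0 'k) \<Rightarrow> 'p \<Rightarrow>\<^sub>0 'k"
  where "pm_scale c \<equiv> Poly_Mapping.map ((*) c)"

lemma lookup_pm_scale [simp]: "Poly_Mapping.lookup (pm_scale c x) p = c * Poly_Mapping.lookup x p"
  by (simp add: Poly_Mapping.map.rep_eq when_def)

lemma keys_pm_scale: "Poly_Mapping.keys (pm_scale c x) \<subseteq> Poly_Mapping.keys x"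
  by (auto simp: in_keys_iff)

interpretation pm: Modules.module "pm_scale :: 'k::field \<Rightarrow> ('p \<Rightarrow>\<^sub>0 'k) \<Rightarrow> _"
  by unfold_locales (auto intro!: poly_mapping_eqI simp: lookup_add algebra_simps)

lemma poly_mapping_induct_keys [consumes 1, case_names zero add]:
  fixes x :: "'p \<Rightarrow>\<^sub>0 'k::field"
  assumes "Poly_Mapping.keys x \<subseteq> A" and zero: "P 0"
    and add: "\<And>x p c. \<lbrakk>Poly_Mapping.keys x \<subseteq> A; p \<in> A; P x\<rbrakk> \<Longrightarrow> P (Poly_Mapping.single p c + x)"
  shows "P x"
proof -
  have "Poly_Mapping.keys x \<subseteq> L \<Longrightarrow> L \<subseteq> A \<Longrightarrow> P x" if "finite L" for L x
    using that
  proof (induction L arbitrary: x)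
    case (insert p L)
    define y where "y = x - Poly_Mapping.single p (Poly_Mapping.lookup x p)"
    have "Poly_Mapping.keys y \<subseteq> L"
      using insert.prems by (auto simp: y_def in_keys_iff lookup_minus lookup_single when_def
          split: if_splits)
    moreover have "x = Poly_Mapping.single p (Poly_Mapping.lookup x p) + y"
      by (simp add: y_def)
    ultimately show ?case using add[of y p "Poly_Mapping.lookup x p"] insert by auto
  qed (use zero in auto)
  then show ?thesis using assms(1) finite_keys by blast
qed

lemma UNION_eq_const:
  assumes "x \<in> A" "\<And>x. x \<in> A \<Longrightarrow> F x = E"
  shows "(\<Union>x\<in>A. F x) = E"
  using assms by (intro SUP_eq_const) blast+

lemma UNION_eq_const2:
  assumes "x \<in> A" "y \<in> B" "\<And>x y. x \<in> A \<Longrightarrow> y \<in> B \<Longrightarrow> F x y = E"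
  shows "(\<Union>x\<in>A. \<Union>y\<in>B. F x y) = E"
  by (rule UNION_eq_const[OF assms(1)], rule UNION_eq_const[OF assms(2)], rule assms(3))

definition linear_extension :: "('p \<Rightarrow> 'k::field) \<Rightarrow> ('p \<Rightarrow>\<^sub>0 'k) \<Rightarrow> 'k"
  where "linear_extension \<phi> x = (\<Sum>p\<in>Poly_Mapping.keys x. Poly_Mapping.lookup x p * \<phi> p)"

lemma linear_extension_0 [simp]: "linear_extension \<phi> 0 = 0"
  by (simp add: linear_extension_def)

lemma linear_extension_single [simp]: "linear_extension \<phi> (Poly_Mapping.single p c) = c * \<phi> p"
  by (simp add: linear_extension_def)

lemma linear_extension_add:
  "linear_extension \<phi> (x + y) = linear_extension \<phi> x + linear_extension \<phi> y"
  unfolding linear_extension_def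
  by (rule setsum_keys_plus_distrib[where f = "\<lambda>p c. c * \<phi> p"]) (auto simp: algebra_simps)

lemma linear_extension_scale: "linear_extension \<phi> (pm_scale c x) = c * linear_extension \<phi> x"
proof -
  have "(\<Sum>p\<in>Poly_Mapping.keys (pm_scale c x). (c * Poly_Mapping.lookup x p) * \<phi> p)
      = (\<Sum>p\<in>Poly_Mapping.keys x. (c * Poly_Mapping.lookup x p) * \<phi> p)"
    using keys_pm_scale[of c x] by (intro sum.mono_neutral_left) (auto simp: in_keys_iff)
  then show ?thesis by (simp add: linear_extension_def sum_distrib_left mult.assoc)
qed

lemma linear_extension_diff:
  "linear_extension \<phi> (x - y) = linear_extension \<phi> x - linear_extension \<phi> y"
proof -
  have "linear_extension \<phi> (x - y) + linear_extension \<phi> y = linear_extension \<phi> x"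
    by (simp add: linear_extension_add[symmetric])
  then show ?thesis by (simp add: algebra_simps)
qed

definition bilinear_form ::
  "('k::field, 'a, 'm) module_scheme \<Rightarrow> ('k, 'b, 'n) module_scheme \<Rightarrow> ('a \<Rightarrow> 'b \<Rightarrow> 'k) \<Rightarrow> bool"
  where "bilinear_form V W \<beta> \<longleftrightarrow>
    (\<forall>v\<in>carrier V. \<forall>v'\<in>carrier V. \<forall>w\<in>carrier W. \<beta> (v \<oplus>\<^bsub>V\<^esub> v') w = \<beta> v w + \<beta> v' w) \<and>
    (\<forall>v\<in>carrier V. \<forall>w\<in>carrier W. \<forall>w'\<in>carrier W. \<beta> v (w \<oplus>\<^bsub>W\<^esub> w') = \<beta> v w + \<beta> v w') \<and>
    (\<forall>c. \<forall>v\<in>carrier V. \<forall>w\<in>carrier W. \<beta> (c \<odot>\<^bsub>V\<^esub> v) w = c * \<beta> v w) \<and>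
    (\<forall>c. \<forall>v\<in>carrier V. \<forall>w\<in>carrier W. \<beta> v (c \<odot>\<^bsub>W\<^esub> w) = c * \<beta> v w)"

lemma bilinear_form_dual:
  assumes "f \<in> dual_space V" "g \<in> dual_space W"
  shows "bilinear_form V W (\<lambda>a b. f a * g b)"
  using assms by (simp add: bilinear_form_def dual_space_def algebra_simps)

locale tensor_spaces = V: k_space V + W: k_space W
  for V :: "('k::field, 'a, 'm) module_scheme" and W :: "('k, 'b, 'n) module_scheme"
begin

abbreviation "reps \<equiv> tensor_free (carrier V) (carrier W) :: (('a \<times> 'b) \<Rightarrow>\<^sub>0 'k) set"
abbreviation "null \<equiv> tensor_null V W"
abbreviation "cls \<equiv> tensor_class V W"
abbreviation "pt \<equiv> pure_tensor V W"

lemma reps_0 [simp]: "0 \<in> reps"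
  and reps_add [simp]: "\<lbrakk>x \<in> reps; y \<in> reps\<rbrakk> \<Longrightarrow> x + y \<in> reps"
  and reps_diff [simp]: "\<lbrakk>x \<in> reps; y \<in> reps\<rbrakk> \<Longrightarrow> x - y \<in> reps"
  and reps_uminus [simp]: "x \<in> reps \<Longrightarrow> - x \<in> reps"
  and reps_scale [simp]: "x \<in> reps \<Longrightarrow> pm_scale c x \<in> reps"
  and reps_single: "\<lbrakk>v \<in> carrier V; w \<in> carrier W\<rbrakk> \<Longrightarrow> Poly_Mapping.single (v, w) c \<in> reps"
  using keys_add[of x y] keys_diff[of x y] keys_pm_scale[of c x]
  by (auto simp: tensor_free_def)

lemma reps_induct [consumes 1, case_names zero add]:
  assumes "x \<in> reps" "P 0"
    and "\<And>x v w c. \<lbrakk>x \<in> reps; v \<in> carrier V; w \<in> carrier W; P x\<rbrakk> \<Longrightarrow>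
      P (Poly_Mapping.single (v, w) c + x)"
  shows "P x"
  using assms poly_mapping_induct_keys[of x "carrier V \<times> carrier W" P]
  by (auto simp: tensor_free_def)

lemma null_0 [simp]: "0 \<in> null"
  and null_add: "\<lbrakk>x \<in> null; y \<in> null\<rbrakk> \<Longrightarrow> x + y \<in> null"
  and null_diff: "\<lbrakk>x \<in> null; y \<in> null\<rbrakk> \<Longrightarrow> x - y \<in> null"
  and null_scale: "x \<in> null \<Longrightarrow> pm_scale c x \<in> null"
  unfolding tensor_null_def
  by (auto intro: pm.span_zero pm.span_add pm.span_diff pm.span_scale)

text \<open>
  The relations of the tensor product are imposed with coefficient 1; being closed under scaling,
  the null space contains their versions with any coefficient \<open>c\<close>.
\<close>

lemma null_rels:
  shows "\<lbrakk>v \<in> carrier V; v' \<in> carrier V; w \<in> carrier W\<rbrakk> \<Longrightarrow>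
      Poly_Mapping.single (v \<oplus>\<^bsub>V\<^esub> v', w) c - Poly_Mapping.single (v, w) c
        - Poly_Mapping.single (v', w) c \<in> null"
    and "\<lbrakk>v \<in> carrier V; w \<in> carrier W; w' \<in> carrier W\<rbrakk> \<Longrightarrow>
      Poly_Mapping.single (v, w \<oplus>\<^bsub>W\<^esub> w') c - Poly_Mapping.single (v, w) c
        - Poly_Mapping.single (v, w') c \<in> null"
    and "\<lbrakk>v \<in> carrier V; w \<in> carrier W\<rbrakk> \<Longrightarrow>
      Poly_Mapping.single (d \<odot>\<^bsub>V\<^esub> v, w) c - Poly_Mapping.single (v, w) (c * d) \<in> null"
    and "\<lbrakk>v \<in> carrier V; w \<in> carrier W\<rbrakk> \<Longrightarrow>
      Poly_Mapping.single (v, d \<odot>\<^bsub>W\<^esub> w) c - Poly_Mapping.single (v, w) (c * d) \<in> null"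
proof -
  have scaled: "pm_scale c x \<in> null" if "x \<in> bilinear_rels V W" for x
    using that unfolding tensor_null_def by (intro pm.span_scale pm.span_base)
  show "Poly_Mapping.single (v \<oplus>\<^bsub>V\<^esub> v', w) c - Poly_Mapping.single (v, w) c
      - Poly_Mapping.single (v', w) c \<in> null"
    if "v \<in> carrier V" "v' \<in> carrier V" "w \<in> carrier W"
    using scaled[of "Poly_Mapping.single (v \<oplus>\<^bsub>V\<^esub> v', w) 1 - Poly_Mapping.single (v, w) 1
      - Poly_Mapping.single (v', w) 1"] that
    by (simp add: pm.scale_right_diff_distrib) (auto simp: bilinear_rels_def)
  show "Poly_Mapping.single (v, w \<oplus>\<^bsub>W\<^esub> w') c - Poly_Mapping.single (v, w) c
      - Poly_Mapping.single (v, w') c \<in> null"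
    if "v \<in> carrier V" "w \<in> carrier W" "w' \<in> carrier W"
    using scaled[of "Poly_Mapping.single (v, w \<oplus>\<^bsub>W\<^esub> w') 1 - Poly_Mapping.single (v, w) 1
      - Poly_Mapping.single (v, w') 1"] that
    by (simp add: pm.scale_right_diff_distrib) (auto simp: bilinear_rels_def)
  show "Poly_Mapping.single (d \<odot>\<^bsub>V\<^esub> v, w) c - Poly_Mapping.single (v, w) (c * d) \<in> null"
    if "v \<in> carrier V" "w \<in> carrier W"
    using scaled[of "Poly_Mapping.single (d \<odot>\<^bsub>V\<^esub> v, w) 1 - Poly_Mapping.single (v, w) d"] that
    by (simp add: pm.scale_right_diff_distrib) (auto simp: bilinear_rels_def)
  show "Poly_Mapping.single (v, d \<odot>\<^bsub>W\<^esub> w) c - Poly_Mapping.single (v, w) (c * d) \<in> null"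
    if "v \<in> carrier V" "w \<in> carrier W"
    using scaled[of "Poly_Mapping.single (v, d \<odot>\<^bsub>W\<^esub> w) 1 - Poly_Mapping.single (v, w) d"] that
    by (simp add: pm.scale_right_diff_distrib) (auto simp: bilinear_rels_def)
qed

lemma null_sum: "(\<And>i. i \<in> I \<Longrightarrow> x i \<in> null) \<Longrightarrow> sum x I \<in> null"
  unfolding tensor_null_def by (rule pm.span_sum)

lemma null_lincomb_left:
  assumes "finite I" "u \<in> I \<rightarrow> carrier V" "w \<in> carrier W"
  shows "Poly_Mapping.single (\<Oplus>\<^bsub>V\<^esub>i\<in>I. d i \<odot>\<^bsub>V\<^esub> u i, w) c
    - (\<Sum>i\<in>I. Poly_Mapping.single (u i, w) (c * d i)) \<in> null"
  using assms(1,2)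
proof (induction I)
  case empty
  have "Poly_Mapping.single (0 \<odot>\<^bsub>V\<^esub> \<zero>\<^bsub>V\<^esub>, w) c - Poly_Mapping.single (\<zero>\<^bsub>V\<^esub>, w) (c * 0) \<in> null"
    using assms by (intro null_rels) auto
  then show ?case by simp
next
  case (insert i I)
  let ?s = "\<Oplus>\<^bsub>V\<^esub>i\<in>I. d i \<odot>\<^bsub>V\<^esub> u i" and ?t = "d i \<odot>\<^bsub>V\<^esub> u i"
  have closed: "u i \<in> carrier V" "?s \<in> carrier V" "(\<lambda>i. d i \<odot>\<^bsub>V\<^esub> u i) \<in> I \<rightarrow> carrier V"
    using insert.prems by (auto simp: Pi_iff)
  have "Poly_Mapping.single (?t \<oplus>\<^bsub>V\<^esub> ?s, w) c - Poly_Mapping.single (?t, w) c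
      - Poly_Mapping.single (?s, w) c \<in> null"
    "Poly_Mapping.single (?t, w) c - Poly_Mapping.single (u i, w) (c * d i) \<in> null"
    using closed assms(3) by (auto intro!: null_rels)
  from null_add[OF null_add[OF this] insert.IH] show ?case
    using insert closed by (simp add: V.finsum_insert algebra_simps)
qed

lemma null_lincomb_right:
  assumes "finite I" "u \<in> I \<rightarrow> carrier W" "v \<in> carrier V"
  shows "Poly_Mapping.single (v, \<Oplus>\<^bsub>W\<^esub>i\<in>I. d i \<odot>\<^bsub>W\<^esub> u i) c
    - (\<Sum>i\<in>I. Poly_Mapping.single (v, u i) (c * d i)) \<in> null"
  using assms(1,2)
proof (induction I)
  case empty
  have "Poly_Mapping.single (v, 0 \<odot>\<^bsub>W\<^esub> \<zero>\<^bsub>W\<^esub>) c - Poly_Mapping.single (v, \<zero>\<^bsub>W\<^esub>) (c * 0) \<in> null"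
    using assms by (intro null_rels) auto
  then show ?case by simp
next
  case (insert i I)
  let ?s = "\<Oplus>\<^bsub>W\<^esub>i\<in>I. d i \<odot>\<^bsub>W\<^esub> u i" and ?t = "d i \<odot>\<^bsub>W\<^esub> u i"
  have closed: "u i \<in> carrier W" "?s \<in> carrier W" "(\<lambda>i. d i \<odot>\<^bsub>W\<^esub> u i) \<in> I \<rightarrow> carrier W"
    using insert.prems by (auto simp: Pi_iff)
  have "Poly_Mapping.single (v, ?t \<oplus>\<^bsub>W\<^esub> ?s) c - Poly_Mapping.single (v, ?t) c
      - Poly_Mapping.single (v, ?s) c \<in> null"
    "Poly_Mapping.single (v, ?t) c - Poly_Mapping.single (v, u i) (c * d i) \<in> null"
    using closed assms(3) by (auto intro!: null_rels)
  from null_add[OF null_add[OF this] insert.IH] show ?case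
    using insert closed by (simp add: W.finsum_insert algebra_simps)
qed

lemma cls_self: "x \<in> reps \<Longrightarrow> x \<in> cls x"
  by (simp add: tensor_class_def)

lemma in_cls: "y \<in> cls x \<Longrightarrow> y \<in> reps \<and> y - x \<in> null"
  by (simp add: tensor_class_def)

lemma cls_eqI:
  assumes "x - y \<in> null"
  shows "cls x = cls y"
proof -
  have "z - x \<in> null \<longleftrightarrow> z - y \<in> null" for z
    using null_add[of "z - x" "x - y"] null_diff[of "z - y" "x - y"] assms by auto
  then show ?thesis by (simp add: tensor_class_def)
qed

lemma tensor_carrier: "carrier (tensor V W) = cls ` reps"
  and tensor_zero: "\<zero>\<^bsub>tensor V W\<^esub> = cls 0"
  and tensor_one: "\<one>\<^bsub>tensor V W\<^esub> = pt \<one>\<^bsub>V\<^esub> \<one>\<^bsub>W\<^esub>"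
  by (simp_all add: tensor_def)

lemma tensor_add:
  assumes "x \<in> reps" "y \<in> reps"
  shows "cls x \<oplus>\<^bsub>tensor V W\<^esub> cls y = cls (x + y)"
proof -
  have "cls (x' + y') = cls (x + y)" if "x' \<in> cls x" "y' \<in> cls y" for x' y'
    using null_add[of "x' - x" "y' - y"] in_cls[OF that(1)] in_cls[OF that(2)]
    by (intro cls_eqI) (simp add: algebra_simps)
  then have "(\<Union>x\<in>cls x. \<Union>y\<in>cls y. cls (x + y)) = cls (x + y)"
    by (rule UNION_eq_const2[OF cls_self[OF assms(1)] cls_self[OF assms(2)]])
  then show ?thesis by (simp add: tensor_def)
qed

lemma tensor_smult:
  assumes "x \<in> reps"
  shows "c \<odot>\<^bsub>tensor V W\<^esub> cls x = cls (pm_scale c x)"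
proof -
  have "cls (pm_scale c x') = cls (pm_scale c x)" if "x' \<in> cls x" for x'
    using null_scale[of "x' - x" c] in_cls[OF that]
    by (intro cls_eqI) (simp add: pm.scale_right_diff_distrib)
  then have "(\<Union>x\<in>cls x. cls (pm_scale c x)) = cls (pm_scale c x)"
    by (rule UNION_eq_const[OF cls_self[OF assms]])
  then show ?thesis by (simp add: tensor_def)
qed

lemma tensor_abelian_group: "abelian_group (tensor V W)"
proof (rule abelian_groupI)
  fix t assume "t \<in> carrier (tensor V W)"
  then obtain x where x: "x \<in> reps" "t = cls x" by (auto simp: tensor_carrier)
  then show "\<exists>s\<in>carrier (tensor V W). s \<oplus>\<^bsub>tensor V W\<^esub> t = \<zero>\<^bsub>tensor V W\<^esub>"
    by (intro bexI[of _ "cls (- x)"]) (auto simp: tensor_add tensor_zero tensor_carrier)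
qed (auto simp: tensor_carrier tensor_add tensor_zero algebra_simps)

sublocale T: k_space "tensor V W"
proof -
  show "k_space (tensor V W)"
    by (intro k_space.intro tensor_abelian_group k_space_axioms.intro)
      (auto simp: tensor_carrier tensor_add tensor_smult pm.scale_left_distrib
        pm.scale_right_distrib)
qed

lemma pt_closed [simp]: "\<lbrakk>v \<in> carrier V; w \<in> carrier W\<rbrakk> \<Longrightarrow> pt v w \<in> carrier (tensor V W)"
  by (simp add: tensor_carrier pure_tensor_def reps_single)

lemma pt_add_left: "\<lbrakk>v \<in> carrier V; v' \<in> carrier V; w \<in> carrier W\<rbrakk> \<Longrightarrow>
    pt (v \<oplus>\<^bsub>V\<^esub> v') w = pt v w \<oplus>\<^bsub>tensor V W\<^esub> pt v' w"
  and pt_add_right: "\<lbrakk>v \<in> carrier V; w \<in> carrier W; w' \<in> carrier W\<rbrakk> \<Longrightarrow>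
    pt v (w \<oplus>\<^bsub>W\<^esub> w') = pt v w \<oplus>\<^bsub>tensor V W\<^esub> pt v w'"
  using null_rels(1)[of v v' w 1] null_rels(2)[of v w w' 1]
  by (auto simp: pure_tensor_def tensor_add reps_single diff_diff_add intro!: cls_eqI)

lemma pt_scale_left: "\<lbrakk>v \<in> carrier V; w \<in> carrier W\<rbrakk> \<Longrightarrow>
    pt (c \<odot>\<^bsub>V\<^esub> v) w = c \<odot>\<^bsub>tensor V W\<^esub> pt v w"
  and pt_scale_right: "\<lbrakk>v \<in> carrier V; w \<in> carrier W\<rbrakk> \<Longrightarrow>
    pt v (c \<odot>\<^bsub>W\<^esub> w) = c \<odot>\<^bsub>tensor V W\<^esub> pt v w"
  using null_rels(3)[of v w c 1] null_rels(4)[of v w c 1]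
  by (auto simp: pure_tensor_def tensor_smult reps_single intro!: cls_eqI)

text \<open>
  A bilinear form vanishes on the bilinearity relations, so that its linear extension descends to
  the tensor product.
\<close>

lemma linear_extension_null:
  assumes "bilinear_form V W \<beta>" "x \<in> null"
  shows "linear_extension (\<lambda>p. \<beta> (fst p) (snd p)) x = 0"
  using assms(2) unfolding tensor_null_def
proof (induction x rule: pm.span_induct_alt)
  case (step c x y)
  have "linear_extension (\<lambda>p. \<beta> (fst p) (snd p)) x = 0"
    using step(1) assms(1)
    unfolding bilinear_rels_def bilinear_form_def by (auto simp: linear_extension_diff)
  then show ?case using step(2) by (simp add: linear_extension_add linear_extension_scale)
qed simp

lemma tensor_form_cls:
  assumes \<beta>: "bilinear_form V W \<beta>" and x: "x \<in> reps"
  shows "tensor_form \<beta> (cls x) = linear_extension (\<lambda>p. \<beta> (fst p) (snd p)) x"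
proof -
  let ?F = "linear_extension (\<lambda>p. \<beta> (fst p) (snd p))"
  have eq: "?F y = ?F x" if "y \<in> cls x" for y
    using linear_extension_null[OF \<beta>, of "y - x"] in_cls[OF that]
    by (simp add: linear_extension_diff)
  have "cls x \<noteq> {}" using cls_self[OF x] by blast
  from the_elem_image_unique[of "cls x" ?F "?F x", OF this eq] show ?thesis
    by (simp add: tensor_form_def linear_extension_def)
qed

lemma tensor_form_add:
  assumes "bilinear_form V W \<beta>" "s \<in> carrier (tensor V W)" "t \<in> carrier (tensor V W)"
  shows "tensor_form \<beta> (s \<oplus>\<^bsub>tensor V W\<^esub> t) = tensor_form \<beta> s + tensor_form \<beta> t"
  using assms by (auto simp: tensor_carrier tensor_add tensor_form_cls linear_extension_add)

lemma tensor_form_scale: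
  assumes "bilinear_form V W \<beta>" "t \<in> carrier (tensor V W)"
  shows "tensor_form \<beta> (c \<odot>\<^bsub>tensor V W\<^esub> t) = c * tensor_form \<beta> t"
  using assms by (auto simp: tensor_carrier tensor_smult tensor_form_cls linear_extension_scale)

lemma tensor_form_pt:
  assumes "bilinear_form V W \<beta>" "v \<in> carrier V" "w \<in> carrier W"
  shows "tensor_form \<beta> (pt v w) = \<beta> v w"
  using assms by (simp add: pure_tensor_def tensor_form_cls reps_single)

end

lemma tensor_free_mult_superset:
  assumes "finite A" "finite B" "Poly_Mapping.keys x \<subseteq> A" "Poly_Mapping.keys y \<subseteq> B"
  shows "tensor_free_mult V W x y = (\<Sum>p\<in>A. \<Sum>r\<in>B.
      Poly_Mapping.single (fst p \<otimes>\<^bsub>V\<^esub> fst r, snd p \<otimes>\<^bsub>W\<^esub> snd r)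
        (Poly_Mapping.lookup x p * Poly_Mapping.lookup y r))"
proof -
  have "(\<Sum>r\<in>Poly_Mapping.keys y. Poly_Mapping.single (fst p \<otimes>\<^bsub>V\<^esub> fst r, snd p \<otimes>\<^bsub>W\<^esub> snd r)
        (Poly_Mapping.lookup x p * Poly_Mapping.lookup y r)) =
      (\<Sum>r\<in>B. Poly_Mapping.single (fst p \<otimes>\<^bsub>V\<^esub> fst r, snd p \<otimes>\<^bsub>W\<^esub> snd r)
        (Poly_Mapping.lookup x p * Poly_Mapping.lookup y r))" for p
    using assms by (intro sum.mono_neutral_left) (auto simp: in_keys_iff)
  then show ?thesis
    unfolding tensor_free_mult_def
    using assms by (auto simp: in_keys_iff intro!: sum.mono_neutral_left)
qed

lemma tensor_free_mult_0 [simp]: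
  "tensor_free_mult V W 0 y = 0" "tensor_free_mult V W x 0 = 0"
  by (simp_all add: tensor_free_mult_def)

lemma tensor_free_mult_single [simp]:
  "tensor_free_mult V W (Poly_Mapping.single p c) (Poly_Mapping.single r d) =
    Poly_Mapping.single (fst p \<otimes>\<^bsub>V\<^esub> fst r, snd p \<otimes>\<^bsub>W\<^esub> snd r) (c * d)"
  using tensor_free_mult_superset[of "{p}" "{r}" "Poly_Mapping.single p c"
      "Poly_Mapping.single r d" V W] by simp

lemma tensor_free_mult_add_left:
  "tensor_free_mult V W (x + x') y = tensor_free_mult V W x y + tensor_free_mult V W x' y"
proof -
  define A where "A = Poly_Mapping.keys x \<union> Poly_Mapping.keys x' \<union> Poly_Mapping.keys (x + x')"
  then have fin: "finite A" and sub: "Poly_Mapping.keys x \<subseteq> A" "Poly_Mapping.keys x' \<subseteq> A"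
    "Poly_Mapping.keys (x + x') \<subseteq> A" by auto
  show ?thesis
    by (simp add: sub[THEN tensor_free_mult_superset[OF fin finite_keys _ order_refl]]
        lookup_add algebra_simps single_add sum.distrib)
qed

lemma tensor_free_mult_add_right:
  "tensor_free_mult V W x (y + y') = tensor_free_mult V W x y + tensor_free_mult V W x y'"
proof -
  define B where "B = Poly_Mapping.keys y \<union> Poly_Mapping.keys y' \<union> Poly_Mapping.keys (y + y')"
  then have fin: "finite B" and sub: "Poly_Mapping.keys y \<subseteq> B" "Poly_Mapping.keys y' \<subseteq> B"
    "Poly_Mapping.keys (y + y') \<subseteq> B" by auto
  show ?thesis
    by (simp add: sub[THEN tensor_free_mult_superset[OF finite_keys fin order_refl]]
        lookup_add algebra_simps single_add sum.distrib)
qed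

lemma tensor_free_mult_scale:
  "tensor_free_mult V W (pm_scale c x) y = pm_scale c (tensor_free_mult V W x y)"
  "tensor_free_mult V W x (pm_scale c y) = pm_scale c (tensor_free_mult V W x y)"
  using tensor_free_mult_superset[of "Poly_Mapping.keys x" "Poly_Mapping.keys y" "pm_scale c x" y V W]
    tensor_free_mult_superset[of "Poly_Mapping.keys x" "Poly_Mapping.keys y" x "pm_scale c y" V W]
  by (simp_all add: keys_pm_scale tensor_free_mult_def pm.scale_sum_right algebra_simps)

lemma tensor_free_mult_diff:
  "tensor_free_mult V W (x - x') y = tensor_free_mult V W x y - tensor_free_mult V W x' y"
  "tensor_free_mult V W x (y - y') = tensor_free_mult V W x y - tensor_free_mult V W x y'"
  using tensor_free_mult_add_left[of V W "x - x'" x' y]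
    tensor_free_mult_add_right[of V W x "y - y'" y'] by (simp_all add: eq_diff_eq)

text \<open>
  For algebras \<open>V\<close> and \<open>W\<close>, the free space on pairs is an algebra under \<open>tensor_free_mult\<close>, and the
  null space is an ideal: multiplying a bilinearity relation by a pair gives, by distributivity in
  \<open>V\<close> and \<open>W\<close>, a relation of the same kind.  The tensor product is the quotient.
\<close>

locale tensor_algebras = V: k_algebra V + W: k_algebra W
  for V :: "('k::field, 'a, 'm) module_scheme" and W :: "('k, 'b, 'n) module_scheme"
begin

sublocale tensor_spaces V W ..

abbreviation "tm \<equiv> tensor_free_mult V W"

lemma reps_mult [simp]: "\<lbrakk>x \<in> reps; y \<in> reps\<rbrakk> \<Longrightarrow> tm x y \<in> reps"
proof (induction x rule: reps_induct)
  case (add x v w c)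
  have "tm (Poly_Mapping.single (v, w) c) y \<in> reps"
    using add.prems
    by (induction y rule: reps_induct)
      (use add.hyps in \<open>simp_all add: tensor_free_mult_add_right reps_single\<close>)
  then show ?case using add by (simp add: tensor_free_mult_add_left)
qed simp

lemma tm_assoc:
  assumes "x \<in> reps" "y \<in> reps" "z \<in> reps"
  shows "tm (tm x y) z = tm x (tm y z)"
proof -
  note distr = tensor_free_mult_add_left tensor_free_mult_add_right
  have 1: "tm (tm (Poly_Mapping.single (v, w) c) (Poly_Mapping.single (v', w') c')) z
      = tm (Poly_Mapping.single (v, w) c) (tm (Poly_Mapping.single (v', w') c') z)"
    if "v \<in> carrier V" "w \<in> carrier W" "v' \<in> carrier V" "w' \<in> carrier W" for v w c v' w' c'
    using assms(3)
    by (induction z rule: reps_induct) (use that in \<open>simp_all add: distr V.m_assoc W.m_assoc mult.assoc\<close>)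
  have 2: "tm (tm (Poly_Mapping.single (v, w) c) y) z = tm (Poly_Mapping.single (v, w) c) (tm y z)"
    if "v \<in> carrier V" "w \<in> carrier W" for v w c
    using assms(2) by (induction y rule: reps_induct) (use that 1 in \<open>simp_all add: distr\<close>)
  show ?thesis
    using assms(1) by (induction x rule: reps_induct) (use 2 in \<open>simp_all add: distr\<close>)
qed

lemma null_mult_right:
  assumes "x \<in> null" "y \<in> reps"
  shows "tm x y \<in> null"
  using assms(2)
proof (induction y rule: reps_induct)
  case (add y v w c)
  have "tm x (Poly_Mapping.single (v, w) c) \<in> null"
    using assms(1) unfolding tensor_null_def
  proof (induction x rule: pm.span_induct_alt)
    case (step d x x')
    have "tm x (Poly_Mapping.single (v, w) c) \<in> null"
      using step(1) add.hyps unfolding bilinear_rels_def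
      by (auto simp: tensor_free_mult_diff V.l_distr W.l_distr V.scale_mult_left W.scale_mult_left
          null_rels null_rels(3,4)[where c = c, unfolded mult.commute[of c]])
    then have "pm_scale d (tm x (Poly_Mapping.single (v, w) c)) + tm x' (Poly_Mapping.single (v, w) c) \<in> null"
      using step(2) null_add null_scale by (simp add: tensor_null_def)
    then show ?case
      by (simp add: tensor_free_mult_add_left tensor_free_mult_scale tensor_null_def)
  qed (use null_0 in \<open>simp add: tensor_null_def\<close>)
  then show ?case using add by (simp add: tensor_free_mult_add_right null_add)
qed simp

lemma null_mult_left:
  assumes "x \<in> null" "y \<in> reps"
  shows "tm y x \<in> null"
  using assms(2)
proof (induction y rule: reps_induct)
  case (add y v w c)
  have "tm (Poly_Mapping.single (v, w) c) x \<in> null"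
    using assms(1) unfolding tensor_null_def
  proof (induction x rule: pm.span_induct_alt)
    case (step d x x')
    have "tm (Poly_Mapping.single (v, w) c) x \<in> null"
      using step(1) add.hyps unfolding bilinear_rels_def
      by (auto simp: tensor_free_mult_diff V.r_distr W.r_distr V.scale_mult_right W.scale_mult_right
          null_rels)
    then have "pm_scale d (tm (Poly_Mapping.single (v, w) c) x) + tm (Poly_Mapping.single (v, w) c) x' \<in> null"
      using step(2) null_add null_scale by (simp add: tensor_null_def)
    then show ?case
      by (simp add: tensor_free_mult_add_right tensor_free_mult_scale tensor_null_def)
  qed (use null_0 in \<open>simp add: tensor_null_def\<close>)
  then show ?case using add by (simp add: tensor_free_mult_add_left null_add)
qed simp

lemma tensor_mult:
  assumes "x \<in> reps" "y \<in> reps"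
  shows "cls x \<otimes>\<^bsub>tensor V W\<^esub> cls y = cls (tm x y)"
proof -
  have "cls (tm x' y') = cls (tm x y)" if "x' \<in> cls x" "y' \<in> cls y" for x' y'
  proof (rule cls_eqI)
    have "tm x' y' - tm x y = tm (x' - x) y' + tm x (y' - y)"
      by (simp add: tensor_free_mult_diff)
    moreover have "tm (x' - x) y' \<in> null" "tm x (y' - y) \<in> null"
      using in_cls[OF that(1)] in_cls[OF that(2)] assms
      by (auto intro: null_mult_left null_mult_right)
    ultimately show "tm x' y' - tm x y \<in> null" by (simp add: null_add)
  qed
  then have "(\<Union>x\<in>cls x. \<Union>y\<in>cls y. cls (tm x y)) = cls (tm x y)"
    by (rule UNION_eq_const2[OF cls_self[OF assms(1)] cls_self[OF assms(2)]])
  then show ?thesis by (simp add: tensor_def)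
qed

lemma pt_mult:
  "\<lbrakk>v \<in> carrier V; v' \<in> carrier V; w \<in> carrier W; w' \<in> carrier W\<rbrakk> \<Longrightarrow>
    pt v w \<otimes>\<^bsub>tensor V W\<^esub> pt v' w' = pt (v \<otimes>\<^bsub>V\<^esub> v') (w \<otimes>\<^bsub>W\<^esub> w')"
  by (simp add: pure_tensor_def tensor_mult reps_single)

lemma tensor_k_algebra: "k_algebra (tensor V W)"
proof -
  let ?one = "Poly_Mapping.single (\<one>\<^bsub>V\<^esub>, \<one>\<^bsub>W\<^esub>) (1::'k)"
  have one: "\<one>\<^bsub>tensor V W\<^esub> = cls ?one" "?one \<in> reps"
    by (simp_all add: tensor_one pure_tensor_def reps_single)
  have one_mult: "tm ?one x = x \<and> tm x ?one = x" if "x \<in> reps" for x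
    using that by (induction x rule: reps_induct)
      (simp_all add: tensor_free_mult_add_left tensor_free_mult_add_right)
  have "ring (tensor V W)"
  proof (rule ringI)
    show "Group.monoid (tensor V W)"
      by (rule monoidI) (auto simp: tensor_carrier one tensor_mult tm_assoc one_mult)
  qed (auto simp: tensor_abelian_group tensor_carrier tensor_mult tensor_add
      tensor_free_mult_add_left tensor_free_mult_add_right)
  then show ?thesis
    by (intro k_algebra.intro k_algebra_axioms.intro T.k_space_axioms)
      (auto simp: tensor_carrier tensor_mult tensor_smult tensor_free_mult_scale)
qed

end

section \<open>Homomorphisms from presented algebras\<close>

lemma free_algebra_simps [simp]:
  "carrier free_algebra = UNIV"
  "x \<otimes>\<^bsub>free_algebra\<^esub> y = x * y"
  "\<one>\<^bsub>free_algebra\<^esub> = 1"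
  "\<zero>\<^bsub>free_algebra\<^esub> = 0"
  "x \<oplus>\<^bsub>free_algebra\<^esub> y = x + y"
  "c \<odot>\<^bsub>free_algebra\<^esub> x = pm_scale c x"
  by (simp_all add: free_algebra_def ring_of_type_algebra_def ring.defs module.defs
      mult_map_scale_conv_mult)

text \<open>
  A scalar multiple is a product with a multiple of the empty word, which is neutral for
  concatenation; hence scalars are central.
\<close>

lemma pm_scale_mult:
  fixes x y :: "'g word \<Rightarrow>\<^sub>0 'k::field"
  shows "pm_scale c x * y = pm_scale c (x * y)" "x * pm_scale c y = pm_scale c (x * y)"
proof -
  have central: "x * Poly_Mapping.single 0 c = Poly_Mapping.single 0 c * x"
    using subset_UNIV
    by (induction x rule: poly_mapping_induct_keys)
      (simp_all add: algebra_simps mult_single)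
  show "pm_scale c x * y = pm_scale c (x * y)"
    by (simp add: mult_map_scale_conv_mult mult.assoc)
  show "x * pm_scale c y = pm_scale c (x * y)"
    using central by (simp add: mult_map_scale_conv_mult mult.assoc[symmetric])
qed

interpretation free: k_algebra "free_algebra :: ('k::field, 'g word \<Rightarrow>\<^sub>0 'k) module"
proof -
  let ?F = "free_algebra :: ('k, 'g word \<Rightarrow>\<^sub>0 'k) module"
  have add: "abelian_group ?F"
  proof (rule abelian_groupI)
    fix x assume "x \<in> carrier ?F"
    show "\<exists>y\<in>carrier ?F. y \<oplus>\<^bsub>?F\<^esub> x = \<zero>\<^bsub>?F\<^esub>" by (rule bexI[of _ "- x"]) auto
  qed (auto simp: algebra_simps)
  have ring: "ring ?F"
    by (intro ringI add monoidI) (auto simp: algebra_simps)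
  show "k_algebra ?F"
    by (intro k_algebra.intro k_space.intro ring add k_algebra_axioms.intro k_space_axioms.intro)
      (auto simp: pm.scale_left_distrib pm.scale_right_distrib pm_scale_mult)
qed

definition eval_word :: "('k::field, 'b, 'm) module_scheme \<Rightarrow> ('g \<Rightarrow> 'b) \<Rightarrow> 'g word \<Rightarrow> 'b"
  where "eval_word B \<phi> w = foldr (\<lambda>s b. \<phi> s \<otimes>\<^bsub>B\<^esub> b) (letters w) \<one>\<^bsub>B\<^esub>"

context k_algebra
begin

context
  fixes \<phi> :: "'g \<Rightarrow> 'a"
  assumes \<phi> [simp]: "\<And>s. \<phi> s \<in> carrier H"
begin

lemma eval_word_closed [simp]: "eval_word H \<phi> w \<in> carrier H"
proof -
  have "foldr (\<lambda>s b. \<phi> s \<otimes> b) l \<one> \<in> carrier H" for l by (induction l) auto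
  then show ?thesis by (simp add: eval_word_def)
qed

lemma eval_word_0: "eval_word H \<phi> 0 = \<one>"
  by (simp add: eval_word_def zero_word_def)

lemma eval_word_add: "eval_word H \<phi> (u + v) = eval_word H \<phi> u \<otimes> eval_word H \<phi> v"
proof -
  have closed: "foldr (\<lambda>s b. \<phi> s \<otimes> b) l \<one> \<in> carrier H" for l by (induction l) auto
  have "foldr (\<lambda>s b. \<phi> s \<otimes> b) (l @ l') \<one>
      = foldr (\<lambda>s b. \<phi> s \<otimes> b) l \<one> \<otimes> foldr (\<lambda>s b. \<phi> s \<otimes> b) l' \<one>" for l l'
    by (induction l) (use closed in \<open>simp_all add: m_assoc del: foldr_append\<close>)
  then show ?thesis by (simp add: eval_word_def plus_word_def)
qed

lemma eval_free_superset:
  assumes "finite A" "Poly_Mapping.keys x \<subseteq> A"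
  shows "eval_free H \<phi> x = (\<Oplus>w\<in>A. Poly_Mapping.lookup x w \<odot> eval_word H \<phi> w)"
  unfolding eval_free_def eval_word_def[symmetric]
  using assms by (intro add.finprod_mono_neutral_cong_left) (auto simp: in_keys_iff)

lemma eval_free_closed [simp]: "eval_free H \<phi> x \<in> carrier H"
  by (simp add: eval_free_superset[OF finite_keys order_refl])

lemma eval_free_add [simp]: "eval_free H \<phi> (x + y) = eval_free H \<phi> x \<oplus> eval_free H \<phi> y"
proof -
  define A where "A = Poly_Mapping.keys x \<union> Poly_Mapping.keys y \<union> Poly_Mapping.keys (x + y)"
  then have fin: "finite A" and sub: "Poly_Mapping.keys x \<subseteq> A" "Poly_Mapping.keys y \<subseteq> A"
    "Poly_Mapping.keys (x + y) \<subseteq> A" by auto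
  show ?thesis
    by (simp add: sub[THEN eval_free_superset[OF fin]] lookup_add lincomb_add)
qed

lemma eval_free_scale [simp]: "eval_free H \<phi> (pm_scale c x) = c \<odot> eval_free H \<phi> x"
  using eval_free_superset[OF finite_keys keys_pm_scale, of c x]
    eval_free_superset[OF finite_keys order_refl, of x]
  by (simp add: lincomb_scale)

lemma eval_free_single [simp]: "eval_free H \<phi> (Poly_Mapping.single w c) = c \<odot> eval_word H \<phi> w"
  using eval_free_superset[of "{w}" "Poly_Mapping.single w c"] by (simp add: finsum_insert)

lemma eval_free_0 [simp]: "eval_free H \<phi> 0 = \<zero>"
  by (simp add: eval_free_def)

lemma eval_free_1 [simp]: "eval_free H \<phi> 1 = \<one>"
  using eval_free_single[of 0 1] by (simp add: eval_word_0 del: eval_free_single)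

lemma eval_free_letter [simp]: "eval_free H \<phi> (letter s) = \<phi> s"
  by (simp add: letter_def eval_word_def)

lemma eval_free_const [simp]: "eval_free H \<phi> (const c) = c \<odot> \<one>"
  by (simp add: const_def eval_word_0)

lemma eval_free_mult [simp]: "eval_free H \<phi> (x * y) = eval_free H \<phi> x \<otimes> eval_free H \<phi> y"
proof -
  have single: "eval_free H \<phi> (Poly_Mapping.single u c * y) = eval_free H \<phi> (Poly_Mapping.single u c) \<otimes> eval_free H \<phi> y"
    for u c y
    using subset_UNIV
    by (induction y rule: poly_mapping_induct_keys)
      (simp_all add: distrib_left r_distr mult_single eval_word_add scale_mult_left
        scale_mult_right scale_scale mult.commute[of c])
  show ?thesis
    using subset_UNIV
    by (induction x rule: poly_mapping_induct_keys) (simp_all add: distrib_right l_distr single)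
qed

lemma eval_free_diff [simp]: "eval_free H \<phi> (x - y) = eval_free H \<phi> x \<ominus> eval_free H \<phi> y"
proof -
  have "eval_free H \<phi> (x - y) = eval_free H \<phi> (x + pm_scale (- 1) y)" by simp
  then show ?thesis
    by (simp only: eval_free_add eval_free_scale scale_minus_one eval_free_closed a_minus_def)
qed

end

end

locale presentation =
  fixes R :: "('g word \<Rightarrow>\<^sub>0 'k::field) set"
begin

abbreviation "relators \<equiv> Idl\<^bsub>free_algebra\<^esub> R"
abbreviation "P \<equiv> presented_algebra R"
abbreviation "proj x \<equiv> relators +>\<^bsub>free_algebra\<^esub> x"

lemma relators_ideal: "ideal relators free_algebra"
  by (rule free.genideal_ideal) simp

sublocale P: k_algebra P
  unfolding presented_algebra_def by (rule free.quotient_algebra_k_algebra[OF relators_ideal])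

lemma proj_simps:
  "carrier P = range proj"
  "\<one>\<^bsub>P\<^esub> = proj 1"
  "\<zero>\<^bsub>P\<^esub> = proj 0"
  "proj x \<oplus>\<^bsub>P\<^esub> proj y = proj (x + y)"
  "proj x \<otimes>\<^bsub>P\<^esub> proj y = proj (x * y)"
  "c \<odot>\<^bsub>P\<^esub> proj x = proj (pm_scale c x)"
  using free.quotient_algebra_simps[OF relators_ideal]
  by (simp_all add: presented_algebra_def)

lemma proj_cong:
  assumes "x - y \<in> R"
  shows "proj x = proj y"
proof -
  interpret ideal relators free_algebra by (rule relators_ideal)
  have "x - y \<in> relators" using assms free.genideal_self[of R] by auto
  then have "x \<in> proj y"
    by (force simp: a_r_coset_def r_coset_def)
  then show ?thesis
    using free.a_repr_independence[OF _ _ a_subgroup, of x y] by simp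
qed

text \<open>
  Every element of a presented algebra is obtained from the generators by the algebra operations.
  Properties that define a subalgebra thus need to be checked on generators only.
\<close>

lemma presented_induct [consumes 1, case_names one gen mult add scale]:
  assumes "t \<in> carrier P"
    and one: "Q \<one>\<^bsub>P\<^esub>"
    and gen: "\<And>s. Q (proj (letter s))"
    and mult: "\<And>x y. \<lbrakk>x \<in> carrier P; y \<in> carrier P; Q x; Q y\<rbrakk> \<Longrightarrow> Q (x \<otimes>\<^bsub>P\<^esub> y)"
    and add: "\<And>x y. \<lbrakk>x \<in> carrier P; y \<in> carrier P; Q x; Q y\<rbrakk> \<Longrightarrow> Q (x \<oplus>\<^bsub>P\<^esub> y)"
    and scale: "\<And>c x. \<lbrakk>x \<in> carrier P; Q x\<rbrakk> \<Longrightarrow> Q (c \<odot>\<^bsub>P\<^esub> x)"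
  shows "Q t"
proof -
  obtain x where x: "t = proj x" using assms(1) by (auto simp: proj_simps)
  have word: "Q (proj (Poly_Mapping.single (Word l) 1))" for l
  proof (induction l)
    case Nil
    have "proj (Poly_Mapping.single (Word []) 1) = \<one>\<^bsub>P\<^esub>"
      by (simp add: proj_simps zero_word_def[symmetric])
    with one show ?case by simp
  next
    case (Cons s l)
    have "Poly_Mapping.single (Word (s # l)) 1 = letter s * Poly_Mapping.single (Word l) (1::'k)"
      by (simp add: letter_def mult_single plus_word_def)
    then show ?case
      using mult[OF _ _ gen[of s] Cons] by (simp add: proj_simps)
  qed
  have "Q (proj x)"
    using subset_UNIV
  proof (induction x rule: poly_mapping_induct_keys)
    case zero
    show ?case using scale[OF P.one_closed one, of 0] by (simp add: proj_simps(3))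
  next
    case (add x w c)
    have "proj (Poly_Mapping.single w c) = c \<odot>\<^bsub>P\<^esub> proj (Poly_Mapping.single (Word (letters w)) 1)"
      by (simp add: proj_simps)
    then have "Q (proj (Poly_Mapping.single w c))"
      using scale[OF _ word[of "letters w"]] by (simp add: proj_simps)
    then show ?case
      using assms(5)[of "proj (Poly_Mapping.single w c)" "proj x"] add by (simp add: proj_simps)
  qed
  then show ?thesis by (simp add: x)
qed

end

text \<open>
  The universal property of a presented algebra: the elements that evaluate to zero form an ideal,
  which contains all relators as soon as it contains \<open>R\<close>, so evaluation is constant on cosets.
\<close>

locale presentation_hom = presentation R + B: k_algebra B
  for R :: "('g word \<Rightarrow>\<^sub>0 'k::field) set" and B :: "('k, 'b, 'm) module_scheme" +
  fixes \<phi> :: "'g \<Rightarrow> 'b"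
  assumes gen_closed [simp]: "\<phi> s \<in> carrier B"
    and rel: "r \<in> R \<Longrightarrow> eval_free B \<phi> r = \<zero>\<^bsub>B\<^esub>"
begin

lemma eval_free_relators:
  assumes "x \<in> relators"
  shows "eval_free B \<phi> x = \<zero>\<^bsub>B\<^esub>"
proof -
  have "ideal {x. eval_free B \<phi> x = \<zero>\<^bsub>B\<^esub>} free_algebra"
  proof (rule idealI)
    show "subgroup {x. eval_free B \<phi> x = \<zero>\<^bsub>B\<^esub>} (add_monoid free_algebra)"
    proof (rule free.add.subgroupI)
      fix x assume "x \<in> {x. eval_free B \<phi> x = \<zero>\<^bsub>B\<^esub>}"
      moreover have "\<ominus>\<^bsub>free_algebra\<^esub> x = pm_scale (- 1) x"
        using free.scale_minus_one[of x] by (simp del: pm.scale_minus_left)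
      ultimately show "\<ominus>\<^bsub>free_algebra\<^esub> x \<in> {x. eval_free B \<phi> x = \<zero>\<^bsub>B\<^esub>}"
        by (simp del: pm.scale_minus_left)
    qed (auto intro: exI[of _ 0])
  qed (auto simp: free.ring_axioms)
  moreover have "R \<subseteq> {x. eval_free B \<phi> x = \<zero>\<^bsub>B\<^esub>}" using rel by auto
  ultimately show ?thesis
    using assms free.genideal_minimal[of "{x. eval_free B \<phi> x = \<zero>\<^bsub>B\<^esub>}" R] by auto
qed

lemma induced_hom_proj: "induced_hom B \<phi> (proj x) = eval_free B \<phi> x"
proof -
  have "eval_free B \<phi> y = eval_free B \<phi> x" if "y \<in> proj x" for y
    using that by (auto simp: a_r_coset_def r_coset_def eval_free_relators)
  moreover have "proj x \<noteq> {}"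
    using additive_subgroup.zero_closed[OF ideal.axioms(1)[OF relators_ideal]]
    by (auto simp: a_r_coset_def r_coset_def)
  ultimately show ?thesis
    unfolding induced_hom_def by (intro the_elem_image_unique)
qed

lemma induced_hom_simps:
  "t \<in> carrier P \<Longrightarrow> induced_hom B \<phi> t \<in> carrier B"
  "\<lbrakk>s \<in> carrier P; t \<in> carrier P\<rbrakk> \<Longrightarrow>
    induced_hom B \<phi> (s \<oplus>\<^bsub>P\<^esub> t) = induced_hom B \<phi> s \<oplus>\<^bsub>B\<^esub> induced_hom B \<phi> t"
  "\<lbrakk>s \<in> carrier P; t \<in> carrier P\<rbrakk> \<Longrightarrow>
    induced_hom B \<phi> (s \<otimes>\<^bsub>P\<^esub> t) = induced_hom B \<phi> s \<otimes>\<^bsub>B\<^esub> induced_hom B \<phi> t"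
  "t \<in> carrier P \<Longrightarrow> induced_hom B \<phi> (c \<odot>\<^bsub>P\<^esub> t) = c \<odot>\<^bsub>B\<^esub> induced_hom B \<phi> t"
  "induced_hom B \<phi> \<one>\<^bsub>P\<^esub> = \<one>\<^bsub>B\<^esub>"
  "induced_hom B \<phi> (proj (letter a)) = \<phi> a"
  by (auto simp: proj_simps induced_hom_proj)

end

section \<open>Functions that split on products\<close>

context k_space
begin

text \<open>
  A rank factorisation: finitely many linear forms take, at every vector, values that depend linearly
  on those of the pivot forms, with coefficients that are values at the fixed vectors \<open>v p\<close>.
\<close>

lemma functionals_pivots:
  assumes "finite I" and b: "\<And>i. i \<in> I \<Longrightarrow> b i \<in> dual_space V"
  obtains P v where "P \<subseteq> I" "v \<in> P \<rightarrow> carrier V"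
    "\<And>i x. \<lbrakk>i \<in> I; x \<in> carrier V\<rbrakk> \<Longrightarrow> b i x = (\<Sum>p\<in>P. b p x * b i (v p))"
proof -
  define S where "S = (\<lambda>x i. if i \<in> I then b i x else 0) ` carrier V"
  have Sadd: "(\<lambda>i. x i + y i) \<in> S" if "x \<in> S" "y \<in> S" for x y
  proof -
    from that obtain u v where "u \<in> carrier V" "v \<in> carrier V"
      "x = (\<lambda>i. if i \<in> I then b i u else 0)" "y = (\<lambda>i. if i \<in> I then b i v else 0)"
      by (auto simp: S_def)
    then show ?thesis
      unfolding S_def by (intro image_eqI[of _ _ "u \<oplus> v"]) (auto simp: dual_space_add b)
  qed
  have Sscale: "(\<lambda>i. c * x i) \<in> S" if "x \<in> S" for c x
  proof -
    from that obtain u where "u \<in> carrier V" "x = (\<lambda>i. if i \<in> I then b i u else 0)"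
      by (auto simp: S_def)
    then show ?thesis
      unfolding S_def by (intro image_eqI[of _ _ "c \<odot> u"]) (auto simp: dual_space_scale b)
  qed
  obtain P w where P: "P \<subseteq> I" and w: "\<forall>p\<in>P. w p \<in> S"
    and piv: "\<And>x i. x \<in> S \<Longrightarrow> i \<in> I \<Longrightarrow> x i = (\<Sum>p\<in>P. x p * w p i)"
    using subspace_pivots[OF assms(1) Sadd Sscale] by blast
  from w have "\<forall>p\<in>P. \<exists>v. v \<in> carrier V \<and> w p = (\<lambda>i. if i \<in> I then b i v else 0)"
    by (auto simp: S_def)
  then obtain v where v: "\<And>p. p \<in> P \<Longrightarrow> v p \<in> carrier V"
    "\<And>p. p \<in> P \<Longrightarrow> w p = (\<lambda>i. if i \<in> I then b i (v p) else 0)" by metis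
  have "b i x = (\<Sum>p\<in>P. b p x * b i (v p))" if "i \<in> I" "x \<in> carrier V" for i x
    using piv[of "\<lambda>i. if i \<in> I then b i x else 0" i] that P v
    by (auto simp: S_def subset_eq intro!: sum.cong)
  from that[OF P _ this] show ?thesis using v(1) by blast
qed

end

lemma lincomb_apply:
  fixes V :: "('k::field, 'x \<Rightarrow> 'k, 'm) module_scheme" (structure)
  assumes "k_space V" "finite I" "f \<in> I \<rightarrow> carrier V"
    and "\<zero> x = 0"
    and "\<And>f g. \<lbrakk>f \<in> carrier V; g \<in> carrier V\<rbrakk> \<Longrightarrow> (f \<oplus> g) x = f x + g x"
    and "\<And>c f. f \<in> carrier V \<Longrightarrow> (c \<odot> f) x = c * f x"
  shows "(\<Oplus>i\<in>I. c i \<odot> f i) x = (\<Sum>i\<in>I. c i * f i x)"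
proof -
  interpret k_space V by fact
  show ?thesis
    using assms(2,3)
  proof (induction I)
    case (insert i I)
    then have "(\<lambda>i. c i \<odot> f i) \<in> I \<rightarrow> carrier V" by (auto simp: Pi_iff)
    with insert assms(5,6) show ?case by (auto simp: finsum_insert)
  qed (use assms(4) in simp)
qed

text \<open>
  A splitting of \<open>f\<close> is an expression of \<open>f (x y)\<close> as a sum of products \<open>a x * b y\<close>, given by
  the list of the pairs \<open>(a, b)\<close>.
\<close>

definition splitting ::
  "('k::field, 'a, 'm) module_scheme \<Rightarrow> ('a \<Rightarrow> 'k) \<Rightarrow> (('a \<Rightarrow> 'k) \<times> ('a \<Rightarrow> 'k)) list \<Rightarrow> bool"
  where "splitting H f ps \<longleftrightarrow> (\<forall>x\<in>carrier H. \<forall>y\<in>carrier H.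
    f (x \<otimes>\<^bsub>H\<^esub> y) = (\<Sum>p\<leftarrow>ps. fst p x * snd p y))"

definition splits :: "('k::field, 'a, 'm) module_scheme \<Rightarrow> ('a \<Rightarrow> 'k) set \<Rightarrow> ('a \<Rightarrow> 'k) \<Rightarrow> bool"
  where "splits H A f \<longleftrightarrow> (\<exists>ps. set ps \<subseteq> A \<times> A \<and> splitting H f ps)"

lemma splitsI_sum:
  assumes "finite I" "\<And>i. i \<in> I \<Longrightarrow> a i \<in> A \<and> b i \<in> A"
    and "\<And>x y. \<lbrakk>x \<in> carrier H; y \<in> carrier H\<rbrakk> \<Longrightarrow> f (x \<otimes>\<^bsub>H\<^esub> y) = (\<Sum>i\<in>I. a i x * b i y)"
  shows "splits H A f"
proof -
  obtain l where l: "set l = I" "distinct l"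
    using finite_distinct_list[OF assms(1)] by blast
  then have "splitting H f (map (\<lambda>i. (a i, b i)) l)"
    using assms(3) l by (auto simp: splitting_def o_def sum.distinct_set_conv_list[symmetric])
  then show ?thesis
    unfolding splits_def using assms(2) l by (intro exI[of _ "map (\<lambda>i. (a i, b i)) l"]) auto
qed

lemma splits_mono: "splits H A f \<Longrightarrow> A \<subseteq> B \<Longrightarrow> splits H B f"
  unfolding splits_def by blast

context k_algebra
begin

lemma dual_space_translate:
  assumes "f \<in> dual_space H" "z \<in> carrier H"
  shows "(\<lambda>x\<in>carrier H. f (x \<otimes> z)) \<in> dual_space H" "(\<lambda>x\<in>carrier H. f (z \<otimes> x)) \<in> dual_space H"
  using assms
  by (auto simp: dual_space_def l_distr r_distr scale_mult_left scale_mult_right)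

text \<open>
  If \<open>f\<close> splits, then \<open>y\<close> enters \<open>f (x y)\<close> only through finitely many linear forms \<open>b p\<close>, and
  \<open>f (x y)\<close> is a combination of values \<open>f (x v)\<close> for finitely many fixed \<open>v\<close>.  Hence \<open>z\<close> enters
  \<open>f (x z y)\<close> only through the finitely many linear forms \<open>b i (z v)\<close>, so the largest ideal in
  the kernel of \<open>f\<close> has finite codimension.
\<close>

lemma finite_dual_carrierI:
  assumes f: "f \<in> dual_space H" and "splits H (dual_space H) f"
  shows "f \<in> finite_dual_carrier H"
proof -
  from assms(2) obtain ps where ps: "set ps \<subseteq> dual_space H \<times> dual_space H" and sp: "splitting H f ps"
    by (auto simp: splits_def)
  define a where "a i = fst (ps ! i)" for i
  define b where "b i = snd (ps ! i)" for i
  let ?n = "length ps"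
  have b: "b i \<in> dual_space H" if "i \<in> {..<?n}" for i
    using that subsetD[OF ps nth_mem[of i ps]] by (auto simp: b_def mem_Times_iff)
  have f_mult: "f (x \<otimes> y) = (\<Sum>i<?n. a i x * b i y)" if "x \<in> carrier H" "y \<in> carrier H" for x y
    using sp that by (simp add: splitting_def a_def b_def sum_list_sum_nth atLeast0LessThan)
  obtain P v where P: "P \<subseteq> {..<?n}" and v: "v \<in> P \<rightarrow> carrier H"
    and piv: "\<And>i y. \<lbrakk>i \<in> {..<?n}; y \<in> carrier H\<rbrakk> \<Longrightarrow> b i y = (\<Sum>p\<in>P. b p y * b i (v p))"
    using functionals_pivots[of "{..<?n}" b] b by blast
  have finP: "finite P" using P by (auto intro: finite_subset)
  have f_right: "f (x \<otimes> y) = (\<Sum>p\<in>P. b p y * f (x \<otimes> v p))"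
    if "x \<in> carrier H" "y \<in> carrier H" for x y
  proof -
    have "f (x \<otimes> y) = (\<Sum>i<?n. a i x * (\<Sum>p\<in>P. b p y * b i (v p)))"
      unfolding f_mult[OF that]
      by (intro sum.cong refl arg_cong2[where f = "(*)"] piv) (use that in auto)
    also have "\<dots> = (\<Sum>i<?n. \<Sum>p\<in>P. a i x * (b p y * b i (v p)))"
      by (simp add: sum_distrib_left)
    also have "\<dots> = (\<Sum>p\<in>P. \<Sum>i<?n. a i x * (b p y * b i (v p)))"
      by (rule sum.swap)
    also have "\<dots> = (\<Sum>p\<in>P. b p y * f (x \<otimes> v p))"
    proof (intro sum.cong refl)
      fix p assume "p \<in> P"
      then have "f (x \<otimes> v p) = (\<Sum>i<?n. a i x * b i (v p))"
        using that v f_mult by auto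
      then show "(\<Sum>i<?n. a i x * (b p y * b i (v p))) = b p y * f (x \<otimes> v p)"
        by (simp add: sum_distrib_left algebra_simps)
    qed
    finally show ?thesis .
  qed
  \<comment> \<open>the forms through which \<open>z\<close> enters \<open>f (x z y)\<close>\<close>
  define \<chi> where "\<chi> j = (\<lambda>z\<in>carrier H. b (fst j) (z \<otimes> v (snd j)))" for j
  have \<chi>: "\<chi> j \<in> dual_space H" if "j \<in> {..<?n} \<times> P" for j
    unfolding \<chi>_def using that v b by (intro dual_space_translate) auto
  obtain Q u where Q: "Q \<subseteq> {..<?n} \<times> P" and u: "u \<in> Q \<rightarrow> carrier H"
    and piv': "\<And>j z. \<lbrakk>j \<in> {..<?n} \<times> P; z \<in> carrier H\<rbrakk> \<Longrightarrow> \<chi> j z = (\<Sum>q\<in>Q. \<chi> q z * \<chi> j (u q))"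
    using functionals_pivots[of "{..<?n} \<times> P" \<chi>] \<chi> finP by blast
  have finQ: "finite Q" using Q finP by (auto intro: finite_subset)
  \<comment> \<open>the largest ideal on which \<open>f\<close> vanishes\<close>
  define J where "J = {z \<in> carrier H. \<forall>x\<in>carrier H. \<forall>y\<in>carrier H. f (x \<otimes> z \<otimes> y) = 0}"
  have J: "ideal J H"
  proof (rule idealI)
    show "subgroup J (add_monoid H)"
    proof (rule add.subgroupI)
      show "J \<noteq> {}" using dual_space_zero[OF f] by (auto simp: J_def intro!: exI[of _ \<zero>])
    next
      fix z assume z: "z \<in> J"
      have "f (x \<otimes> (\<ominus> z) \<otimes> y) = (- 1) * f (x \<otimes> z \<otimes> y)"
        if "x \<in> carrier H" "y \<in> carrier H" for x y
        using that z dual_space_scale[OF f, of "x \<otimes> z \<otimes> y" "- 1"]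
        by (simp add: J_def scale_minus_one l_minus r_minus)
      then show "\<ominus> z \<in> J" using z by (simp add: J_def)
    qed (auto simp: J_def l_distr r_distr dual_space_add[OF f])
  next
    fix z x assume z: "z \<in> J" and x: "x \<in> carrier H"
    have zc: "z \<in> carrier H" using z by (simp add: J_def)
    have "f (y \<otimes> (x \<otimes> z) \<otimes> y') = 0" "f (y \<otimes> (z \<otimes> x) \<otimes> y') = 0"
      if "y \<in> carrier H" "y' \<in> carrier H" for y y'
    proof -
      have "y \<otimes> (x \<otimes> z) \<otimes> y' = (y \<otimes> x) \<otimes> z \<otimes> y'" "y \<otimes> (z \<otimes> x) \<otimes> y' = y \<otimes> z \<otimes> (x \<otimes> y')"
        using that x zc by (simp_all add: m_assoc)
      then show "f (y \<otimes> (x \<otimes> z) \<otimes> y') = 0" "f (y \<otimes> (z \<otimes> x) \<otimes> y') = 0"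
        using z x that by (auto simp: J_def)
    qed
    then show "x \<otimes> z \<in> J" "z \<otimes> x \<in> J" using zc x by (auto simp: J_def)
  qed (rule ring_axioms)
  have in_J: "z \<in> J" if z: "z \<in> carrier H" and \<chi>0: "\<And>j. j \<in> {..<?n} \<times> P \<Longrightarrow> \<chi> j z = 0" for z
  proof -
    have "f (x \<otimes> z \<otimes> y) = 0" if xy: "x \<in> carrier H" "y \<in> carrier H" for x y
    proof -
      have "f (x \<otimes> z \<otimes> v p) = 0" if p: "p \<in> P" for p
      proof -
        have vp: "v p \<in> carrier H" using v p by auto
        then have "f (x \<otimes> z \<otimes> v p) = (\<Sum>i<?n. a i x * b i (z \<otimes> v p))"
          using xy z f_mult by (simp add: m_assoc)
        also have "\<dots> = 0"
          using \<chi>0[of "(_, p)"] z p by (intro sum.neutral) (auto simp: \<chi>_def)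
        finally show ?thesis .
      qed
      then show ?thesis using f_right[of "x \<otimes> z" y] xy z by simp
    qed
    then show ?thesis using z by (simp add: J_def)
  qed
  interpret Q: k_algebra "quotient_algebra H J" by (rule quotient_algebra_k_algebra[OF J])
  have "fin_dim (quotient_algebra H J)"
  proof (rule Q.fin_dimI[OF finQ])
    show "(\<lambda>q. J +> u q) \<in> Q \<rightarrow> carrier (quotient_algebra H J)"
      using u by (auto simp: quotient_algebra_simps[OF J])
    fix C assume "C \<in> carrier (quotient_algebra H J)"
    then obtain z where z: "z \<in> carrier H" "C = J +> z" by (auto simp: quotient_algebra_simps[OF J])
    \<comment> \<open>an element at which all forms \<open>\<chi> j\<close> agree with those at \<open>z\<close>, so that \<open>z - s\<close> lies in \<open>J\<close>\<close>
    define s where "s = (\<Oplus>q\<in>Q. \<chi> q z \<odot> u q)"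
    have s: "s \<in> carrier H" using u by (simp add: s_def)
    have "\<chi> j (z \<ominus> s) = 0" if j: "j \<in> {..<?n} \<times> P" for j
    proof -
      have "\<chi> j s = (\<Sum>q\<in>Q. \<chi> q z * \<chi> j (u q))"
        unfolding s_def by (rule dual_space_lincomb[OF \<chi>[OF j] finQ u])
      then have "\<chi> j s = \<chi> j z" using piv'[OF j z(1)] by simp
      moreover have "\<chi> j (z \<ominus> s) = \<chi> j z + (- 1) * \<chi> j s"
        using z s dual_space_add[OF \<chi>[OF j]] dual_space_scale[OF \<chi>[OF j], of s "- 1"]
        by (simp add: a_minus_def scale_minus_one)
      ultimately show ?thesis by simp
    qed
    then have "z \<ominus> s \<in> J" using in_J[of "z \<ominus> s"] z s by blast
    moreover have "z = (z \<ominus> s) \<oplus> s" using z s by (simp add: a_minus_def a_assoc l_neg)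
    ultimately have "z \<in> J +> s" by (auto simp: a_r_coset_def r_coset_def)
    then have "J +> z = J +> s"
      using a_repr_independence[OF _ s additive_subgroup.a_subgroup[OF ideal.axioms(1)[OF J]]] by simp
    then have "C = (\<Oplus>\<^bsub>quotient_algebra H J\<^esub>q\<in>Q. \<chi> q z \<odot>\<^bsub>quotient_algebra H J\<^esub> (J +> u q))"
      using quotient_algebra_lincomb[OF J finQ u, of "\<lambda>q. \<chi> q z"] z by (simp add: s_def)
    then show "\<exists>c. C = (\<Oplus>\<^bsub>quotient_algebra H J\<^esub>q\<in>Q. c q \<odot>\<^bsub>quotient_algebra H J\<^esub> (J +> u q))"
      by (rule exI[of _ "\<lambda>q. \<chi> q z"])
  qed
  moreover have "f z = 0" if "z \<in> J" for z
  proof -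
    have "z \<in> carrier H" "f (\<one> \<otimes> z \<otimes> \<one>) = 0" using that one_closed unfolding J_def by blast+
    then show ?thesis by simp
  qed
  ultimately show ?thesis using f J by (auto simp: finite_dual_carrier_def)
qed

lemma ideal_coset:
  assumes "ideal I H" "x \<in> I"
  shows "I +> x = I +> \<zero>"
proof -
  have "x \<in> I +> \<zero>"
    using assms ideal.Icarr[OF assms]
    by (auto simp: a_r_coset_def r_coset_def intro!: bexI[of _ x])
  from a_repr_independence[OF this zero_closed additive_subgroup.a_subgroup[OF ideal.axioms(1)[OF assms(1)]]]
  show ?thesis by (rule sym)
qed

text \<open>
  Conversely, let \<open>f\<close> vanish on an ideal \<open>I\<close> of finite codimension.  A frame of the quotient expresses
  \<open>x\<close>, up to an element of \<open>I\<close>, by fixed representatives \<open>r b\<close> with coefficients \<open>a b x\<close>, so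
  \<open>f (x y)\<close> is the sum of the \<open>a b x * f (r b y)\<close>.  Both factors vanish on \<open>I\<close>, so they belong to the
  finite dual again.
\<close>

lemma finite_dual_carrierD:
  assumes "f \<in> finite_dual_carrier H"
  shows "f \<in> dual_space H" "splits H (finite_dual_carrier H) f"
proof -
  show f: "f \<in> dual_space H" using assms by (simp add: finite_dual_carrier_def)
  obtain I where I: "ideal I H" and fI: "\<And>x. x \<in> I \<Longrightarrow> f x = 0"
    and fd: "fin_dim (quotient_algebra H I)"
    using assms by (auto simp: finite_dual_carrier_def)
  note simps = quotient_algebra_simps[OF I]
  interpret Q: k_algebra "quotient_algebra H I" by (rule quotient_algebra_k_algebra[OF I])
  obtain B F where B: "finite B" "B \<subseteq> carrier (quotient_algebra H I)"
    and F: "\<And>b. b \<in> B \<Longrightarrow> F b \<in> dual_space (quotient_algebra H I)"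
    and span: "\<And>C. C \<in> carrier (quotient_algebra H I) \<Longrightarrow>
      C = (\<Oplus>\<^bsub>quotient_algebra H I\<^esub>b\<in>B. F b C \<odot>\<^bsub>quotient_algebra H I\<^esub> b)"
    using Q.fin_dim_frame[OF fd] by blast
  have "\<forall>b\<in>B. \<exists>r. r \<in> carrier H \<and> b = I +> r" using B by (auto simp: simps)
  then obtain r where r: "\<And>b. b \<in> B \<Longrightarrow> r b \<in> carrier H" "\<And>b. b \<in> B \<Longrightarrow> b = I +> r b"
    by metis
  define a where "a b = (\<lambda>x\<in>carrier H. F b (I +> x))" for b
  define g where "g b = (\<lambda>y\<in>carrier H. f (r b \<otimes> y))" for b
  have a: "a b \<in> dual_space H" if "b \<in> B" for b
    using F[OF that] by (auto simp: a_def dual_space_def simps simp flip: simps(4,6))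
  have g: "g b \<in> dual_space H" if "b \<in> B" for b
    unfolding g_def using r(1)[OF that] f by (intro dual_space_translate)
  show "splits H (finite_dual_carrier H) f"
  proof (rule splitsI_sum[OF B(1)])
    fix b assume b: "b \<in> B"
    have "a b x = 0" if "x \<in> I" for x
      using that ideal.Icarr[OF I that] ideal_coset[OF I that] Q.dual_space_zero[OF F[OF b]]
      by (simp add: a_def simps(3))
    moreover have "g b x = 0" if "x \<in> I" for x
      using that ideal.Icarr[OF I that] ideal.I_l_closed[OF I that r(1)[OF b]] fI by (simp add: g_def)
    ultimately show "a b \<in> finite_dual_carrier H \<and> g b \<in> finite_dual_carrier H"
      using a[OF b] g[OF b] I fd by (auto simp: finite_dual_carrier_def)
  next
    fix x y assume xy: "x \<in> carrier H" "y \<in> carrier H"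
    define s where "s = (\<Oplus>b\<in>B. a b x \<odot> r b)"
    have r': "r \<in> B \<rightarrow> carrier H" using r by auto
    then have s: "s \<in> carrier H" by (simp add: s_def)
    have "I +> x = (\<Oplus>\<^bsub>quotient_algebra H I\<^esub>b\<in>B. F b (I +> x) \<odot>\<^bsub>quotient_algebra H I\<^esub> b)"
      using xy by (intro span) (simp add: simps)
    also have "\<dots> = (\<Oplus>\<^bsub>quotient_algebra H I\<^esub>b\<in>B. a b x \<odot>\<^bsub>quotient_algebra H I\<^esub> (I +> r b))"
      using xy B(2) by (intro Q.finsum_cong') (auto simp: a_def r(2)[symmetric])
    also have "\<dots> = I +> s"
      unfolding s_def by (rule quotient_algebra_lincomb[OF I B(1) r'])
    finally have "x \<in> I +> s"
      using ideal.axioms(1)[OF I, THEN additive_subgroup.zero_closed] xy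
      by (force simp: a_r_coset_def r_coset_def)
    then obtain i where i: "i \<in> I" "x = i \<oplus> s" by (auto simp: a_r_coset_def r_coset_def)
    have "f (x \<otimes> y) = f (i \<otimes> y) + f (s \<otimes> y)"
      using i s xy ideal.Icarr[OF I i(1)] by (simp add: l_distr dual_space_add[OF f])
    also have "f (i \<otimes> y) = 0" using fI ideal.I_r_closed[OF I i(1) xy(2)] by simp
    also have "f (s \<otimes> y) = (\<lambda>x\<in>carrier H. f (x \<otimes> y)) s" using s by simp
    also have "\<dots> = (\<Sum>b\<in>B. a b x * (\<lambda>x\<in>carrier H. f (x \<otimes> y)) (r b))"
      unfolding s_def by (rule dual_space_lincomb[OF dual_space_translate(1)[OF f xy(2)] B(1) r'])
    also have "\<dots> = (\<Sum>b\<in>B. a b x * g b y)"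
      using r xy by (intro sum.cong) (auto simp: g_def)
    finally show "f (x \<otimes> y) = (\<Sum>b\<in>B. a b x * g b y)" by simp
  qed
qed

end

section \<open>The finite dual\<close>

lemma finite_dual_simps [simp]:
  "carrier (finite_dual H) = finite_dual_carrier H"
  "f \<otimes>\<^bsub>finite_dual H\<^esub> g = (\<lambda>x\<in>carrier H. tensor_form (\<lambda>a b. f a * g b) (comult H x))"
  "\<one>\<^bsub>finite_dual H\<^esub> = (\<lambda>x\<in>carrier H. counit H x)"
  "\<zero>\<^bsub>finite_dual H\<^esub> = (\<lambda>x\<in>carrier H. 0)"
  "f \<oplus>\<^bsub>finite_dual H\<^esub> g = (\<lambda>x\<in>carrier H. f x + g x)"
  "c \<odot>\<^bsub>finite_dual H\<^esub> f = (\<lambda>x\<in>carrier H. c * f x)"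
  "antipode (finite_dual H) f = (\<lambda>x\<in>carrier H. f (antipode H x))"
  by (simp_all add: finite_dual_def finite_dual_algebra_def module.defs hopf.defs)

text \<open>
  The tensor square depends only on the vector space structure, which the Hopf algebra structure of
  the finite dual extends.
\<close>

lemma tensor_finite_dual:
  "tensor_class (finite_dual_algebra H) (finite_dual_algebra H) =
    tensor_class (finite_dual H) (finite_dual H)"
  "carrier (tensor (finite_dual_algebra H) (finite_dual_algebra H)) =
    carrier (tensor (finite_dual H) (finite_dual H))"
proof -
  have eq: "carrier (finite_dual_algebra H) = carrier (finite_dual H)"
    "add (finite_dual_algebra H) = add (finite_dual H)"
    "module.smult (finite_dual_algebra H) = module.smult (finite_dual H)"
    by (simp_all add: finite_dual_def module.defs hopf.defs)
  show "tensor_class (finite_dual_algebra H) (finite_dual_algebra H) =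
      tensor_class (finite_dual H) (finite_dual H)"
    by (simp add: fun_eq_iff tensor_class_def tensor_null_def bilinear_rels_def eq
        del: finite_dual_simps)
  then show "carrier (tensor (finite_dual_algebra H) (finite_dual_algebra H)) =
      carrier (tensor (finite_dual H) (finite_dual H))"
    by (simp add: tensor_def eq del: finite_dual_simps)
qed

context k_algebra
begin

lemma splits_add:
  assumes "splits H A f" "splits H A g"
  shows "splits H A (\<lambda>x\<in>carrier H. f x + g x)"
proof -
  obtain ps rs where "set ps \<subseteq> A \<times> A" "splitting H f ps" "set rs \<subseteq> A \<times> A" "splitting H g rs"
    using assms by (auto simp: splits_def)
  then show ?thesis
    unfolding splits_def by (intro exI[of _ "ps @ rs"]) (simp add: splitting_def)
qed

lemma splits_scale:
  assumes "splits H A f" and A: "\<And>a. a \<in> A \<Longrightarrow> (\<lambda>x\<in>carrier H. c * a x) \<in> A"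
  shows "splits H A (\<lambda>x\<in>carrier H. c * f x)"
proof -
  obtain ps where "set ps \<subseteq> A \<times> A" "splitting H f ps" using assms(1) by (auto simp: splits_def)
  then show ?thesis
    unfolding splits_def
    by (intro exI[of _ "map (\<lambda>p. (\<lambda>x\<in>carrier H. c * fst p x, snd p)) ps"])
      (auto simp: splitting_def o_def A sum_list_const_mult mult.assoc)
qed

lemma dual_space_k_closed:
  "f \<in> dual_space H \<Longrightarrow> (\<lambda>x\<in>carrier H. c * f x) \<in> dual_space H"
  "\<lbrakk>f \<in> dual_space H; g \<in> dual_space H\<rbrakk> \<Longrightarrow> (\<lambda>x\<in>carrier H. f x + g x) \<in> dual_space H"
  "(\<lambda>x\<in>carrier H. 0) \<in> dual_space H"
  by (auto simp: dual_space_def algebra_simps)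

lemma finite_dual_carrier_iff:
  "f \<in> finite_dual_carrier H \<longleftrightarrow> f \<in> dual_space H \<and> splits H (dual_space H) f"
proof
  assume f: "f \<in> finite_dual_carrier H"
  have "finite_dual_carrier H \<subseteq> dual_space H" by (auto simp: finite_dual_carrier_def)
  then show "f \<in> dual_space H \<and> splits H (dual_space H) f"
    using finite_dual_carrierD[OF f] splits_mono by blast
qed (use finite_dual_carrierI in blast)

lemma finite_dual_ext:
  assumes "f \<in> finite_dual_carrier H" "g \<in> finite_dual_carrier H" "\<And>x. x \<in> carrier H \<Longrightarrow> f x = g x"
  shows "f = g"
  using assms by (intro ext) (auto simp: finite_dual_carrier_def dual_space_def dest!: PiE_arb)

end

text \<open>
  The product of the finite dual comes from the comultiplication, the unit from the counit.  The
  finite dual is closed under products because these maps are algebra homomorphisms.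
\<close>

locale algebra_with_comult = k_algebra H
  for H :: "('k::field, 'a, 'm) hopf_scheme" (structure) +
  assumes comult_closed [simp]: "x \<in> carrier H \<Longrightarrow> comult H x \<in> carrier (tensor H H)"
    and comult_add: "\<lbrakk>x \<in> carrier H; y \<in> carrier H\<rbrakk> \<Longrightarrow>
      comult H (x \<oplus> y) = comult H x \<oplus>\<^bsub>tensor H H\<^esub> comult H y"
    and comult_scale: "x \<in> carrier H \<Longrightarrow> comult H (c \<odot> x) = c \<odot>\<^bsub>tensor H H\<^esub> comult H x"
    and comult_mult: "\<lbrakk>x \<in> carrier H; y \<in> carrier H\<rbrakk> \<Longrightarrow>
      comult H (x \<otimes> y) = comult H x \<otimes>\<^bsub>tensor H H\<^esub> comult H y"
    and counit_add: "\<lbrakk>x \<in> carrier H; y \<in> carrier H\<rbrakk> \<Longrightarrow> counit H (x \<oplus> y) = counit H x + counit H y"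
    and counit_scale: "x \<in> carrier H \<Longrightarrow> counit H (c \<odot> x) = c * counit H x"
    and counit_mult: "\<lbrakk>x \<in> carrier H; y \<in> carrier H\<rbrakk> \<Longrightarrow> counit H (x \<otimes> y) = counit H x * counit H y"
begin

interpretation sq: tensor_algebras H H ..

abbreviation "D \<equiv> finite_dual H"

lemma counit_dual: "(\<lambda>x\<in>carrier H. counit H x) \<in> dual_space H"
  by (simp add: dual_space_def counit_add counit_scale)

lemma conv_dual:
  assumes "f \<in> dual_space H" "g \<in> dual_space H"
  shows "f \<otimes>\<^bsub>D\<^esub> g \<in> dual_space H"
  using sq.tensor_form_add[OF bilinear_form_dual[OF assms]]
    sq.tensor_form_scale[OF bilinear_form_dual[OF assms]]
  by (simp add: dual_space_def comult_add comult_scale)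

text \<open>
  If \<open>f\<close> and \<open>g\<close> split, then so does the form \<open>f \<otimes> g\<close> on the algebra \<open>H \<otimes> H\<close>; it suffices to
  compare both sides on pure tensors.
\<close>

lemma tensor_form_mult:
  assumes fg: "f \<in> dual_space H" "g \<in> dual_space H"
    and ps: "set ps \<subseteq> dual_space H \<times> dual_space H" "splitting H f ps"
    and rs: "set rs \<subseteq> dual_space H \<times> dual_space H" "splitting H g rs"
    and st: "s \<in> carrier (tensor H H)" "t \<in> carrier (tensor H H)"
  shows "tensor_form (\<lambda>a b. f a * g b) (s \<otimes>\<^bsub>tensor H H\<^esub> t) =
    (\<Sum>p\<leftarrow>ps. \<Sum>r\<leftarrow>rs. tensor_form (\<lambda>a b. fst p a * fst r b) s * tensor_form (\<lambda>a b. snd p a * snd r b) t)"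
proof -
  define L where "L f g = linear_extension (\<lambda>p. f (fst p) * g (snd p))" for f g :: "'a \<Rightarrow> 'k"
  obtain x y where x: "x \<in> sq.reps" "s = sq.cls x" and y: "y \<in> sq.reps" "t = sq.cls y"
    using st by (auto simp: sq.tensor_carrier)
  have form: "tensor_form (\<lambda>a b. f a * g b) (sq.cls z) = L f g z"
    if "f \<in> dual_space H" "g \<in> dual_space H" "z \<in> sq.reps" for f g z
    unfolding L_def using that by (intro sq.tensor_form_cls bilinear_form_dual)
  have L_add: "L f g (z + z') = L f g z + L f g z'" for f g z z'
    by (simp add: L_def linear_extension_add)
  have L_single: "L f g (Poly_Mapping.single (v, w) c) = c * (f v * g w)" for f g v w c
    by (simp add: L_def)
  have L_0: "L f g 0 = 0" for f g by (simp add: L_def)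
  have mult: "L f g (sq.tm x y) = (\<Sum>p\<leftarrow>ps. \<Sum>r\<leftarrow>rs. L (fst p) (fst r) x * L (snd p) (snd r) y)"
    using x(1)
  proof (induction x rule: sq.reps_induct)
    case zero
    then show ?case by (simp add: L_0)
  next
    case (add x v w c)
    have "L f g (sq.tm (Poly_Mapping.single (v, w) c) y) =
        (\<Sum>p\<leftarrow>ps. \<Sum>r\<leftarrow>rs. L (fst p) (fst r) (Poly_Mapping.single (v, w) c) * L (snd p) (snd r) y)"
      using y(1)
    proof (induction y rule: sq.reps_induct)
      case zero
      then show ?case by (simp add: L_0)
    next
      case (add y v' w' d)
      have "f (v \<otimes> v') * g (w \<otimes> w')
          = (\<Sum>p\<leftarrow>ps. \<Sum>r\<leftarrow>rs. (fst p v * snd p v') * (fst r w * snd r w'))"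
        using ps(2) rs(2) add.hyps \<open>v \<in> carrier H\<close> \<open>w \<in> carrier H\<close>
        by (simp add: splitting_def sum_list_const_mult sum_list_mult_const)
      then have "L f g (sq.tm (Poly_Mapping.single (v, w) c) (Poly_Mapping.single (v', w') d))
          = (\<Sum>p\<leftarrow>ps. \<Sum>r\<leftarrow>rs. L (fst p) (fst r) (Poly_Mapping.single (v, w) c)
              * L (snd p) (snd r) (Poly_Mapping.single (v', w') d))"
        by (simp add: L_single sum_list_const_mult[symmetric] algebra_simps)
      with add.IH show ?case
        by (simp add: tensor_free_mult_add_right L_add distrib_left sum_list_addf)
    qed
    with add.IH show ?case
      by (simp add: tensor_free_mult_add_left L_add distrib_right sum_list_addf)
  qed
  have "(\<Sum>p\<leftarrow>ps. \<Sum>r\<leftarrow>rs. tensor_form (\<lambda>a b. fst p a * fst r b) s * tensor_form (\<lambda>a b. snd p a * snd r b) t)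
      = (\<Sum>p\<leftarrow>ps. \<Sum>r\<leftarrow>rs. L (fst p) (fst r) x * L (snd p) (snd r) y)"
  proof (intro arg_cong[where f = sum_list] map_cong refl)
    fix p r assume "p \<in> set ps" "r \<in> set rs"
    then have "fst p \<in> dual_space H" "snd p \<in> dual_space H" "fst r \<in> dual_space H" "snd r \<in> dual_space H"
      using ps(1) rs(1) by auto
    then show "tensor_form (\<lambda>a b. fst p a * fst r b) s * tensor_form (\<lambda>a b. snd p a * snd r b) t =
        L (fst p) (fst r) x * L (snd p) (snd r) y"
      using x y by (simp add: form)
  qed
  then show ?thesis
    using mult form[OF fg sq.reps_mult[OF x(1) y(1)]] x y by (simp add: sq.tensor_mult)
qed

lemma conv_splitting:
  assumes fg: "f \<in> dual_space H" "g \<in> dual_space H"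
    and ps: "set ps \<subseteq> dual_space H \<times> dual_space H" "splitting H f ps"
    and rs: "set rs \<subseteq> dual_space H \<times> dual_space H" "splitting H g rs"
  shows "splitting H (f \<otimes>\<^bsub>D\<^esub> g)
    (concat (map (\<lambda>p. map (\<lambda>r. (fst p \<otimes>\<^bsub>D\<^esub> fst r, snd p \<otimes>\<^bsub>D\<^esub> snd r)) rs) ps))"
proof -
  have "(\<Sum>x\<leftarrow>concat (map h l). k x) = (\<Sum>y\<leftarrow>l. \<Sum>x\<leftarrow>h y. k x)"
    for k :: "('a \<Rightarrow> 'k) \<times> ('a \<Rightarrow> 'k) \<Rightarrow> 'k" and h and l :: "(('a \<Rightarrow> 'k) \<times> ('a \<Rightarrow> 'k)) list"
    by (induction l) simp_all
  then show ?thesis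
    by (simp add: splitting_def comult_mult tensor_form_mult[OF assms] o_def)
qed

text \<open>
  The factors of the splittings are multiplied with each other, so a set \<open>A\<close> of allowed factors only
  has to be closed under products.
\<close>

lemma splits_conv:
  assumes A: "A \<subseteq> dual_space H" "\<And>a b. \<lbrakk>a \<in> A; b \<in> A\<rbrakk> \<Longrightarrow> a \<otimes>\<^bsub>D\<^esub> b \<in> A"
    and fg: "f \<in> dual_space H" "g \<in> dual_space H" and "splits H A f" "splits H A g"
  shows "splits H A (f \<otimes>\<^bsub>D\<^esub> g)"
proof -
  obtain ps rs where ps: "set ps \<subseteq> A \<times> A" "splitting H f ps" and rs: "set rs \<subseteq> A \<times> A" "splitting H g rs"
    using assms(5,6) by (auto simp: splits_def)
  have "splitting H (f \<otimes>\<^bsub>D\<^esub> g)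
      (concat (map (\<lambda>p. map (\<lambda>r. (fst p \<otimes>\<^bsub>D\<^esub> fst r, snd p \<otimes>\<^bsub>D\<^esub> snd r)) rs) ps))"
    using A(1) ps rs by (intro conv_splitting fg) auto
  moreover have "fst p \<otimes>\<^bsub>D\<^esub> fst r \<in> A" "snd p \<otimes>\<^bsub>D\<^esub> snd r \<in> A" if "p \<in> set ps" "r \<in> set rs" for p r
    using that ps(1) rs(1) by (auto intro!: A(2) simp del: finite_dual_simps)
  ultimately show ?thesis
    unfolding splits_def
    by (intro exI[of _ "concat (map (\<lambda>p. map (\<lambda>r. (fst p \<otimes>\<^bsub>D\<^esub> fst r, snd p \<otimes>\<^bsub>D\<^esub> snd r)) rs) ps)"] conjI)
      (auto simp del: finite_dual_simps)
qed

lemma splits_counit: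
  "(\<lambda>x\<in>carrier H. counit H x) \<in> A \<Longrightarrow> splits H A (\<lambda>x\<in>carrier H. counit H x)"
  unfolding splits_def
  by (intro exI[of _ "[(\<lambda>x\<in>carrier H. counit H x, \<lambda>x\<in>carrier H. counit H x)]"])
    (simp add: splitting_def counit_mult)

lemma finite_dual_k_space: "k_space D"
proof -
  have zero: "(\<lambda>x\<in>carrier H. 0) \<in> finite_dual_carrier H"
    unfolding finite_dual_carrier_iff
    by (auto simp: dual_space_k_closed splits_def splitting_def intro!: exI[of _ "[]"])
  have add: "(\<lambda>x\<in>carrier H. f x + g x) \<in> finite_dual_carrier H"
    if "f \<in> finite_dual_carrier H" "g \<in> finite_dual_carrier H" for f g
    using that unfolding finite_dual_carrier_iff by (simp add: dual_space_k_closed splits_add)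
  have scale: "(\<lambda>x\<in>carrier H. c * f x) \<in> finite_dual_carrier H"
    if "f \<in> finite_dual_carrier H" for c f
    using that unfolding finite_dual_carrier_iff by (simp add: dual_space_k_closed splits_scale)
  have ext: "(\<lambda>x\<in>carrier H. f x) = f" if "f \<in> finite_dual_carrier H" for f
    using that by (auto simp: finite_dual_carrier_def dual_space_def extensional_restrict PiE_def)
  have "abelian_group D"
  proof (rule abelian_groupI)
    fix f assume "f \<in> carrier D"
    then show "\<exists>g\<in>carrier D. g \<oplus>\<^bsub>D\<^esub> f = \<zero>\<^bsub>D\<^esub>"
      using scale[of f "- 1"] by (intro bexI[of _ "\<lambda>x\<in>carrier H. - 1 * f x"]) auto
  qed (auto simp: zero add ext algebra_simps cong: restrict_cong)
  then show ?thesis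
    by (intro k_space.intro k_space_axioms.intro)
      (auto simp: scale ext algebra_simps cong: restrict_cong)
qed

sublocale D: k_space "finite_dual H" by (rule finite_dual_k_space)

lemma k_subalgebraI:
  assumes "B \<subseteq> finite_dual_carrier H" "\<one>\<^bsub>D\<^esub> \<in> B"
    and "\<And>f g. \<lbrakk>f \<in> B; g \<in> B\<rbrakk> \<Longrightarrow> f \<oplus>\<^bsub>D\<^esub> g \<in> B"
    and "\<And>f g. \<lbrakk>f \<in> B; g \<in> B\<rbrakk> \<Longrightarrow> f \<otimes>\<^bsub>D\<^esub> g \<in> B"
    and scale: "\<And>c f. f \<in> B \<Longrightarrow> c \<odot>\<^bsub>D\<^esub> f \<in> B"
  shows "k_subalgebra B D"
proof -
  have "\<ominus>\<^bsub>D\<^esub> f \<in> B" if "f \<in> B" for f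
    using that assms(1) scale[of f "- 1"] D.scale_minus_one[of f]
    by (simp add: subset_eq del: finite_dual_simps(2-))
  then have "subgroup B (add_monoid D)"
    using assms by (intro D.add.subgroupI) (auto simp del: finite_dual_simps(2-))
  then show ?thesis
    using assms by (auto simp: k_subalgebra_def subring_def submonoid_def simp del: finite_dual_simps(2-))
qed

lemma finite_dual_subalgebra: "k_subalgebra (finite_dual_carrier H) D"
proof (rule k_subalgebraI)
  show "\<one>\<^bsub>D\<^esub> \<in> finite_dual_carrier H"
    by (simp add: finite_dual_carrier_iff counit_dual splits_counit)
  show "f \<otimes>\<^bsub>D\<^esub> g \<in> finite_dual_carrier H"
    if "f \<in> finite_dual_carrier H" "g \<in> finite_dual_carrier H" for f g
    using that unfolding finite_dual_carrier_iff
    by (auto intro: conv_dual splits_conv simp del: finite_dual_simps)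
  show "f \<oplus>\<^bsub>D\<^esub> g \<in> finite_dual_carrier H"
    if "f \<in> finite_dual_carrier H" "g \<in> finite_dual_carrier H" for f g
    using D.a_closed[of f g] that by (simp del: finite_dual_simps(2-))
  show "c \<odot>\<^bsub>D\<^esub> f \<in> finite_dual_carrier H" if "f \<in> finite_dual_carrier H" for c f
    using D.scale_closed[of f c] that by (simp del: finite_dual_simps(2-))
qed simp

lemma k_subalgebraD:
  assumes "k_subalgebra B D"
  shows "B \<subseteq> finite_dual_carrier H" "\<one>\<^bsub>D\<^esub> \<in> B"
    "\<lbrakk>f \<in> B; g \<in> B\<rbrakk> \<Longrightarrow> f \<oplus>\<^bsub>D\<^esub> g \<in> B" "\<lbrakk>f \<in> B; g \<in> B\<rbrakk> \<Longrightarrow> f \<otimes>\<^bsub>D\<^esub> g \<in> B"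
    "f \<in> B \<Longrightarrow> c \<odot>\<^bsub>D\<^esub> f \<in> B"
  using assms subringE[of B D] by (auto simp: k_subalgebra_def simp del: finite_dual_simps(2-))

lemma generated_subalgebra_least:
  "k_subalgebra B D \<Longrightarrow> S \<subseteq> B \<Longrightarrow> generated_subalgebra D S \<subseteq> B"
  by (auto simp: generated_subalgebra_def)

lemma generated_subalgebra_superset: "S \<subseteq> generated_subalgebra D S"
  by (auto simp: generated_subalgebra_def)

lemma generated_subalgebra_subalgebra:
  assumes "S \<subseteq> finite_dual_carrier H"
  shows "k_subalgebra (generated_subalgebra D S) D"
proof (rule k_subalgebraI)
  show "generated_subalgebra D S \<subseteq> finite_dual_carrier H"
    by (rule generated_subalgebra_least[OF finite_dual_subalgebra assms])
qed (auto simp: generated_subalgebra_def k_subalgebraD simp del: finite_dual_simps)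

interpretation DD: tensor_spaces "finite_dual H" "finite_dual H" ..

text \<open>
  The comultiplication of the finite dual is well defined because different elements of
  \<open>D \<otimes> D\<close> give different functions on pairs.  Choose pivots for the left factors \<open>fst p\<close> that occur in
  a representative \<open>z\<close> and move all coefficients to the right: \<open>z\<close> becomes a sum of tensors of the
  pivots \<open>q\<close> with functions whose value at \<open>y\<close> is the value of \<open>z\<close> at the pair \<open>(v q, y)\<close>, that is, zero.
\<close>

lemma tensor_finite_dual_inj:
  assumes z: "z \<in> DD.reps"
    and zero: "\<And>x y. \<lbrakk>x \<in> carrier H; y \<in> carrier H\<rbrakk> \<Longrightarrow>
      linear_extension (\<lambda>p. fst p x * snd p y) z = 0"
  shows "z \<in> DD.null"
proof -
  let ?L = "Poly_Mapping.keys z"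
  have L: "?L \<subseteq> finite_dual_carrier H \<times> finite_dual_carrier H"
    using z by (simp add: tensor_free_def)
  then have Lc: "fst p \<in> finite_dual_carrier H" "snd p \<in> finite_dual_carrier H" if "p \<in> ?L" for p
    using that by auto
  obtain P v where P: "P \<subseteq> ?L" and v: "v \<in> P \<rightarrow> carrier H"
    and piv: "\<And>p x. \<lbrakk>p \<in> ?L; x \<in> carrier H\<rbrakk> \<Longrightarrow> fst p x = (\<Sum>q\<in>P. fst q x * fst p (v q))"
    by (rule functionals_pivots[of ?L fst, OF finite_keys finite_dual_carrierD(1)[OF Lc(1)]])
      (assumption, rule that)
  have finP: "finite P" using P by (auto intro: finite_subset)
  have Pc: "fst \<in> P \<rightarrow> carrier D" and Sc: "snd \<in> ?L \<rightarrow> carrier D" using P Lc by auto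
  note apply_D = lincomb_apply[OF finite_dual_k_space]
  have left: "fst p = (\<Oplus>\<^bsub>D\<^esub>q\<in>P. fst p (v q) \<odot>\<^bsub>D\<^esub> fst q)" if p: "p \<in> ?L" for p
  proof (rule finite_dual_ext)
    show "fst p \<in> finite_dual_carrier H" using Lc p by simp
    from D.lincomb_closed[OF Pc]
    show "(\<Oplus>\<^bsub>D\<^esub>q\<in>P. fst p (v q) \<odot>\<^bsub>D\<^esub> fst q) \<in> finite_dual_carrier H" by (simp del: finite_dual_simps(2-))
    fix x assume "x \<in> carrier H"
    then show "fst p x = (\<Oplus>\<^bsub>D\<^esub>q\<in>P. fst p (v q) \<odot>\<^bsub>D\<^esub> fst q) x"
      using piv[OF p] apply_D[OF finP Pc, of x "\<lambda>q. fst p (v q)"] by (simp add: mult.commute)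
  qed
  have right: "(\<Oplus>\<^bsub>D\<^esub>p\<in>?L. (Poly_Mapping.lookup z p * fst p (v q)) \<odot>\<^bsub>D\<^esub> snd p) = \<zero>\<^bsub>D\<^esub>"
    if q: "q \<in> P" for q
  proof (rule finite_dual_ext)
    from D.lincomb_closed[OF Sc]
    show "(\<Oplus>\<^bsub>D\<^esub>p\<in>?L. (Poly_Mapping.lookup z p * fst p (v q)) \<odot>\<^bsub>D\<^esub> snd p) \<in> finite_dual_carrier H"
      by (simp del: finite_dual_simps(2-))
    show "\<zero>\<^bsub>D\<^esub> \<in> finite_dual_carrier H"
      using D.zero_closed by (simp del: finite_dual_simps(2-))
    fix y assume y: "y \<in> carrier H"
    have "(\<Oplus>\<^bsub>D\<^esub>p\<in>?L. (Poly_Mapping.lookup z p * fst p (v q)) \<odot>\<^bsub>D\<^esub> snd p) y =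
        (\<Sum>p\<in>?L. (Poly_Mapping.lookup z p * fst p (v q)) * snd p y)"
      using y by (intro apply_D finite_keys Sc) auto
    also have "\<dots> = 0"
      using zero[of "v q" y] v q y by (auto simp: linear_extension_def mult.assoc)
    finally show "(\<Oplus>\<^bsub>D\<^esub>p\<in>?L. (Poly_Mapping.lookup z p * fst p (v q)) \<odot>\<^bsub>D\<^esub> snd p) y = \<zero>\<^bsub>D\<^esub> y"
      using y by simp
  qed
  have "z = (\<Sum>p\<in>?L. Poly_Mapping.single (fst p, snd p) (Poly_Mapping.lookup z p))"
    by (intro poly_mapping_eqI) (auto simp: lookup_sum lookup_single when_def in_keys_iff)
  also have "\<dots> - (\<Sum>p\<in>?L. \<Sum>q\<in>P. Poly_Mapping.single (fst q, snd p) (Poly_Mapping.lookup z p * fst p (v q))) \<in> DD.null"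
    unfolding sum_subtractf[symmetric]
  proof (rule DD.null_sum)
    fix p assume p: "p \<in> ?L"
    show "Poly_Mapping.single (fst p, snd p) (Poly_Mapping.lookup z p)
      - (\<Sum>q\<in>P. Poly_Mapping.single (fst q, snd p) (Poly_Mapping.lookup z p * fst p (v q))) \<in> DD.null"
      using DD.null_lincomb_left[OF finP Pc, of "snd p" "\<lambda>q. fst p (v q)" "Poly_Mapping.lookup z p"]
        Lc(2)[OF p] by (simp add: left[OF p, symmetric] del: finite_dual_simps(2-))
  qed
  also have "(\<Sum>p\<in>?L. \<Sum>q\<in>P. Poly_Mapping.single (fst q, snd p) (Poly_Mapping.lookup z p * fst p (v q)))
      = (\<Sum>q\<in>P. \<Sum>p\<in>?L. Poly_Mapping.single (fst q, snd p) (1 * (Poly_Mapping.lookup z p * fst p (v q))))"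
    by (subst sum.swap) simp
  finally have 1: "z - \<dots> \<in> DD.null" .
  have "(\<Sum>p\<in>?L. Poly_Mapping.single (fst q, snd p) (1 * (Poly_Mapping.lookup z p * fst p (v q)))) \<in> DD.null"
    if q: "q \<in> P" for q
  proof -
    have qc: "fst q \<in> carrier D" using Pc q by auto
    have "Poly_Mapping.single (fst q, \<zero>\<^bsub>D\<^esub>) 1
        - (\<Sum>p\<in>?L. Poly_Mapping.single (fst q, snd p) (1 * (Poly_Mapping.lookup z p * fst p (v q)))) \<in> DD.null"
      using DD.null_lincomb_right[OF finite_keys Sc qc, of "\<lambda>p. Poly_Mapping.lookup z p * fst p (v q)" 1]
      by (simp add: right[OF q] del: finite_dual_simps(2-))
    moreover have "Poly_Mapping.single (fst q, \<zero>\<^bsub>D\<^esub>) 1 \<in> DD.null"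
      using DD.null_lincomb_right[of "{}" snd "fst q" "\<lambda>_. 0" 1] qc by (simp del: finite_dual_simps)
    ultimately show ?thesis using DD.null_diff by fastforce
  qed
  then have "(\<Sum>q\<in>P. \<Sum>p\<in>?L. Poly_Mapping.single (fst q, snd p) (1 * (Poly_Mapping.lookup z p * fst p (v q)))) \<in> DD.null"
    by (rule DD.null_sum)
  from DD.null_add[OF 1 this] show ?thesis by simp
qed

text \<open>
  That the antipode reverses the comultiplication has to be checked on generators only.  For a product
  \<open>x y\<close>, split the two functions and apply the hypotheses on \<open>x\<close> and \<open>y\<close> to the factors.
\<close>

lemma conv_antipode_mult:
  assumes S_closed: "\<And>x. x \<in> carrier H \<Longrightarrow> antipode H x \<in> carrier H"
    and S_mult: "\<And>x y. \<lbrakk>x \<in> carrier H; y \<in> carrier H\<rbrakk> \<Longrightarrow>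
      antipode H (x \<otimes> y) = antipode H y \<otimes> antipode H x"
    and S_dual: "\<And>f. f \<in> dual_space H \<Longrightarrow> antipode D f \<in> dual_space H"
    and x: "x \<in> carrier H" "\<And>f g. \<lbrakk>f \<in> finite_dual_carrier H; g \<in> finite_dual_carrier H\<rbrakk> \<Longrightarrow>
      (f \<otimes>\<^bsub>D\<^esub> g) (antipode H x) = (antipode D g \<otimes>\<^bsub>D\<^esub> antipode D f) x"
    and y: "y \<in> carrier H" "\<And>f g. \<lbrakk>f \<in> finite_dual_carrier H; g \<in> finite_dual_carrier H\<rbrakk> \<Longrightarrow>
      (f \<otimes>\<^bsub>D\<^esub> g) (antipode H y) = (antipode D g \<otimes>\<^bsub>D\<^esub> antipode D f) y"
    and f: "f \<in> finite_dual_carrier H" and g: "g \<in> finite_dual_carrier H"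
  shows "(f \<otimes>\<^bsub>D\<^esub> g) (antipode H (x \<otimes> y)) = (antipode D g \<otimes>\<^bsub>D\<^esub> antipode D f) (x \<otimes> y)"
proof -
  let ?S = "antipode D"
  let ?c = "\<lambda>f g. f \<otimes>\<^bsub>D\<^esub> g"
  obtain ps where ps: "set ps \<subseteq> finite_dual_carrier H \<times> finite_dual_carrier H" "splitting H f ps"
    using finite_dual_carrierD(2)[OF f] by (auto simp: splits_def)
  obtain rs where rs: "set rs \<subseteq> finite_dual_carrier H \<times> finite_dual_carrier H" "splitting H g rs"
    using finite_dual_carrierD(2)[OF g] by (auto simp: splits_def)
  have sub: "finite_dual_carrier H \<subseteq> dual_space H" by (auto simp: finite_dual_carrier_def)
  have rev: "splitting H (?S f) (map (\<lambda>p. (?S (snd p), ?S (fst p))) ps)"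
    if "splitting H f ps" for f ps
    using that by (simp add: splitting_def S_mult S_closed o_def mult.commute)
  have rev_dual: "set (map (\<lambda>p. (?S (snd p), ?S (fst p))) ps) \<subseteq> dual_space H \<times> dual_space H"
    if "set ps \<subseteq> finite_dual_carrier H \<times> finite_dual_carrier H" for ps
    using that sub S_dual by (fastforce simp del: finite_dual_simps)
  have conv_apply: "tensor_form (\<lambda>a b. u a * v b) (comult H z) = ?c u v z" if "z \<in> carrier H" for u v z
    using that by simp
  have prod_apply: "?c u v (z \<otimes> z') = (\<Sum>p\<leftarrow>us. \<Sum>r\<leftarrow>vs. ?c (fst p) (fst r) z * ?c (snd p) (snd r) z')"
    if "u \<in> dual_space H" "v \<in> dual_space H" "set us \<subseteq> dual_space H \<times> dual_space H" "splitting H u us"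
      "set vs \<subseteq> dual_space H \<times> dual_space H" "splitting H v vs" "z \<in> carrier H" "z' \<in> carrier H"
    for u v us vs z z'
    using tensor_form_mult[OF that(1-6) comult_closed[OF that(7)] comult_closed[OF that(8)]] that(7,8)
    by (simp add: comult_mult)
  have "?c f g (antipode H (x \<otimes> y)) =
      (\<Sum>p\<leftarrow>ps. \<Sum>r\<leftarrow>rs. ?c (fst p) (fst r) (antipode H y) * ?c (snd p) (snd r) (antipode H x))"
    unfolding S_mult[OF x(1) y(1)]
    using f g ps rs sub x y S_closed by (intro prod_apply) auto
  also have "\<dots> = (\<Sum>p\<leftarrow>ps. \<Sum>r\<leftarrow>rs. ?c (?S (fst r)) (?S (fst p)) y * ?c (?S (snd r)) (?S (snd p)) x)"
  proof (intro arg_cong[where f = sum_list] map_cong refl)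
    fix p r assume "p \<in> set ps" "r \<in> set rs"
    then have "fst p \<in> finite_dual_carrier H" "snd p \<in> finite_dual_carrier H"
      "fst r \<in> finite_dual_carrier H" "snd r \<in> finite_dual_carrier H"
      using ps(1) rs(1) by auto
    then show "?c (fst p) (fst r) (antipode H y) * ?c (snd p) (snd r) (antipode H x) =
        ?c (?S (fst r)) (?S (fst p)) y * ?c (?S (snd r)) (?S (snd p)) x"
      by (simp only: x(2) y(2))
  qed
  also have "\<dots> = (\<Sum>r\<leftarrow>rs. \<Sum>p\<leftarrow>ps. ?c (?S (snd r)) (?S (snd p)) x * ?c (?S (fst r)) (?S (fst p)) y)"
    by (induction ps) (simp_all add: sum_list_addf mult.commute del: finite_dual_simps)
  also have "\<dots> = ?c (?S g) (?S f) (x \<otimes> y)"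
    using prod_apply[OF S_dual S_dual rev_dual[OF rs(1)] rev[OF rs(2)] rev_dual[OF ps(1)] rev[OF ps(2)] x(1) y(1)]
      f g sub by (simp add: o_def subset_eq del: finite_dual_simps)
  finally show ?thesis .
qed

text \<open>
  A splitting of \<open>f\<close>, read as a sum of pure tensors, is the coproduct of \<open>f\<close>.
\<close>

lemma comult_finite_dual:
  assumes "A \<subseteq> finite_dual_carrier H" "splits H A f"
  shows "comult D f \<in> tensor_subspace D D A A"
proof -
  obtain ps where ps: "set ps \<subseteq> A \<times> A" "splitting H f ps" using assms(2) by (auto simp: splits_def)
  define z :: "_ \<Rightarrow>\<^sub>0 'k" where "z = (\<Sum>p\<leftarrow>ps. Poly_Mapping.single p 1)"
  have keys: "Poly_Mapping.keys z \<subseteq> A \<times> A"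
  proof -
    have "Poly_Mapping.keys z \<subseteq> set ps"
      unfolding z_def
    proof (induction ps)
      case (Cons p ps)
      then show ?case
        using keys_add[of "Poly_Mapping.single p (1::'k)" "\<Sum>p\<leftarrow>ps. Poly_Mapping.single p 1"] by auto
    qed simp
    then show ?thesis using ps by blast
  qed
  then have z: "z \<in> DD.reps" using assms(1) by (auto simp: tensor_free_def)
  have ext_z: "linear_extension \<phi> z = (\<Sum>p\<leftarrow>ps. \<phi> p)" for \<phi>
    unfolding z_def by (induction ps) (auto simp: linear_extension_add)
  have bil: "bilinear_form D D (\<lambda>a b. a x * b y)" if "x \<in> carrier H" "y \<in> carrier H" for x y
    using that by (simp add: bilinear_form_def algebra_simps)
  \<comment> \<open>the property that characterises the coproduct of \<open>f\<close>\<close>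
  define Q where "Q t \<longleftrightarrow> t \<in> carrier (tensor (finite_dual_algebra H) (finite_dual_algebra H)) \<and>
      (\<forall>x\<in>carrier H. \<forall>y\<in>carrier H. tensor_form (\<lambda>a b. a x * b y) t = f (x \<otimes> y))" for t
  have Q_cls: "Q (DD.cls x) \<longleftrightarrow> (\<forall>u\<in>carrier H. \<forall>w\<in>carrier H.
      linear_extension (\<lambda>p. fst p u * snd p w) x = f (u \<otimes> w))" if "x \<in> DD.reps" for x
    using that by (auto simp: Q_def tensor_finite_dual DD.tensor_carrier DD.tensor_form_cls bil)
  have "(THE t. Q t) = DD.cls z"
  proof (rule the_equality)
    show "Q (DD.cls z)"
      using ps(2) by (simp add: Q_cls[OF z] ext_z splitting_def)
    fix t assume t: "Q t"
    then obtain x where x: "x \<in> DD.reps" "t = DD.cls x"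
      by (auto simp: Q_def tensor_finite_dual DD.tensor_carrier)
    have "x - z \<in> DD.null"
      using t \<open>Q (DD.cls z)\<close> DD.reps_diff[OF x(1) z]
      by (intro tensor_finite_dual_inj) (simp_all add: x(2) Q_cls[OF z] Q_cls[OF x(1)] linear_extension_diff)
    then show "t = DD.cls z" using x by (simp add: DD.cls_eqI)
  qed
  moreover have "comult D f = (THE t. Q t)"
    by (simp add: Q_def finite_dual_def module.defs hopf.defs)
  ultimately show ?thesis
    using keys by (auto simp: tensor_subspace_def tensor_free_def)
qed

end

section \<open>Coordinate functions and dual modules\<close>

context k_algebra
begin

lemma underlying_space_k_space:
  assumes "left_module H M"
  shows "k_space (underlying_space H M)"
proof -
  interpret L: left_module H M by fact
  have "abelian_group (underlying_space H M)"
  proof (rule abelian_groupI)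
    fix x assume "x \<in> carrier (underlying_space H M)"
    then show "\<exists>y\<in>carrier (underlying_space H M).
        y \<oplus>\<^bsub>underlying_space H M\<^esub> x = \<zero>\<^bsub>underlying_space H M\<^esub>"
      by (intro bexI[of _ "\<ominus>\<^bsub>M\<^esub> x"]) (simp_all add: underlying_space_simps L.M.l_neg)
  qed (simp_all add: underlying_space_simps L.M.a_ac)
  moreover have "((c \<odot> \<one>) \<otimes> (d \<odot> \<one>)) = (c * d) \<odot> \<one>" for c d
    by (simp add: scale_mult_left scale_scale)
  ultimately show ?thesis
    by (intro k_space.intro k_space_axioms.intro)
      (simp_all add: underlying_space_simps L.smult_closed L.smult_r_distr scale_add_left
        L.smult_l_distr L.smult_one flip: L.smult_assoc)
qed

lemma coordinate_function_dual:
  assumes M: "left_module H M" and f: "f \<in> dual_space (underlying_space H M)"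
    and v: "v \<in> carrier M"
  shows "coordinate_function H M f v \<in> dual_space H"
proof -
  interpret L: left_module H M by fact
  interpret U: k_space "underlying_space H M" by (rule underlying_space_k_space[OF M])
  have "(c \<odot> x) \<odot>\<^bsub>M\<^esub> v = (c \<odot> \<one>) \<odot>\<^bsub>M\<^esub> (x \<odot>\<^bsub>M\<^esub> v)" if "x \<in> carrier H" for c x
    using that v by (simp add: scale_mult_left flip: L.smult_assoc)
  then show ?thesis
    using v U.dual_space_add[OF f] U.dual_space_scale[OF f]
    by (simp add: dual_space_def coordinate_function_def underlying_space_simps
        L.smult_closed L.smult_l_distr)
qed

text \<open>Matrix multiplication: insert a frame of the module between the factors \<open>x\<close> and \<open>y\<close>.\<close>

lemma coordinate_function_splits:
  assumes M: "left_module H M" and fd: "fin_dim (underlying_space H M)"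
    and f: "f \<in> dual_space (underlying_space H M)" and v: "v \<in> carrier M"
  shows "splits H {coordinate_function H M f v | f v. f \<in> dual_space (underlying_space H M) \<and> v \<in> carrier M}
    (coordinate_function H M f v)"
proof -
  interpret L: left_module H M by fact
  interpret U: k_space "underlying_space H M" by (rule underlying_space_k_space[OF M])
  obtain B F where B: "finite B" "B \<subseteq> carrier (underlying_space H M)"
    and F: "\<And>b. b \<in> B \<Longrightarrow> F b \<in> dual_space (underlying_space H M)"
    and span: "\<And>x. x \<in> carrier (underlying_space H M) \<Longrightarrow>
      x = (\<Oplus>\<^bsub>underlying_space H M\<^esub>b\<in>B. F b x \<odot>\<^bsub>underlying_space H M\<^esub> b)"
    using U.fin_dim_frame[OF fd] by blast
  have Bc: "b \<in> carrier M" if "b \<in> B" for b using B that by (auto simp: underlying_space_simps)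
  show ?thesis
  proof (rule splitsI_sum[OF B(1)])
    fix b assume "b \<in> B"
    then show "coordinate_function H M f b \<in> {coordinate_function H M f v | f v.
          f \<in> dual_space (underlying_space H M) \<and> v \<in> carrier M} \<and>
        coordinate_function H M (F b) v \<in> {coordinate_function H M f v | f v.
          f \<in> dual_space (underlying_space H M) \<and> v \<in> carrier M}"
      using F Bc f v by blast
  next
    fix x y assume xy: "x \<in> carrier H" "y \<in> carrier H"
    define g where "g = (\<lambda>u\<in>carrier M. f (x \<odot>\<^bsub>M\<^esub> u))"
    have comm: "x \<odot>\<^bsub>M\<^esub> ((c \<odot> \<one>) \<odot>\<^bsub>M\<^esub> u) = (c \<odot> \<one>) \<odot>\<^bsub>M\<^esub> (x \<odot>\<^bsub>M\<^esub> u)" if "u \<in> carrier M" for c u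
      using that xy by (simp add: scale_mult_left scale_mult_right flip: L.smult_assoc)
    have g: "g \<in> dual_space (underlying_space H M)"
      using U.dual_space_add[OF f] U.dual_space_scale[OF f] xy comm
      by (simp add: dual_space_def g_def underlying_space_simps L.smult_closed L.smult_r_distr)
    have yv: "y \<odot>\<^bsub>M\<^esub> v \<in> carrier (underlying_space H M)"
      using xy v by (simp add: underlying_space_simps L.smult_closed)
    have "coordinate_function H M f v (x \<otimes> y) = g (y \<odot>\<^bsub>M\<^esub> v)"
      using xy v by (simp add: coordinate_function_def g_def L.smult_assoc L.smult_closed)
    also have "\<dots> = g (\<Oplus>\<^bsub>underlying_space H M\<^esub>b\<in>B. F b (y \<odot>\<^bsub>M\<^esub> v) \<odot>\<^bsub>underlying_space H M\<^esub> b)"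
      using span[OF yv] by simp
    also have "\<dots> = (\<Sum>b\<in>B. F b (y \<odot>\<^bsub>M\<^esub> v) * g b)"
      using B by (intro U.dual_space_lincomb[OF g]) auto
    also have "\<dots> = (\<Sum>b\<in>B. coordinate_function H M f b x * coordinate_function H M (F b) v y)"
      using xy Bc by (intro sum.cong) (simp_all add: g_def coordinate_function_def mult.commute)
    finally show "coordinate_function H M f v (x \<otimes> y) =
        (\<Sum>b\<in>B. coordinate_function H M f b x * coordinate_function H M (F b) v y)" .
  qed
qed

lemma simple_coordinate_functions_splits:
  assumes "c \<in> simple_coordinate_functions H"
  shows "c \<in> dual_space H" "splits H (simple_coordinate_functions H) c"
proof -
  obtain M :: "('a, nat \<Rightarrow> 'k) module" and f v where c: "c = coordinate_function H M f v"
    and M: "simple_module H M" "fin_dim (underlying_space H M)"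
      "f \<in> dual_space (underlying_space H M)" "v \<in> carrier M"
    using assms unfolding simple_coordinate_functions_def by blast
  have L: "left_module H M" using M by (simp add: simple_module_def)
  show "c \<in> dual_space H" unfolding c by (rule coordinate_function_dual[OF L M(3,4)])
  show "splits H (simple_coordinate_functions H) c"
    unfolding c
    by (rule splits_mono[OF coordinate_function_splits[OF L M(2-4)]])
      (use M in \<open>auto simp: simple_coordinate_functions_def\<close>)
qed

lemma simple_coordinate_functions_finite_dual:
  "simple_coordinate_functions H \<subseteq> finite_dual_carrier H"
  using simple_coordinate_functions_splits splits_mono finite_dual_carrier_iff by blast

end

text \<open>This is the contragredient module.\<close>

definition dual_module ::
  "('k::field, 'a, 'm) hopf_scheme \<Rightarrow> ('a, 'b, 'n) module_scheme \<Rightarrow> ('a, 'b \<Rightarrow> 'k) module"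
  where "dual_module H M =
    \<lparr>carrier = dual_space (underlying_space H M),
     monoid.mult = undefined,
     one = undefined,
     ring.zero = (\<lambda>v\<in>carrier M. 0),
     add = (\<lambda>f g. \<lambda>v\<in>carrier M. f v + g v),
     module.smult = (\<lambda>x f. \<lambda>v\<in>carrier M. f (antipode H x \<odot>\<^bsub>M\<^esub> v))\<rparr>"

text \<open>
  The antipode of a Hopf algebra reverses the order of multiplication and of comultiplication.
  The latter is expressed by its effect on products in the finite dual.  Surjectivity makes
  duality of modules preserve simplicity: subspaces stable under the image of the antipode are
  submodules.
\<close>

locale algebra_with_antipode = algebra_with_comult H
  for H :: "('k::field, 'a, 'm) hopf_scheme" (structure) +
  assumes antipode_closed [simp]: "x \<in> carrier H \<Longrightarrow> antipode H x \<in> carrier H"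
    and antipode_add: "\<lbrakk>x \<in> carrier H; y \<in> carrier H\<rbrakk> \<Longrightarrow>
      antipode H (x \<oplus> y) = antipode H x \<oplus> antipode H y"
    and antipode_scale: "x \<in> carrier H \<Longrightarrow> antipode H (c \<odot> x) = c \<odot> antipode H x"
    and antipode_one: "antipode H \<one> = \<one>"
    and antipode_mult: "\<lbrakk>x \<in> carrier H; y \<in> carrier H\<rbrakk> \<Longrightarrow>
      antipode H (x \<otimes> y) = antipode H y \<otimes> antipode H x"
    and antipode_surj: "x \<in> carrier H \<Longrightarrow> \<exists>y\<in>carrier H. antipode H y = x"
    and counit_antipode: "x \<in> carrier H \<Longrightarrow> counit H (antipode H x) = counit H x"
    and conv_antipode: "\<lbrakk>f \<in> finite_dual_carrier H; g \<in> finite_dual_carrier H; x \<in> carrier H\<rbrakk> \<Longrightarrow>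
      (f \<otimes>\<^bsub>finite_dual H\<^esub> g) (antipode H x) =
        (antipode (finite_dual H) g \<otimes>\<^bsub>finite_dual H\<^esub> antipode (finite_dual H) f) x"
begin

context
  fixes M :: "('a, 'b, 'n) module_scheme"
  assumes M: "left_module H M"
begin

interpretation L: left_module H M by (rule M)
interpretation U: k_space "underlying_space H M" by (rule underlying_space_k_space[OF M])

lemma dual_module_simps:
  "carrier (dual_module H M) = dual_space (underlying_space H M)"
  "\<zero>\<^bsub>dual_module H M\<^esub> = (\<lambda>v\<in>carrier M. 0)"
  "f \<oplus>\<^bsub>dual_module H M\<^esub> g = (\<lambda>v\<in>carrier M. f v + g v)"
  "x \<odot>\<^bsub>dual_module H M\<^esub> f = (\<lambda>v\<in>carrier M. f (antipode H x \<odot>\<^bsub>M\<^esub> v))"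
  by (simp_all add: dual_module_def)

lemma functional_add: "\<lbrakk>f \<in> dual_space (underlying_space H M); v \<in> carrier M; w \<in> carrier M\<rbrakk> \<Longrightarrow>
    f (v \<oplus>\<^bsub>M\<^esub> w) = f v + f w"
  and functional_scale: "\<lbrakk>f \<in> dual_space (underlying_space H M); v \<in> carrier M\<rbrakk> \<Longrightarrow>
    f ((c \<odot> \<one>) \<odot>\<^bsub>M\<^esub> v) = c * f v"
  and functional_ext: "f \<in> dual_space (underlying_space H M) \<Longrightarrow> restrict f (carrier M) = f"
  using U.dual_space_add[of f v w] U.dual_space_scale[of f v c]
  by (auto simp: underlying_space_simps dual_space_def PiE_def extensional_restrict)

lemma functionalI:
  assumes "\<And>v w. \<lbrakk>v \<in> carrier M; w \<in> carrier M\<rbrakk> \<Longrightarrow> f (v \<oplus>\<^bsub>M\<^esub> w) = f v + f w"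
    and "\<And>c v. v \<in> carrier M \<Longrightarrow> f ((c \<odot> \<one>) \<odot>\<^bsub>M\<^esub> v) = c * f v"
  shows "restrict f (carrier M) \<in> dual_space (underlying_space H M)"
  using assms by (simp add: dual_space_def underlying_space_simps L.smult_closed)

lemma dual_module_left_module: "left_module H (dual_module H M)"
proof -
  let ?N = "dual_module H M"
  have "abelian_group ?N"
  proof (rule abelian_groupI)
    fix f assume "f \<in> carrier ?N"
    then have f: "f \<in> dual_space (underlying_space H M)" by (simp add: dual_module_simps)
    show "\<exists>g\<in>carrier ?N. g \<oplus>\<^bsub>?N\<^esub> f = \<zero>\<^bsub>?N\<^esub>"
      by (rule bexI[of _ "\<lambda>v\<in>carrier M. - f v"])
        (auto simp: dual_module_simps functional_add[OF f] functional_scale[OF f]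
          intro!: functionalI)
  next
    fix f g assume "f \<in> carrier ?N" "g \<in> carrier ?N"
    then have fg: "f \<in> dual_space (underlying_space H M)" "g \<in> dual_space (underlying_space H M)"
      by (simp_all add: dual_module_simps)
    show "f \<oplus>\<^bsub>?N\<^esub> g \<in> carrier ?N"
      unfolding dual_module_simps
      by (intro functionalI) (simp_all add: functional_add functional_scale fg algebra_simps)
  next
    show "\<zero>\<^bsub>?N\<^esub> \<in> carrier ?N"
      unfolding dual_module_simps by (intro functionalI) simp_all
  qed (auto simp: dual_module_simps functional_ext algebra_simps cong: restrict_cong)
  moreover have comm: "x \<odot>\<^bsub>M\<^esub> ((c \<odot> \<one>) \<odot>\<^bsub>M\<^esub> u) = (c \<odot> \<one>) \<odot>\<^bsub>M\<^esub> (x \<odot>\<^bsub>M\<^esub> u)"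
    if "u \<in> carrier M" "x \<in> carrier H" for c u x
    using that by (simp add: scale_mult_left scale_mult_right flip: L.smult_assoc)
  have "x \<odot>\<^bsub>?N\<^esub> f \<in> carrier ?N" if "x \<in> carrier H" "f \<in> carrier ?N" for x f
    using that unfolding dual_module_simps
    by (intro functionalI)
      (simp_all add: functional_add functional_scale comm L.smult_r_distr L.smult_closed)
  ultimately show ?thesis
    by (intro left_module.intro left_module_axioms.intro ring_axioms)
      (auto simp: dual_module_simps antipode_add antipode_mult antipode_one L.smult_l_distr
        L.smult_assoc L.smult_closed L.smult_one functional_add functional_ext
        cong: restrict_cong)
qed

interpretation N: left_module H "dual_module H M" by (rule dual_module_left_module)
interpretation UN: k_space "underlying_space H (dual_module H M)"
  by (rule underlying_space_k_space[OF dual_module_left_module])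

lemma dual_module_lincomb:
  assumes "finite I" "f \<in> I \<rightarrow> dual_space (underlying_space H M)" "v \<in> carrier M"
  shows "(\<Oplus>\<^bsub>underlying_space H (dual_module H M)\<^esub>i\<in>I. c i \<odot>\<^bsub>underlying_space H (dual_module H M)\<^esub> f i) v =
    (\<Sum>i\<in>I. c i * f i v)"
  using assms
  by (intro lincomb_apply UN.k_space_axioms)
    (auto simp: underlying_space_simps dual_module_simps antipode_scale antipode_one functional_scale)

text \<open>
  The coordinate functionals \<open>F b\<close> of a frame of \<open>M\<close> span the dual, with coefficients \<open>f b\<close>.
\<close>

lemma dual_module_fin_dim:
  assumes "fin_dim (underlying_space H M)"
  shows "fin_dim (underlying_space H (dual_module H M))"
proof -
  obtain B F where B: "finite B" "B \<subseteq> carrier (underlying_space H M)"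
    and F: "\<And>b. b \<in> B \<Longrightarrow> F b \<in> dual_space (underlying_space H M)"
    and span: "\<And>x. x \<in> carrier (underlying_space H M) \<Longrightarrow>
      x = (\<Oplus>\<^bsub>underlying_space H M\<^esub>b\<in>B. F b x \<odot>\<^bsub>underlying_space H M\<^esub> b)"
    using U.fin_dim_frame[OF assms] by blast
  show ?thesis
  proof (rule UN.fin_dimI[OF B(1), of F])
    show FN: "F \<in> B \<rightarrow> carrier (underlying_space H (dual_module H M))"
      using F by (simp add: underlying_space_simps dual_module_simps)
    fix f assume "f \<in> carrier (underlying_space H (dual_module H M))"
    then have f: "f \<in> dual_space (underlying_space H M)"
      by (simp add: underlying_space_simps dual_module_simps)
    let ?s = "\<Oplus>\<^bsub>underlying_space H (dual_module H M)\<^esub>b\<in>B. f b \<odot>\<^bsub>underlying_space H (dual_module H M)\<^esub> F b"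
    have s: "?s \<in> dual_space (underlying_space H M)"
      using UN.lincomb_closed[OF FN, of f] by (simp add: underlying_space_simps dual_module_simps)
    have "f v = ?s v" if v: "v \<in> carrier M" for v
    proof -
      have "f v = f (\<Oplus>\<^bsub>underlying_space H M\<^esub>b\<in>B. F b v \<odot>\<^bsub>underlying_space H M\<^esub> b)"
        using span[of v] v by (simp add: underlying_space_simps)
      also have "\<dots> = (\<Sum>b\<in>B. F b v * f b)"
        using B by (intro U.dual_space_lincomb[OF f]) auto
      also have "\<dots> = ?s v"
        using B(1) F v by (simp add: dual_module_lincomb mult.commute)
      finally show ?thesis .
    qed
    then have "restrict f (carrier M) = restrict ?s (carrier M)" by (intro restrict_ext)
    then have "f = ?s" by (simp only: functional_ext f s)
    then show "\<exists>c. f = (\<Oplus>\<^bsub>underlying_space H (dual_module H M)\<^esub>b\<in>B. c b \<odot>\<^bsub>underlying_space H (dual_module H M)\<^esub> F b)"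
      by (rule exI[of _ f])
  qed
qed

text \<open>
  A submodule \<open>N\<close> of the dual of a simple module \<open>M\<close> has a common kernel which is a submodule of
  \<open>M\<close>.  If it is \<open>M\<close>, then \<open>N\<close> is zero.  If it is zero, finitely many elements \<open>\<psi> p\<close> of \<open>N\<close> already have
  zero common kernel, and then every functional is a combination of them.
\<close>

lemma dual_module_simple:
  assumes simple: "simple_module H M" and fd: "fin_dim (underlying_space H M)"
  shows "simple_module H (dual_module H M)"
  unfolding simple_module_def
proof (intro conjI allI impI)
  let ?N = "dual_module H M"
  show "left_module H ?N" by (rule dual_module_left_module)
  obtain B F where B: "finite B" "B \<subseteq> carrier (underlying_space H M)"
    and F: "\<And>b. b \<in> B \<Longrightarrow> F b \<in> dual_space (underlying_space H M)"
    and span: "\<And>x. x \<in> carrier (underlying_space H M) \<Longrightarrow>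
      x = (\<Oplus>\<^bsub>underlying_space H M\<^esub>b\<in>B. F b x \<odot>\<^bsub>underlying_space H M\<^esub> b)"
    using U.fin_dim_frame[OF fd] by blast
  have expand: "f v = (\<Sum>b\<in>B. F b v * f b)"
    if f: "f \<in> dual_space (underlying_space H M)" and v: "v \<in> carrier M" for f v
  proof -
    have "f v = f (\<Oplus>\<^bsub>underlying_space H M\<^esub>b\<in>B. F b v \<odot>\<^bsub>underlying_space H M\<^esub> b)"
      using span[of v] v by (simp add: underlying_space_simps)
    also have "\<dots> = (\<Sum>b\<in>B. F b v * f b)"
      using B by (intro U.dual_space_lincomb[OF f]) auto
    finally show ?thesis .
  qed
  show "carrier ?N \<noteq> {\<zero>\<^bsub>?N\<^esub>}"
  proof
    assume "carrier ?N = {\<zero>\<^bsub>?N\<^esub>}"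
    then have F0: "F b v = 0" if "b \<in> B" "v \<in> carrier M" for b v
      using F[OF that(1)] that(2) by (auto simp: dual_module_simps)
    have "v = \<zero>\<^bsub>M\<^esub>" if v: "v \<in> carrier M" for v
    proof -
      have "v = (\<Oplus>\<^bsub>underlying_space H M\<^esub>b\<in>B. F b v \<odot>\<^bsub>underlying_space H M\<^esub> b)"
        using span[of v] v by (simp add: underlying_space_simps)
      also have "\<dots> = (\<Oplus>\<^bsub>underlying_space H M\<^esub>b\<in>B. 0 \<odot>\<^bsub>underlying_space H M\<^esub> b)"
        using B F0 v by (intro U.finsum_cong') auto
      also have "\<dots> = \<zero>\<^bsub>M\<^esub>"
        using U.lincomb_zero[of id B] B by (auto simp: underlying_space_simps subset_eq)
      finally show ?thesis .
    qed
    then have "carrier M = {\<zero>\<^bsub>M\<^esub>}" using L.M.zero_closed by blast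
    then show False using simple by (simp add: simple_module_def)
  qed
  fix N assume "submodule N H ?N"
  then interpret S: submodule N H ?N .
  have N: "N \<subseteq> dual_space (underlying_space H M)"
    using S.subset by (simp add: dual_module_simps)
  have N_add: "(\<lambda>v\<in>carrier M. f v + g v) \<in> N" if "f \<in> N" "g \<in> N" for f g
    using S.m_closed[OF that] by (simp add: dual_module_simps)
  have N_act: "(\<lambda>v\<in>carrier M. f (antipode H x \<odot>\<^bsub>M\<^esub> v)) \<in> N" if "f \<in> N" "x \<in> carrier H" for f x
    using S.smult_closed[OF that(2,1)] by (simp add: dual_module_simps)
  have N_zero: "(\<lambda>v\<in>carrier M. 0) \<in> N"
    using S.one_closed by (simp add: dual_module_simps)
  have N_scale: "(\<lambda>v\<in>carrier M. c * f v) \<in> N" if "f \<in> N" for c f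
  proof -
    have "(\<lambda>v\<in>carrier M. f (antipode H (c \<odot> \<one>) \<odot>\<^bsub>M\<^esub> v)) = (\<lambda>v\<in>carrier M. c * f v)"
      using that N by (intro restrict_ext) (auto simp: antipode_scale antipode_one functional_scale)
    then show ?thesis using N_act[OF that, of "c \<odot> \<one>"] by simp
  qed
  define Z where "Z = {v \<in> carrier M. \<forall>f\<in>N. f v = 0}"
  have "submodule Z H M"
  proof (intro submodule.intro subgroup.intro submodule_axioms.intro)
    show "\<one>\<^bsub>add_monoid M\<^esub> \<in> Z"
      using N U.dual_space_zero by (auto simp: Z_def underlying_space_simps)
    show "v \<otimes>\<^bsub>add_monoid M\<^esub> w \<in> Z" if "v \<in> Z" "w \<in> Z" for v w
      using that N by (auto simp: Z_def functional_add subset_eq)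
    show "inv\<^bsub>add_monoid M\<^esub> v \<in> Z" if v: "v \<in> Z" for v
    proof -
      have vc: "v \<in> carrier M" using v by (simp add: Z_def)
      have "f (\<ominus>\<^bsub>M\<^esub> v) = 0" if "f \<in> N" for f
      proof -
        have f: "f \<in> dual_space (underlying_space H M)" using that N by auto
        have "f (\<ominus>\<^bsub>M\<^esub> v \<oplus>\<^bsub>M\<^esub> v) = f (\<ominus>\<^bsub>M\<^esub> v) + f v" by (rule functional_add[OF f]) (use vc in auto)
        moreover have "f v = 0" using v that by (simp add: Z_def)
        ultimately show ?thesis
          using vc U.dual_space_zero[OF f] by (simp add: L.M.l_neg underlying_space_simps)
      qed
      then show ?thesis using vc by (simp add: Z_def a_inv_def[symmetric])
    qed
    show "x \<odot>\<^bsub>M\<^esub> v \<in> Z" if x: "x \<in> carrier H" and v: "v \<in> Z" for x v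
    proof -
      obtain y where y: "y \<in> carrier H" "antipode H y = x" using antipode_surj[OF x] by blast
      have "f (x \<odot>\<^bsub>M\<^esub> v) = 0" if "f \<in> N" for f
        using N_act[OF that y(1)] v y(2) by (auto simp: Z_def)
      then show ?thesis using x v by (simp add: Z_def L.smult_closed)
    qed
  qed (auto simp: Z_def)
  then consider "Z = {\<zero>\<^bsub>M\<^esub>}" | "Z = carrier M"
    using simple by (auto simp: simple_module_def)
  then show "N = {\<zero>\<^bsub>?N\<^esub>} \<or> N = carrier ?N"
  proof cases
    case 2
    have "f = (\<lambda>v\<in>carrier M. 0)" if f: "f \<in> N" for f
    proof -
      have "restrict f (carrier M) = (\<lambda>v\<in>carrier M. 0)"
        using 2 f by (intro restrict_ext) (auto simp: Z_def)
      then show ?thesis using functional_ext[of f] N f by auto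
    qed
    then have "N = {\<lambda>v\<in>carrier M. 0}" using N_zero by blast
    then show ?thesis by (simp add: dual_module_simps)
  next
    case 1
    \<comment> \<open>values of the elements of \<open>N\<close> on the frame, which determine them\<close>
    define S where "S = (\<lambda>f b. if b \<in> B then f b else 0) ` N"
    have Bc: "b \<in> carrier M" if "b \<in> B" for b using B that by (auto simp: underlying_space_simps)
    have S_add: "(\<lambda>b. s b + t b) \<in> S" if "s \<in> S" "t \<in> S" for s t
    proof -
      from that obtain f g where "f \<in> N" "g \<in> N" "s = (\<lambda>b. if b \<in> B then f b else 0)"
        "t = (\<lambda>b. if b \<in> B then g b else 0)" by (auto simp: S_def)
      then show ?thesis
        unfolding S_def by (intro image_eqI[OF _ N_add[of f g]]) (auto simp: Bc)
    qed
    have S_scale: "(\<lambda>b. c * s b) \<in> S" if "s \<in> S" for c s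
    proof -
      from that obtain f where "f \<in> N" "s = (\<lambda>b. if b \<in> B then f b else 0)" by (auto simp: S_def)
      then show ?thesis
        unfolding S_def by (intro image_eqI[OF _ N_scale[of f c]]) (auto simp: Bc)
    qed
    obtain P w where P: "P \<subseteq> B" and w: "\<forall>p\<in>P. w p \<in> S"
      and piv: "\<And>s b. s \<in> S \<Longrightarrow> b \<in> B \<Longrightarrow> s b = (\<Sum>p\<in>P. s p * w p b)"
      using subspace_pivots[OF B(1) S_add S_scale] by blast
    have finP: "finite P" using P B by (auto intro: finite_subset)
    have "\<forall>p\<in>P. \<exists>f. f \<in> N \<and> w p = (\<lambda>b. if b \<in> B then f b else 0)" using w by (auto simp: S_def)
    then obtain \<psi> where \<psi>: "\<And>p. p \<in> P \<Longrightarrow> \<psi> p \<in> N"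
      "\<And>p. p \<in> P \<Longrightarrow> w p = (\<lambda>b. if b \<in> B then \<psi> p b else 0)" by metis
    have \<psi>d: "\<psi> p \<in> dual_space (underlying_space H M)" if "p \<in> P" for p using \<psi>(1)[OF that] N by auto
    have pivN: "f b = (\<Sum>p\<in>P. f p * \<psi> p b)" if f: "f \<in> N" and b: "b \<in> B" for f b
    proof -
      have "(\<lambda>b. if b \<in> B then f b else 0) \<in> S" using f by (auto simp: S_def)
      from piv[OF this b] have "f b = (\<Sum>p\<in>P. (if p \<in> B then f p else 0) * w p b)" using b by simp
      also have "\<dots> = (\<Sum>p\<in>P. f p * \<psi> p b)" using P b by (intro sum.cong) (auto simp: \<psi>(2))
      finally show ?thesis .
    qed
    have N_span: "f v = (\<Sum>p\<in>P. f p * \<psi> p v)" if f: "f \<in> N" and v: "v \<in> carrier M" for f v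
    proof -
      have "f v = (\<Sum>b\<in>B. F b v * (\<Sum>p\<in>P. f p * \<psi> p b))"
        using expand[of f v] f v N by (subst (asm) sum.cong[OF refl arg_cong[OF pivN[OF f]]]) auto
      also have "\<dots> = (\<Sum>p\<in>P. f p * (\<Sum>b\<in>B. F b v * \<psi> p b))"
        unfolding sum_distrib_left by (subst sum.swap) (simp add: algebra_simps)
      also have "\<dots> = (\<Sum>p\<in>P. f p * \<psi> p v)"
        using expand[OF \<psi>d v] by (intro sum.cong) auto
      finally show ?thesis .
    qed
    obtain Q u where Q: "Q \<subseteq> P" and u: "u \<in> Q \<rightarrow> carrier (underlying_space H M)"
      and pivQ: "\<And>p v. \<lbrakk>p \<in> P; v \<in> carrier (underlying_space H M)\<rbrakk> \<Longrightarrow> \<psi> p v = (\<Sum>q\<in>Q. \<psi> q v * \<psi> p (u q))"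
      by (rule U.functionals_pivots[of P \<psi>, OF finP \<psi>d]) (assumption, rule that)
    have finQ: "finite Q" using Q finP by (auto intro: finite_subset)
    have "\<theta> \<in> N" if \<theta>: "\<theta> \<in> dual_space (underlying_space H M)" for \<theta>
    proof -
      have eq: "\<theta> v = (\<Sum>q\<in>Q. \<theta> (u q) * \<psi> q v)" if v: "v \<in> carrier M" for v
      proof -
        have v': "v \<in> carrier (underlying_space H M)" using v by (simp add: underlying_space_simps)
        \<comment> \<open>the difference of \<open>v\<close> and \<open>s\<close> lies in the common kernel of the \<open>\<psi> p\<close>, which is zero\<close>
        define s where "s = (\<Oplus>\<^bsub>underlying_space H M\<^esub>q\<in>Q. \<psi> q v \<odot>\<^bsub>underlying_space H M\<^esub> u q)"
        have s: "s \<in> carrier (underlying_space H M)" using u by (simp add: s_def)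
        define d where "d = v \<oplus>\<^bsub>underlying_space H M\<^esub> (- 1) \<odot>\<^bsub>underlying_space H M\<^esub> s"
        have d: "d \<in> carrier (underlying_space H M)" using v' s by (simp add: d_def)
        have fd: "f d = f v - f s" if "f \<in> dual_space (underlying_space H M)" for f
          using v' s U.dual_space_add[OF that, of v "(- 1) \<odot>\<^bsub>underlying_space H M\<^esub> s"]
            U.dual_space_scale[OF that s, of "- 1"] by (simp add: d_def)
        have fs: "f s = (\<Sum>q\<in>Q. \<psi> q v * f (u q))" if "f \<in> dual_space (underlying_space H M)" for f
          unfolding s_def by (rule U.dual_space_lincomb[OF that finQ u])
        have "\<psi> p d = 0" if p: "p \<in> P" for p
          using fd[OF \<psi>d[OF p]] fs[OF \<psi>d[OF p]] pivQ[OF p v'] by simp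
        then have "f d = 0" if "f \<in> N" for f
          using N_span[OF that, of d] d by (simp add: underlying_space_simps)
        then have "d \<in> Z" using d by (simp add: Z_def underlying_space_simps)
        then have "\<theta> d = 0" using 1 U.dual_space_zero[OF \<theta>] by (simp add: underlying_space_simps)
        then show ?thesis using fd[OF \<theta>] fs[OF \<theta>] by (simp add: mult.commute)
      qed
      have "(\<lambda>v\<in>carrier M. \<Sum>q\<in>R. \<theta> (u q) * \<psi> q v) \<in> N" if "finite R" "R \<subseteq> Q" for R
        using that
      proof (induction R)
        case empty
        show ?case using N_zero by (simp only: sum.empty)
      next
        case (insert q R)
        then have "\<psi> q \<in> N" using \<psi>(1) Q by auto
        have "(\<lambda>v\<in>carrier M. \<Sum>q\<in>insert q R. \<theta> (u q) * \<psi> q v) = (\<lambda>v\<in>carrier M.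
            (\<lambda>v\<in>carrier M. \<theta> (u q) * \<psi> q v) v + (\<lambda>v\<in>carrier M. \<Sum>q\<in>R. \<theta> (u q) * \<psi> q v) v)"
          using insert.hyps by (intro restrict_ext) simp
        also have "\<dots> \<in> N"
          using \<open>\<psi> q \<in> N\<close> insert by (intro N_add N_scale) auto
        finally show ?case .
      qed
      from this[OF finQ order_refl] have "(\<lambda>v\<in>carrier M. \<Sum>q\<in>Q. \<theta> (u q) * \<psi> q v) \<in> N" .
      also have "(\<lambda>v\<in>carrier M. \<Sum>q\<in>Q. \<theta> (u q) * \<psi> q v) = restrict \<theta> (carrier M)"
        using eq by (intro restrict_ext) simp
      finally show ?thesis by (simp only: functional_ext[OF \<theta>])
    qed
    then show ?thesis using N by (auto simp: dual_module_simps)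
  qed
qed

end

text \<open>
  Since \<open>f (S x v)\<close> is the value of \<open>x f\<close> at \<open>v\<close>, composing a coordinate function of \<open>M\<close> with the
  antipode gives a coordinate function of the dual module, for the vector \<open>f\<close> and the functional
  \<open>e\<close> that evaluates at \<open>v\<close>.
\<close>

lemma simple_coordinate_functions_antipode:
  assumes "c \<in> simple_coordinate_functions H"
  shows "antipode D c \<in> simple_coordinate_functions H"
proof -
  obtain M :: "('a, nat \<Rightarrow> 'k) module" and f v where c: "c = coordinate_function H M f v"
    and simple: "simple_module H M" and fd: "fin_dim (underlying_space H M)"
    and f: "f \<in> dual_space (underlying_space H M)" and v: "v \<in> carrier M"
    using assms unfolding simple_coordinate_functions_def by blast
  have M: "left_module H M" using simple by (simp add: simple_module_def)
  interpret L: left_module H M by (rule M)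
  interpret N: left_module H "dual_module H M" by (rule dual_module_left_module[OF M])
  define e where "e = (\<lambda>g\<in>carrier (dual_module H M). g v)"
  have e: "e \<in> dual_space (underlying_space H (dual_module H M))"
    using v N.M.a_closed N.smult_closed[OF scale_closed[OF one_closed]]
    by (simp add: dual_space_def[of "underlying_space H (dual_module H M)"] e_def
        underlying_space_simps dual_module_simps(3,4)[OF M] antipode_scale antipode_one)
      (simp add: dual_module_simps[OF M] functional_scale[OF M])
  have "antipode D c = coordinate_function H (dual_module H M) e f"
  proof -
    have "c (antipode H x) = e (x \<odot>\<^bsub>dual_module H M\<^esub> f)" if x: "x \<in> carrier H" for x
      using N.smult_closed[OF x, of f] x v f
      by (simp add: c coordinate_function_def e_def dual_module_simps[OF M])
    then show ?thesis
      unfolding coordinate_function_def[of H "dual_module H M"] finite_dual_simps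
      by (intro restrict_ext)
  qed
  also have "\<dots> \<in> simple_coordinate_functions H"
    by (rule coordinate_function_simple)
      (use dual_module_simple[OF M simple fd] dual_module_fin_dim[OF M fd] e f
        in \<open>simp_all add: dual_module_simps[OF M]\<close>)
  finally show ?thesis .
qed

text \<open>
  The elements of \<open>A\<close> that split into elements of \<open>A\<close>, and those that the antipode maps into \<open>A\<close>, form
  subalgebras.  Both contain the coordinate functions of simple modules, so they are all of \<open>A\<close>.
\<close>

theorem sub_hopf_algebra_simple_coordinate_functions:
  "sub_hopf_algebra (generated_subalgebra D (simple_coordinate_functions H)) D"
proof -
  let ?A = "generated_subalgebra D (simple_coordinate_functions H)"
  have A: "k_subalgebra ?A D"
    by (rule generated_subalgebra_subalgebra[OF simple_coordinate_functions_finite_dual])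
  note sup = generated_subalgebra_superset[of "simple_coordinate_functions H"]
  note A_rules = k_subalgebraD[OF A]
  have Ac: "?A \<subseteq> finite_dual_carrier H" by (rule A_rules(1))
  have Ad: "f \<in> dual_space H" if "f \<in> ?A" for f
    using that Ac finite_dual_carrierD(1) by blast
  have "k_subalgebra {f \<in> ?A. splits H ?A f} D"
  proof (rule k_subalgebraI)
    show "\<one>\<^bsub>D\<^esub> \<in> {f \<in> ?A. splits H ?A f}"
      using A_rules(2) splits_counit by simp
    show "f \<oplus>\<^bsub>D\<^esub> g \<in> {f \<in> ?A. splits H ?A f}"
      if "f \<in> {f \<in> ?A. splits H ?A f}" "g \<in> {f \<in> ?A. splits H ?A f}" for f g
      using that A_rules(3)[of f g] splits_add by simp
    show "c \<odot>\<^bsub>D\<^esub> f \<in> {f \<in> ?A. splits H ?A f}" if "f \<in> {f \<in> ?A. splits H ?A f}" for c f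
      using that A_rules(5)[of f c] splits_scale[of ?A f c] A_rules(5)[of _ c] by simp
    show "f \<otimes>\<^bsub>D\<^esub> g \<in> {f \<in> ?A. splits H ?A f}"
      if "f \<in> {f \<in> ?A. splits H ?A f}" "g \<in> {f \<in> ?A. splits H ?A f}" for f g
      using that A_rules(4) Ad by (auto intro!: splits_conv simp del: finite_dual_simps)
  qed (use Ac in auto)
  moreover have "simple_coordinate_functions H \<subseteq> {f \<in> ?A. splits H ?A f}"
    using sup splits_mono[OF simple_coordinate_functions_splits(2) sup] by (auto simp only: mem_Collect_eq)
  ultimately have "?A \<subseteq> {f \<in> ?A. splits H ?A f}" by (rule generated_subalgebra_least)
  then have splits_A: "splits H ?A f" if "f \<in> ?A" for f using that by blast
  have "k_subalgebra {f \<in> ?A. antipode D f \<in> ?A} D"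
  proof (rule k_subalgebraI)
    have "antipode D \<one>\<^bsub>D\<^esub> = \<one>\<^bsub>D\<^esub>" by (simp add: counit_antipode cong: restrict_cong)
    then show "\<one>\<^bsub>D\<^esub> \<in> {f \<in> ?A. antipode D f \<in> ?A}" using A_rules(2) by (simp del: finite_dual_simps)
    show "f \<oplus>\<^bsub>D\<^esub> g \<in> {f \<in> ?A. antipode D f \<in> ?A}"
      if "f \<in> {f \<in> ?A. antipode D f \<in> ?A}" "g \<in> {f \<in> ?A. antipode D f \<in> ?A}" for f g
    proof -
      have "antipode D (f \<oplus>\<^bsub>D\<^esub> g) = antipode D f \<oplus>\<^bsub>D\<^esub> antipode D g" by (simp cong: restrict_cong)
      then show ?thesis using that A_rules(3) by (simp del: finite_dual_simps)
    qed
    show "c \<odot>\<^bsub>D\<^esub> f \<in> {f \<in> ?A. antipode D f \<in> ?A}" if "f \<in> {f \<in> ?A. antipode D f \<in> ?A}" for c f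
    proof -
      have "antipode D (c \<odot>\<^bsub>D\<^esub> f) = c \<odot>\<^bsub>D\<^esub> antipode D f" by (simp cong: restrict_cong)
      then show ?thesis using that A_rules(5) by (simp del: finite_dual_simps)
    qed
    show "f \<otimes>\<^bsub>D\<^esub> g \<in> {f \<in> ?A. antipode D f \<in> ?A}"
      if "f \<in> {f \<in> ?A. antipode D f \<in> ?A}" "g \<in> {f \<in> ?A. antipode D f \<in> ?A}" for f g
    proof -
      have fg: "f \<in> finite_dual_carrier H" "g \<in> finite_dual_carrier H" using that Ac by auto
      have "antipode D (f \<otimes>\<^bsub>D\<^esub> g) = (\<lambda>x\<in>carrier H. (f \<otimes>\<^bsub>D\<^esub> g) (antipode H x))" by simp
      also have "\<dots> = (\<lambda>x\<in>carrier H. (antipode D g \<otimes>\<^bsub>D\<^esub> antipode D f) x)"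
        by (intro restrict_ext conv_antipode fg)
      also have "\<dots> = antipode D g \<otimes>\<^bsub>D\<^esub> antipode D f" by (simp cong: restrict_cong)
      finally show ?thesis using that A_rules(4) by (simp del: finite_dual_simps)
    qed
  qed (use Ac in auto)
  moreover have "simple_coordinate_functions H \<subseteq> {f \<in> ?A. antipode D f \<in> ?A}"
    using sup subsetD[OF sup simple_coordinate_functions_antipode] by (auto simp only: mem_Collect_eq)
  ultimately have "?A \<subseteq> {f \<in> ?A. antipode D f \<in> ?A}" by (rule generated_subalgebra_least)
  then have antipode_A: "antipode D f \<in> ?A" if "f \<in> ?A" for f using that by blast
  show ?thesis
    unfolding sub_hopf_algebra_def
    using A comult_finite_dual[OF Ac splits_A] antipode_A by blast
qed

end

section \<open>The Hopf algebra $U_{g,h}$\<close>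

lemma k_algebra_cong:
  fixes H :: "('k::field, 'a, 'm) module_scheme" and H' :: "('k, 'a, 'n) module_scheme"
  assumes "k_algebra H"
    and eq: "carrier H' = carrier H" "monoid.mult H' = monoid.mult H" "one H' = one H"
      "ring.zero H' = ring.zero H" "add H' = add H" "module.smult H' = module.smult H"
  shows "k_algebra H'"
proof -
  interpret k_algebra H by fact
  have add: "abelian_group H'"
  proof (rule abelian_groupI)
    fix x assume "x \<in> carrier H'"
    then show "\<exists>y\<in>carrier H'. y \<oplus>\<^bsub>H'\<^esub> x = \<zero>\<^bsub>H'\<^esub>"
      by (intro bexI[of _ "\<ominus>\<^bsub>H\<^esub> x"]) (simp_all add: eq l_neg)
  qed (simp_all add: eq a_ac)
  have ring: "ring H'"
    by (intro ringI add monoidI) (simp_all add: eq m_assoc l_distr r_distr)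
  show ?thesis
    by (intro k_algebra.intro k_space.intro ring add k_algebra_axioms.intro k_space_axioms.intro)
      (simp_all add: eq scale_add_left scale_add_right scale_scale scale_mult_left scale_mult_right)
qed

lemma opposite_algebra_simps [simp]:
  "carrier (opposite_algebra H) = carrier H"
  "x \<otimes>\<^bsub>opposite_algebra H\<^esub> y = y \<otimes>\<^bsub>H\<^esub> x"
  "\<one>\<^bsub>opposite_algebra H\<^esub> = \<one>\<^bsub>H\<^esub>"
  "\<zero>\<^bsub>opposite_algebra H\<^esub> = \<zero>\<^bsub>H\<^esub>"
  "x \<oplus>\<^bsub>opposite_algebra H\<^esub> y = x \<oplus>\<^bsub>H\<^esub> y"
  "c \<odot>\<^bsub>opposite_algebra H\<^esub> x = c \<odot>\<^bsub>H\<^esub> x"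
  by (simp_all add: opposite_algebra_def)

lemma (in k_algebra) opposite_k_algebra: "k_algebra (opposite_algebra H)"
proof -
  let ?O = "opposite_algebra H"
  have add: "abelian_group ?O"
  proof (rule abelian_groupI)
    fix x assume "x \<in> carrier ?O"
    then show "\<exists>y\<in>carrier ?O. y \<oplus>\<^bsub>?O\<^esub> x = \<zero>\<^bsub>?O\<^esub>"
      by (intro bexI[of _ "\<ominus> x"]) (simp_all add: l_neg)
  qed (simp_all add: a_ac)
  have ring: "ring ?O"
    by (intro ringI add monoidI) (simp_all add: m_assoc l_distr r_distr)
  show ?thesis
    by (intro k_algebra.intro k_space.intro ring add k_algebra_axioms.intro k_space_axioms.intro)
      (simp_all add: scale_add_left scale_add_right scale_scale scale_mult_left scale_mult_right)
qed

lemma scalar_algebra_simps [simp]: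
  "carrier scalar_algebra = UNIV"
  "x \<otimes>\<^bsub>scalar_algebra\<^esub> y = x * y"
  "\<one>\<^bsub>scalar_algebra\<^esub> = 1"
  "\<zero>\<^bsub>scalar_algebra\<^esub> = 0"
  "x \<oplus>\<^bsub>scalar_algebra\<^esub> y = x + y"
  "c \<odot>\<^bsub>scalar_algebra\<^esub> x = c * x"
  by (simp_all add: scalar_algebra_def ring_of_type_algebra_def ring.defs module.defs)

lemma scalar_k_algebra: "k_algebra (scalar_algebra :: ('k::field, 'k) module)"
proof -
  let ?F = "scalar_algebra :: ('k, 'k) module"
  have add: "abelian_group ?F"
  proof (rule abelian_groupI)
    fix x assume "x \<in> carrier ?F"
    show "\<exists>y\<in>carrier ?F. y \<oplus>\<^bsub>?F\<^esub> x = \<zero>\<^bsub>?F\<^esub>" by (rule bexI[of _ "- x"]) auto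
  qed (auto simp: algebra_simps)
  have ring: "ring ?F"
    by (intro ringI add monoidI) (auto simp: algebra_simps)
  show "k_algebra ?F"
    by (intro k_algebra.intro k_space.intro ring add k_algebra_axioms.intro k_space_axioms.intro)
      (auto simp: algebra_simps)
qed

context k_algebra
begin

lemma diff_self_eq: "\<lbrakk>x = y; y \<in> carrier H\<rbrakk> \<Longrightarrow> x \<ominus> y = \<zero>"
  by (simp add: a_minus_def r_neg)

text \<open>
  Commutation rules for an invertible element pass to its inverse; the presentation states them for the
  generators \<open>K\<close>, \<open>g\<close> and \<open>h\<close> but not for their inverses.
\<close>

lemma inverse_q_commute:
  assumes "a \<in> carrier H" "b \<in> carrier H" "x \<in> carrier H" "a \<otimes> b = \<one>" "b \<otimes> a = \<one>"
    and comm: "a \<otimes> x = c \<odot> (x \<otimes> a)" and "c \<noteq> 0"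
  shows "b \<otimes> x = inverse c \<odot> (x \<otimes> b)"
proof -
  have "x \<otimes> b = b \<otimes> (a \<otimes> x) \<otimes> b" using assms(1-3,5) by (simp add: m_assoc[symmetric])
  also have "\<dots> = c \<odot> (b \<otimes> (x \<otimes> (a \<otimes> b)))"
    using assms(1-3) by (simp add: comm scale_mult_left scale_mult_right m_assoc)
  also have "\<dots> = c \<odot> (b \<otimes> x)" using assms by simp
  finally show ?thesis using assms by (simp add: scale_scale)
qed

lemma inverse_commute:
  assumes "a \<in> carrier H" "b \<in> carrier H" "x \<in> carrier H" "a \<otimes> b = \<one>" "b \<otimes> a = \<one>"
    and "a \<otimes> x = x \<otimes> a"
  shows "b \<otimes> x = x \<otimes> b"
  using inverse_q_commute[of a b x 1] assms by simp

text \<open>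
  With products associated to the right, a rewriting rule for \<open>a x\<close> does not apply to
  \<open>a (x y)\<close>; this lemma and the two after it supply the missing instances.
\<close>

lemma left_mult_eq:
  assumes "a \<in> carrier H" "x \<in> carrier H" "y \<in> carrier H" "a \<otimes> x = x \<otimes> a"
  shows "a \<otimes> (x \<otimes> y) = x \<otimes> (a \<otimes> y)"
  using assms by (metis m_assoc)

lemma left_mult_eq_scale:
  assumes "a \<in> carrier H" "x \<in> carrier H" "y \<in> carrier H" "a \<otimes> x = c \<odot> (x \<otimes> a)"
  shows "a \<otimes> (x \<otimes> y) = c \<odot> (x \<otimes> (a \<otimes> y))"
proof -
  have "a \<otimes> (x \<otimes> y) = (a \<otimes> x) \<otimes> y" using assms(1-3) by (simp add: m_assoc)
  also have "\<dots> = c \<odot> (x \<otimes> (a \<otimes> y))" using assms(1-3) by (simp add: assms(4) scale_mult_left m_assoc)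
  finally show ?thesis .
qed

lemma left_mult_cancel:
  assumes "a \<in> carrier H" "x \<in> carrier H" "y \<in> carrier H" "a \<otimes> x = \<one>"
  shows "a \<otimes> (x \<otimes> y) = y"
  using assms by (metis m_assoc l_one)

end

abbreviation EF_coeff :: "'k::field \<Rightarrow> 'k"
  where "EF_coeff q \<equiv> inverse (q - inverse q)"

text \<open>
  The relators are differences; here they are stated as equations, and the one for \<open>E\<close> and \<open>F\<close>
  without subtraction, so that both sides can be expanded into sums of scaled words and compared.
\<close>

lemma U_presentation_hom:
  fixes B :: "('k::field, 'b, 'm) module_scheme" (structure)
  assumes "k_algebra B" and [simp]: "\<And>s. \<phi> s \<in> carrier B"
    and "\<phi> GK \<otimes> \<phi> GKi = \<one>" "\<phi> GKi \<otimes> \<phi> GK = \<one>" "\<phi> Gg \<otimes> \<phi> Ggi = \<one>" "\<phi> Ggi \<otimes> \<phi> Gg = \<one>"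
      "\<phi> Gh \<otimes> \<phi> Ghi = \<one>" "\<phi> Ghi \<otimes> \<phi> Gh = \<one>"
    and "\<phi> Gg \<otimes> \<phi> Gh = \<phi> Gh \<otimes> \<phi> Gg"
      "\<phi> Gg \<otimes> \<phi> GE = \<phi> GE \<otimes> \<phi> Gg" "\<phi> Gg \<otimes> \<phi> GF = \<phi> GF \<otimes> \<phi> Gg" "\<phi> Gg \<otimes> \<phi> GK = \<phi> GK \<otimes> \<phi> Gg"
      "\<phi> Gh \<otimes> \<phi> GE = \<phi> GE \<otimes> \<phi> Gh" "\<phi> Gh \<otimes> \<phi> GF = \<phi> GF \<otimes> \<phi> Gh" "\<phi> Gh \<otimes> \<phi> GK = \<phi> GK \<otimes> \<phi> Gh"
    and "\<phi> GK \<otimes> \<phi> GE \<otimes> \<phi> GKi = q\<^sup>2 \<odot> \<phi> GE"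
      "\<phi> GK \<otimes> \<phi> GF \<otimes> \<phi> GKi = inverse (q\<^sup>2) \<odot> \<phi> GF"
    and EF: "\<phi> GE \<otimes> \<phi> GF = \<phi> GF \<otimes> \<phi> GE \<oplus>
      (EF_coeff q \<odot> \<phi> GK \<oplus> (- EF_coeff q) \<odot> (\<phi> GKi \<otimes> (\<phi> Gg \<otimes> \<phi> Gg)))"
  shows "presentation_hom (U_rels q) B \<phi>"
proof -
  interpret k_algebra B by fact
  have "\<phi> GE \<otimes> \<phi> GF \<ominus> \<phi> GF \<otimes> \<phi> GE
      = EF_coeff q \<odot> (\<phi> GK \<ominus> \<phi> GKi \<otimes> (\<phi> Gg \<otimes> \<phi> Gg))"
  proof -
    have "EF_coeff q \<odot> (\<phi> GK \<ominus> \<phi> GKi \<otimes> (\<phi> Gg \<otimes> \<phi> Gg))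
        = EF_coeff q \<odot> \<phi> GK \<oplus> (- EF_coeff q) \<odot> (\<phi> GKi \<otimes> (\<phi> Gg \<otimes> \<phi> Gg))"
      by (simp add: a_minus_def scale_add_right scale_scale flip: scale_minus_one)
    moreover have "\<phi> GE \<otimes> \<phi> GF \<ominus> \<phi> GF \<otimes> \<phi> GE
        = EF_coeff q \<odot> \<phi> GK \<oplus> (- EF_coeff q) \<odot> (\<phi> GKi \<otimes> (\<phi> Gg \<otimes> \<phi> Gg))"
      unfolding EF a_minus_def by (simp add: a_ac r_neg r_neg1 r_neg2)
    ultimately show ?thesis by simp
  qed
  with assms(3-17) have "eval_free B \<phi> r = \<zero>" if "r \<in> U_rels q" for r
    using that unfolding U_rels_def Let_def
    by (elim insertE emptyE)
      (simp_all add: diff_self_eq power2_eq_square[of "letter _"] scale_mult_left)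
  then show ?thesis
    by (intro presentation_hom.intro presentation_hom_axioms.intro k_algebra_axioms) auto
qed

locale U_parameter =
  fixes q :: "'k::field"
  assumes q_nonzero: "q \<noteq> 0"
begin

abbreviation "U \<equiv> U_alg q"
abbreviation "uE \<equiv> U_gen q GE"
abbreviation "uF \<equiv> U_gen q GF"
abbreviation "uK \<equiv> U_gen q GK"
abbreviation "uKi \<equiv> U_gen q GKi"
abbreviation "ug \<equiv> U_gen q Gg"
abbreviation "ugi \<equiv> U_gen q Ggi"
abbreviation "uh \<equiv> U_gen q Gh"
abbreviation "uhi \<equiv> U_gen q Ghi"

sublocale pres: presentation "U_rels q" rewrites "presented_algebra (U_rels q) = U_alg q"
  by (simp_all add: U_alg_def)

lemma U_gen_proj: "U_gen q s = pres.proj (letter s)"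
  by (simp add: U_gen_def)

lemma U_gen_closed [simp]: "U_gen q s \<in> carrier U"
  by (simp add: U_gen_proj pres.proj_simps)

lemma relations:
  "uK \<otimes>\<^bsub>U\<^esub> uKi = \<one>\<^bsub>U\<^esub>" "uKi \<otimes>\<^bsub>U\<^esub> uK = \<one>\<^bsub>U\<^esub>"
  "ug \<otimes>\<^bsub>U\<^esub> ugi = \<one>\<^bsub>U\<^esub>" "ugi \<otimes>\<^bsub>U\<^esub> ug = \<one>\<^bsub>U\<^esub>"
  "uh \<otimes>\<^bsub>U\<^esub> uhi = \<one>\<^bsub>U\<^esub>" "uhi \<otimes>\<^bsub>U\<^esub> uh = \<one>\<^bsub>U\<^esub>"
  "ug \<otimes>\<^bsub>U\<^esub> uh = uh \<otimes>\<^bsub>U\<^esub> ug"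
  "ug \<otimes>\<^bsub>U\<^esub> uE = uE \<otimes>\<^bsub>U\<^esub> ug" "ug \<otimes>\<^bsub>U\<^esub> uF = uF \<otimes>\<^bsub>U\<^esub> ug" "ug \<otimes>\<^bsub>U\<^esub> uK = uK \<otimes>\<^bsub>U\<^esub> ug"
  "uh \<otimes>\<^bsub>U\<^esub> uE = uE \<otimes>\<^bsub>U\<^esub> uh" "uh \<otimes>\<^bsub>U\<^esub> uF = uF \<otimes>\<^bsub>U\<^esub> uh" "uh \<otimes>\<^bsub>U\<^esub> uK = uK \<otimes>\<^bsub>U\<^esub> uh"
  "(uK \<otimes>\<^bsub>U\<^esub> uE) \<otimes>\<^bsub>U\<^esub> uKi = q\<^sup>2 \<odot>\<^bsub>U\<^esub> uE"
  "(uK \<otimes>\<^bsub>U\<^esub> uF) \<otimes>\<^bsub>U\<^esub> uKi = inverse (q\<^sup>2) \<odot>\<^bsub>U\<^esub> uF"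
  unfolding U_gen_proj pres.proj_simps mult_map_scale_conv_mult const_def[symmetric]
  by (rule pres.proj_cong, simp add: U_rels_def Let_def)+

lemma relation_EF: "uE \<otimes>\<^bsub>U\<^esub> uF = uF \<otimes>\<^bsub>U\<^esub> uE \<oplus>\<^bsub>U\<^esub>
    (EF_coeff q \<odot>\<^bsub>U\<^esub> uK \<oplus>\<^bsub>U\<^esub> (- EF_coeff q) \<odot>\<^bsub>U\<^esub> (uKi \<otimes>\<^bsub>U\<^esub> (ug \<otimes>\<^bsub>U\<^esub> ug)))"
proof -
  let ?E = "letter GE :: gen word \<Rightarrow>\<^sub>0 'k" and ?F = "letter GF :: gen word \<Rightarrow>\<^sub>0 'k"
    and ?K = "letter GK :: gen word \<Rightarrow>\<^sub>0 'k" and ?Ki = "letter GKi :: gen word \<Rightarrow>\<^sub>0 'k"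
    and ?g = "letter Gg :: gen word \<Rightarrow>\<^sub>0 'k"
  have "pres.proj (?E * ?F) = pres.proj (?F * ?E + const (EF_coeff q) * (?K - ?Ki * ?g\<^sup>2))"
    by (rule pres.proj_cong) (simp add: U_rels_def Let_def diff_diff_add[symmetric])
  also have "?F * ?E + const (EF_coeff q) * (?K - ?Ki * ?g\<^sup>2)
      = ?F * ?E + (pm_scale (EF_coeff q) ?K + pm_scale (- EF_coeff q) (?Ki * (?g * ?g)))"
    by (simp add: const_def mult_map_scale_conv_mult[symmetric] pm.scale_right_diff_distrib
        power2_eq_square)
  finally show ?thesis unfolding U_gen_proj pres.proj_simps .
qed

lemma K_commute:
  "uK \<otimes>\<^bsub>U\<^esub> uE = q\<^sup>2 \<odot>\<^bsub>U\<^esub> (uE \<otimes>\<^bsub>U\<^esub> uK)"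
  "uK \<otimes>\<^bsub>U\<^esub> uF = inverse (q\<^sup>2) \<odot>\<^bsub>U\<^esub> (uF \<otimes>\<^bsub>U\<^esub> uK)"
proof -
  have "uK \<otimes>\<^bsub>U\<^esub> x = ((uK \<otimes>\<^bsub>U\<^esub> x) \<otimes>\<^bsub>U\<^esub> uKi) \<otimes>\<^bsub>U\<^esub> uK" if "x \<in> carrier U" for x
    using that by (simp add: pres.P.m_assoc relations)
  from this[of uE] this[of uF] show
    "uK \<otimes>\<^bsub>U\<^esub> uE = q\<^sup>2 \<odot>\<^bsub>U\<^esub> (uE \<otimes>\<^bsub>U\<^esub> uK)"
    "uK \<otimes>\<^bsub>U\<^esub> uF = inverse (q\<^sup>2) \<odot>\<^bsub>U\<^esub> (uF \<otimes>\<^bsub>U\<^esub> uK)"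
    by (simp_all add: relations pres.P.scale_mult_left)
qed

lemma q2_nonzero: "q\<^sup>2 \<noteq> 0" "inverse (q\<^sup>2) \<noteq> 0"
  using q_nonzero by simp_all

lemmas Ki_commute =
  pres.P.inverse_q_commute[OF U_gen_closed U_gen_closed U_gen_closed relations(1,2) K_commute(1) q2_nonzero(1)]
  pres.P.inverse_q_commute[OF U_gen_closed U_gen_closed U_gen_closed relations(1,2) K_commute(2) q2_nonzero(2), unfolded inverse_inverse_eq]

lemmas g_commute = relations(8-10)
  pres.P.inverse_commute[OF U_gen_closed U_gen_closed U_gen_closed relations(1,2) relations(10)[symmetric],
    symmetric]

lemmas gi_commute = g_commute[THEN
    pres.P.inverse_commute[OF U_gen_closed U_gen_closed U_gen_closed relations(3,4)]]

lemmas h_commute = relations(11-13)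
  pres.P.inverse_commute[OF U_gen_closed U_gen_closed U_gen_closed relations(1,2) relations(13)[symmetric],
    symmetric]
  relations(7)[symmetric]
  pres.P.inverse_commute[OF U_gen_closed U_gen_closed U_gen_closed relations(3,4) relations(7), symmetric]

lemmas hi_commute = h_commute[THEN
    pres.P.inverse_commute[OF U_gen_closed U_gen_closed U_gen_closed relations(5,6)]]

lemmas central = g_commute gi_commute h_commute hi_commute

lemma relation_EF_left:
  assumes y: "y \<in> carrier U"
  shows "uE \<otimes>\<^bsub>U\<^esub> (uF \<otimes>\<^bsub>U\<^esub> y) = uF \<otimes>\<^bsub>U\<^esub> (uE \<otimes>\<^bsub>U\<^esub> y) \<oplus>\<^bsub>U\<^esub>
    (EF_coeff q \<odot>\<^bsub>U\<^esub> (uK \<otimes>\<^bsub>U\<^esub> y) \<oplus>\<^bsub>U\<^esub> (- EF_coeff q) \<odot>\<^bsub>U\<^esub> (uKi \<otimes>\<^bsub>U\<^esub> (ug \<otimes>\<^bsub>U\<^esub> (ug \<otimes>\<^bsub>U\<^esub> y))))"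
proof -
  have "uE \<otimes>\<^bsub>U\<^esub> (uF \<otimes>\<^bsub>U\<^esub> y) = (uE \<otimes>\<^bsub>U\<^esub> uF) \<otimes>\<^bsub>U\<^esub> y" using y by (simp add: pres.P.m_assoc)
  then show ?thesis
    unfolding relation_EF using y by (simp add: pres.P.l_distr pres.P.scale_mult_left pres.P.m_assoc)
qed

text \<open>
  A rewriting system for \<open>U\<close>: it brings words into the order \<open>F\<close>, \<open>E\<close>, \<open>K\<close>, \<open>g\<close>, \<open>h\<close> (each of the
  last three with its inverse) and pulls out scalars.
\<close>

lemmas normal_form =
  pres.P.m_assoc pres.P.l_distr pres.P.r_distr pres.P.scale_mult_left pres.P.scale_mult_right
  pres.P.scale_add_right pres.P.scale_scale
  relations(1-6) relations(1-6)[THEN pres.P.left_mult_cancel[OF U_gen_closed U_gen_closed, rotated]]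
  K_commute K_commute[THEN pres.P.left_mult_eq_scale[OF U_gen_closed U_gen_closed, rotated]]
  Ki_commute Ki_commute[THEN pres.P.left_mult_eq_scale[OF U_gen_closed U_gen_closed, rotated]]
  relation_EF relation_EF_left
  central central[THEN pres.P.left_mult_eq[OF U_gen_closed U_gen_closed, rotated]]

end

section \<open>The structure maps of $U_{g,h}$\<close>

context U_parameter
begin

interpretation TT: tensor_algebras U U by (intro tensor_algebras.intro pres.P.k_algebra_axioms)
interpretation T: k_algebra "tensor U U" by (rule TT.tensor_k_algebra)
interpretation O: k_algebra "opposite_algebra U" by (rule pres.P.opposite_k_algebra)

lemma square_pow: "x \<in> carrier U \<Longrightarrow> x [^]\<^bsub>U\<^esub> (2::nat) = x \<otimes>\<^bsub>U\<^esub> x"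
  by (simp add: numeral_2_eq_2)

lemma comult_gen_simps:
  "U_comult_gen q GE = TT.pt uhi uE \<oplus>\<^bsub>tensor U U\<^esub> TT.pt uE (uh \<otimes>\<^bsub>U\<^esub> uK)"
  "U_comult_gen q GF = TT.pt (uKi \<otimes>\<^bsub>U\<^esub> uh \<otimes>\<^bsub>U\<^esub> (ug \<otimes>\<^bsub>U\<^esub> ug)) uF \<oplus>\<^bsub>tensor U U\<^esub> TT.pt uF uhi"
  "U_comult_gen q GK = TT.pt uK uK" "U_comult_gen q GKi = TT.pt uKi uKi"
  "U_comult_gen q Gg = TT.pt ug ug" "U_comult_gen q Ggi = TT.pt ugi ugi"
  "U_comult_gen q Gh = TT.pt uh uh" "U_comult_gen q Ghi = TT.pt uhi uhi"
  by (simp_all add: U_comult_gen_def Let_def square_pow)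

lemmas tensor_normal_form = comult_gen_simps TT.pt_mult T.l_distr T.r_distr T.scale_mult_left
  T.scale_mult_right TT.T.scale_add_right TT.T.scale_scale TT.pt_scale_left TT.pt_scale_right
  TT.pt_add_left TT.pt_add_right normal_form TT.tensor_one[symmetric]

lemma comult_gen_closed [simp]: "U_comult_gen q s \<in> carrier (tensor U U)"
  by (cases s) (simp_all add: comult_gen_simps)

text \<open>
  All relations follow by comparing normal forms.  For the one between \<open>E\<close> and \<open>F\<close>, the mixed terms
  with \<open>E\<close> on the left and \<open>F\<close> on the right agree for both orders of multiplication, and the terms
  with \<open>K\<close> on the right and the inverse of \<open>K\<close> on the left cancel.
\<close>

lemma comult_presentation_hom: "presentation_hom (U_rels q) (tensor U U) (U_comult_gen q)"
proof (rule U_presentation_hom)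
  let ?c = "EF_coeff q"
  show "U_comult_gen q GE \<otimes>\<^bsub>tensor U U\<^esub> U_comult_gen q GF =
      U_comult_gen q GF \<otimes>\<^bsub>tensor U U\<^esub> U_comult_gen q GE \<oplus>\<^bsub>tensor U U\<^esub>
      (?c \<odot>\<^bsub>tensor U U\<^esub> U_comult_gen q GK \<oplus>\<^bsub>tensor U U\<^esub>
        (- ?c) \<odot>\<^bsub>tensor U U\<^esub> (U_comult_gen q GKi \<otimes>\<^bsub>tensor U U\<^esub>
          (U_comult_gen q Gg \<otimes>\<^bsub>tensor U U\<^esub> U_comult_gen q Gg)))"
    by (simp add: tensor_normal_form TT.T.a_ac TT.T.scale_cancel)
qed (simp_all add: tensor_normal_form TT.T.a_ac T.k_algebra_axioms)

lemma counit_presentation_hom: "presentation_hom (U_rels q) scalar_algebra U_counit_gen"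
  by (rule U_presentation_hom[OF scalar_k_algebra]) simp_all

lemma q2_cancel: "inverse (q\<^sup>2) * (q\<^sup>2 * c) = c" "q\<^sup>2 * (inverse (q\<^sup>2) * c) = c"
  "inverse (q\<^sup>2) * q\<^sup>2 = 1" "q\<^sup>2 * inverse (q\<^sup>2) = 1"
  using q_nonzero by simp_all

lemma antipode_gen_simps:
  "U_antipode_gen q GE = (- 1) \<odot>\<^bsub>U\<^esub> (uE \<otimes>\<^bsub>U\<^esub> uKi)"
  "U_antipode_gen q GF = (- 1) \<odot>\<^bsub>U\<^esub> (uK \<otimes>\<^bsub>U\<^esub> uF \<otimes>\<^bsub>U\<^esub> (ugi \<otimes>\<^bsub>U\<^esub> ugi))"
  "U_antipode_gen q GK = uKi" "U_antipode_gen q GKi = uK"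
  "U_antipode_gen q Gg = ugi" "U_antipode_gen q Ggi = ug"
  "U_antipode_gen q Gh = uhi" "U_antipode_gen q Ghi = uh"
  by (simp_all add: U_antipode_gen_def Let_def square_pow pres.P.scale_minus_one)

lemma antipode_gen_closed [simp]: "U_antipode_gen q s \<in> carrier U"
  by (cases s) (simp_all add: antipode_gen_simps)

lemma antipode_presentation_hom: "presentation_hom (U_rels q) (opposite_algebra U) (U_antipode_gen q)"
proof (rule U_presentation_hom)
  show "U_antipode_gen q GE \<otimes>\<^bsub>opposite_algebra U\<^esub> U_antipode_gen q GF =
      U_antipode_gen q GF \<otimes>\<^bsub>opposite_algebra U\<^esub> U_antipode_gen q GE \<oplus>\<^bsub>opposite_algebra U\<^esub>
      (EF_coeff q \<odot>\<^bsub>opposite_algebra U\<^esub> U_antipode_gen q GK \<oplus>\<^bsub>opposite_algebra U\<^esub>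
        (- EF_coeff q) \<odot>\<^bsub>opposite_algebra U\<^esub> (U_antipode_gen q GKi \<otimes>\<^bsub>opposite_algebra U\<^esub>
          (U_antipode_gen q Gg \<otimes>\<^bsub>opposite_algebra U\<^esub> U_antipode_gen q Gg)))"
    by (simp add: normal_form antipode_gen_simps pres.P.a_ac q2_cancel pres.P.scale_cancel)
qed (simp_all add: normal_form antipode_gen_simps O.k_algebra_axioms q_nonzero)


lemma U_gh_simps [simp]:
  "carrier (U_gh q) = carrier U"
  "monoid.mult (U_gh q) = monoid.mult U"
  "one (U_gh q) = one U"
  "ring.zero (U_gh q) = ring.zero U"
  "add (U_gh q) = add U"
  "module.smult (U_gh q) = module.smult U"
  "comult (U_gh q) = induced_hom (tensor U U) (U_comult_gen q)"
  "counit (U_gh q) = induced_hom scalar_algebra U_counit_gen"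
  "antipode (U_gh q) = induced_hom (opposite_algebra U) (U_antipode_gen q)"
  by (simp_all add: U_gh_def module.defs hopf.defs)

lemma tensor_U_gh: "tensor (U_gh q) (U_gh q) = tensor U U"
proof -
  have "tensor_null (U_gh q) (U_gh q) = tensor_null U U"
    by (simp add: tensor_null_def bilinear_rels_def)
  then have cls: "tensor_class (U_gh q) (U_gh q) = tensor_class U U"
    by (intro ext) (simp add: tensor_class_def)
  have "tensor_free_mult (U_gh q) (U_gh q) = tensor_free_mult U U"
    by (intro ext) (simp add: tensor_free_mult_def)
  with cls show ?thesis by (simp add: tensor_def pure_tensor_def)
qed

interpretation \<Delta>: presentation_hom "U_rels q" "tensor U U" "U_comult_gen q"
  rewrites "presented_algebra (U_rels q) = U_alg q"
  by (rule comult_presentation_hom) (simp add: U_alg_def)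

interpretation \<epsilon>: presentation_hom "U_rels q" scalar_algebra U_counit_gen
  rewrites "presented_algebra (U_rels q) = U_alg q"
  by (rule counit_presentation_hom) (simp add: U_alg_def)

interpretation S: presentation_hom "U_rels q" "opposite_algebra U" "U_antipode_gen q"
  rewrites "presented_algebra (U_rels q) = U_alg q"
  by (rule antipode_presentation_hom) (simp add: U_alg_def)

lemmas comult_simps = \<Delta>.induced_hom_simps[folded U_gen_proj]
lemmas counit_simps = \<epsilon>.induced_hom_simps[folded U_gen_proj, unfolded scalar_algebra_simps]
lemmas antipode_simps = S.induced_hom_simps[folded U_gen_proj, unfolded opposite_algebra_simps]

lemma U_gh_algebra_with_comult: "algebra_with_comult (U_gh q)"
  by (intro algebra_with_comult.intro algebra_with_comult_axioms.intro
      k_algebra_cong[OF pres.P.k_algebra_axioms])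
    (simp_all add: tensor_U_gh comult_simps counit_simps)

interpretation A: algebra_with_comult "U_gh q" by (rule U_gh_algebra_with_comult)

abbreviation "S \<equiv> induced_hom (opposite_algebra U) (U_antipode_gen q)"

lemma dual_U: "dual_space (U_gh q) = dual_space U"
  by (simp add: dual_space_def)

lemma antipode_dual:
  assumes "f \<in> dual_space (U_gh q)"
  shows "antipode (finite_dual (U_gh q)) f \<in> dual_space (U_gh q)"
  using A.dual_space_add[OF assms] A.dual_space_scale[OF assms]
  by (simp add: dual_space_def antipode_simps)

text \<open>
  The image of the antipode is a subalgebra; preimages of \<open>E\<close> and \<open>F\<close> are found by moving the
  invertible factors of the antipode of \<open>E\<close> and \<open>F\<close> to the other side, in reverse order.
\<close>

lemma antipode_surjective:
  assumes "t \<in> carrier U"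
  shows "\<exists>y\<in>carrier U. S y = t"
  using assms
proof (induction t rule: pres.presented_induct)
  case one
  show ?case by (rule bexI[of _ "\<one>\<^bsub>U\<^esub>"]) (simp_all add: antipode_simps)
next
  case (gen s)
  have "S ((- 1) \<odot>\<^bsub>U\<^esub> (uKi \<otimes>\<^bsub>U\<^esub> uE)) = uE"
    "S ((- 1) \<odot>\<^bsub>U\<^esub> (ugi \<otimes>\<^bsub>U\<^esub> (ugi \<otimes>\<^bsub>U\<^esub> (uF \<otimes>\<^bsub>U\<^esub> uK)))) = uF"
    "S uKi = uK" "S uK = uKi" "S ugi = ug" "S ug = ugi" "S uhi = uh" "S uh = uhi"
    by (simp_all add: antipode_simps antipode_gen_simps normal_form q2_cancel q_nonzero)
  then show ?case
    unfolding U_gen_proj[symmetric]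
    by (cases s) (metis U_gen_closed pres.P.m_closed pres.P.scale_closed)+
next
  case (mult x y)
  then obtain u v where "u \<in> carrier U" "v \<in> carrier U" "S u = x" "S v = y" by blast
  then show ?case by (intro bexI[of _ "v \<otimes>\<^bsub>U\<^esub> u"]) (simp_all add: antipode_simps)
next
  case (add x y)
  then obtain u v where "u \<in> carrier U" "v \<in> carrier U" "S u = x" "S v = y" by blast
  then show ?case by (intro bexI[of _ "u \<oplus>\<^bsub>U\<^esub> v"]) (simp_all add: antipode_simps)
next
  case (scale c x)
  then obtain u where "u \<in> carrier U" "S u = x" by blast
  then show ?case by (intro bexI[of _ "c \<odot>\<^bsub>U\<^esub> u"]) (simp_all add: antipode_simps)
qed

lemma counit_antipode_U:
  assumes "t \<in> carrier U"
  shows "counit (U_gh q) (S t) = counit (U_gh q) t"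
  using assms
proof (induction t rule: pres.presented_induct)
  case (gen s)
  show ?case
    unfolding U_gen_proj[symmetric]
    by (cases s) (simp_all add: antipode_simps antipode_gen_simps counit_simps)
qed (simp_all add: antipode_simps counit_simps)

text \<open>
  On the generators this compares the coproduct of the antipode of \<open>s\<close> with the antipodes applied
  to the exchanged factors of the coproduct of \<open>s\<close>; the forms are evaluated term by term.
\<close>

lemma conv_antipode_U:
  assumes t: "t \<in> carrier U" and "f \<in> finite_dual_carrier (U_gh q)" "g \<in> finite_dual_carrier (U_gh q)"
  shows "(f \<otimes>\<^bsub>finite_dual (U_gh q)\<^esub> g) (S t) = (antipode (finite_dual (U_gh q)) g \<otimes>\<^bsub>finite_dual (U_gh q)\<^esub>
    antipode (finite_dual (U_gh q)) f) t"
  using assms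
proof (induction t arbitrary: f g rule: pres.presented_induct)
  case (mult x y)
  show ?case
    using A.conv_antipode_mult[of x y f g] antipode_dual mult
    by (simp add: antipode_simps del: finite_dual_simps)
next
  case (gen s)
  define f' g' where "f' = antipode (finite_dual (U_gh q)) f" and "g' = antipode (finite_dual (U_gh q)) g"
  have eval: "f' x = f (S x)" "g' x = g (S x)" if "x \<in> carrier U" for x
    using that by (simp_all add: f'_def g'_def)
  have "f \<in> dual_space (U_gh q)" "g \<in> dual_space (U_gh q)"
    using gen by (simp_all add: finite_dual_carrier_def)
  then have dual: "f \<in> dual_space U" "g \<in> dual_space U" "f' \<in> dual_space U" "g' \<in> dual_space U"
    using antipode_dual by (simp_all add: dual_U f'_def g'_def del: finite_dual_simps)
  note bil = bilinear_form_dual[OF dual(1,2)] bilinear_form_dual[OF dual(4,3)]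
  note form = bil[THEN TT.tensor_form_add] bil[THEN TT.tensor_form_scale] bil[THEN TT.tensor_form_pt]
  have S_gen: "S (U_gen q s) \<in> carrier U" by (simp add: antipode_simps)
  have "tensor_form (\<lambda>a b. f a * g b) (induced_hom (tensor U U) (U_comult_gen q) (S (U_gen q s))) =
      tensor_form (\<lambda>a b. g' a * f' b) (induced_hom (tensor U U) (U_comult_gen q) (U_gen q s))"
    by (cases s)
      (simp_all add: antipode_simps antipode_gen_simps comult_simps tensor_normal_form form eval
        dual[THEN pres.P.dual_space_scale] q2_cancel)
  then show ?case
    using S_gen by (simp add: U_gen_proj[symmetric] f'_def g'_def)
next
  case one
  have "f \<in> dual_space (U_gh q)" "g \<in> dual_space (U_gh q)"
    using one by (simp_all add: finite_dual_carrier_def)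
  note dual = this this[THEN antipode_dual]
  note bil = bilinear_form_dual[OF dual(1,2)[unfolded dual_U]]
    bilinear_form_dual[OF dual(4,3)[unfolded dual_U]]
  have "tensor_form (\<lambda>a b. f a * g b) \<one>\<^bsub>tensor U U\<^esub> = f \<one>\<^bsub>U\<^esub> * g \<one>\<^bsub>U\<^esub>"
    "tensor_form (\<lambda>a b. antipode (finite_dual (U_gh q)) g a * antipode (finite_dual (U_gh q)) f b)
      \<one>\<^bsub>tensor U U\<^esub> = g \<one>\<^bsub>U\<^esub> * f \<one>\<^bsub>U\<^esub>"
    using bil[THEN TT.tensor_form_pt] by (simp_all add: TT.tensor_one antipode_simps)
  then show ?case by (simp add: antipode_simps comult_simps mult.commute)
next
  case (add x y)
  have "f \<in> dual_space (U_gh q)" "g \<in> dual_space (U_gh q)"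
    using add by (simp_all add: finite_dual_carrier_def)
  note conv = A.conv_dual[OF this] A.conv_dual[OF this(2,1)[THEN antipode_dual]]
  show ?case
    using conv[THEN A.dual_space_add] add by (simp add: antipode_simps del: finite_dual_simps)
next
  case (scale c x)
  have "f \<in> dual_space (U_gh q)" "g \<in> dual_space (U_gh q)"
    using scale by (simp_all add: finite_dual_carrier_def)
  note conv = A.conv_dual[OF this] A.conv_dual[OF this(2,1)[THEN antipode_dual]]
  show ?case
    using conv[THEN A.dual_space_scale] scale by (simp add: antipode_simps del: finite_dual_simps)
qed

lemma U_gh_algebra_with_antipode: "algebra_with_antipode (U_gh q)"
  by (intro algebra_with_antipode.intro algebra_with_antipode_axioms.intro U_gh_algebra_with_comult)
    (use counit_antipode_U conv_antipode_U antipode_surjective in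
      \<open>simp_all add: antipode_simps del: finite_dual_simps\<close>)

end

theorem corollary3p13:
  fixes q :: "'k :: {alg_closed_field, field_char_0}"
  assumes "q \<noteq> 0" and "q\<^sup>2 \<noteq> 1"
    and not_root_of_unity: "\<forall>n::nat. n > 0 \<longrightarrow> q ^ n \<noteq> 1"
  shows "sub_hopf_algebra
    (generated_subalgebra (finite_dual (U_gh q)) (simple_coordinate_functions (U_gh q)))
    (finite_dual (U_gh q))"
  by (intro algebra_with_antipode.sub_hopf_algebra_simple_coordinate_functions
      U_parameter.U_gh_algebra_with_antipode U_parameter.intro assms(1))

end
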